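(* Let $q\ge 2$ be an integer, put $n=q^2+q+1$, $m_q=\frac12 q(q+1)^2$ and $A_q=\frac{1}{2\sqrt q}\ln\frac{q+1+\sqrt q}{q+1-\sqrt q}$. Let $G$ be a connected $C_4$-free graph on $n$ vertices. Then $$\tau(G)\le n^{(n-3)/2}\exp\bigl(-2A_q(m_q-e(G))\bigr).$$ Equality holds if and only if $G$ is a polarity graph arising from a projective plane of order $q$.
   Context: All graphs are finite and simple. $e(G)$ is the number of edges of $G$ and $\tau(G)$ is the number of spanning trees of $G$. A graph is $C_4$-free if it contains no subgraph (not necessarily induced) isomorphic to the 4-cycle $C_4$. Being a polarity graph is understood up to graph isomorphism. A projective plane is an incidence structure of points and lines in which any two distinct points lie on a unique line, any two distinct lines meet in a unique point, and there exist four points no three of which are collinear. It has order $q$ if every line contains exactly $q+1$ points; it then has $q^2+q+1$ points and $q^2+q+1$ lines, and each point lies on exactly $q+1$ lines. Let $\Pi$ be a finite projective plane of order $q$ with point set $\mathcal P$ and line set $\mathcal L$. A polarity $\varphi$ of $\Pi$ is a bijection $\varphi:\mathcal P\cup\mathcal L\to\mathcal P\cup\mathcal L$ with $\varphi(\mathcal P)=\mathcal L$, $\varphi(\mathcal L)=\mathcal P$, $\varphi^2$ the identity, and, for every point $x$ and line $\ell$, $x\in\ell$ if and only if $\varphi(\ell)\in\varphi(x)$. The polarity graph $G(\varphi)$ is the simple graph with vertex set $\mathcal P$ in which two distinct points $x,y$ are adjacent if and only if $x\in\varphi(y)$. A polarity graph arising from a projective plane of order $q$ is a graph of the form $G(\varphi)$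 for some polarity $\varphi$ of some projective plane of order $q$. *)

theory Defs
  imports Complex_Main
begin

section \<open>Simple graphs\<close>

record 'a graph =
  vertices :: "'a set"
  edges :: "'a set set"

definition simple_graph :: "'a graph \<Rightarrow> bool" where
  "simple_graph G \<longleftrightarrow> finite (vertices G) \<and>
     edges G \<subseteq> {{u, v} | u v. u \<in> vertices G \<and> v \<in> vertices G \<and> u \<noteq> v}"

definition subgraph_of :: "'a graph \<Rightarrow> 'a graph \<Rightarrow> bool" where
  "subgraph_of H G \<longleftrightarrow>
     simple_graph H \<and> vertices H \<subseteq> vertices G \<and> edges H \<subseteq> edges G"

definition graph_iso :: "'a graph \<Rightarrow> 'b graph \<Rightarrow> bool" where
  "graph_iso G H \<longleftrightarrow> (\<exists>f. bij_betw f (vertices G) (vertices H) \<and>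
     (\<forall>u\<in>vertices G. \<forall>v\<in>vertices G. {u, v} \<in> edges G \<longleftrightarrow> {f u, f v} \<in> edges H))"

definition connected_graph :: "'a graph \<Rightarrow> bool" where
  "connected_graph G \<longleftrightarrow> vertices G \<noteq> {} \<and>
     (\<forall>u\<in>vertices G. \<forall>v\<in>vertices G. (u, v) \<in> {(x, y). {x, y} \<in> edges G}\<^sup>*)"

text \<open>A cycle is given by the list of its vertices, without repeating the first one at the end.\<close>

definition graph_cycle :: "'a graph \<Rightarrow> 'a list \<Rightarrow> bool" where
  "graph_cycle G xs \<longleftrightarrow> length xs \<ge> 3 \<and> distinct xs \<and> set xs \<subseteq> vertices G \<and>
     (\<forall>i<length xs. {xs ! i, xs ! (Suc i mod length xs)} \<in> edges G)"

definition tree_graph :: "'a graph \<Rightarrow> bool" where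
  "tree_graph T \<longleftrightarrow> simple_graph T \<and> connected_graph T \<and> (\<nexists>xs. graph_cycle T xs)"

definition spanning_trees :: "'a graph \<Rightarrow> 'a graph set" where
  "spanning_trees G = {T. subgraph_of T G \<and> vertices T = vertices G \<and> tree_graph T}"

definition num_spanning_trees :: "'a graph \<Rightarrow> nat" where
  "num_spanning_trees G = card (spanning_trees G)"

definition num_edges :: "'a graph \<Rightarrow> nat" where
  "num_edges G = card (edges G)"

definition C4 :: "nat graph" where
  "C4 = \<lparr>vertices = {0, 1, 2, 3}, edges = {{0, 1}, {1, 2}, {2, 3}, {3, 0}}\<rparr>"

definition C4_free :: "'a graph \<Rightarrow> bool" where
  "C4_free G \<longleftrightarrow> (\<nexists>H. subgraph_of H G \<and> graph_iso H C4)"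


section \<open>Projective planes and polarity graphs\<close>

record ('p, 'l) incidence_structure =
  points :: "'p set"
  lines :: "'l set"
  incident :: "'p \<Rightarrow> 'l \<Rightarrow> bool"

definition finite_projective_plane :: "('p, 'l) incidence_structure \<Rightarrow> bool" where
  "finite_projective_plane \<Pi> \<longleftrightarrow>
     finite (points \<Pi>) \<and> finite (lines \<Pi>) \<and>
     (\<forall>x\<in>points \<Pi>. \<forall>y\<in>points \<Pi>. x \<noteq> y \<longrightarrow>
        (\<exists>!l. l \<in> lines \<Pi> \<and> incident \<Pi> x l \<and> incident \<Pi> y l)) \<and>
     (\<forall>l\<in>lines \<Pi>. \<forall>m\<in>lines \<Pi>. l \<noteq> m \<longrightarrow>
        (\<exists>!x. x \<in> points \<Pi> \<and> incident \<Pi> x l \<and> incident \<Pi> x m)) \<and>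
     (\<exists>Q\<subseteq>points \<Pi>. card Q = 4 \<and>
        (\<forall>T\<subseteq>Q. card T = 3 \<longrightarrow> \<not> (\<exists>l\<in>lines \<Pi>. \<forall>x\<in>T. incident \<Pi> x l)))"

definition plane_order :: "('p, 'l) incidence_structure \<Rightarrow> nat \<Rightarrow> bool" where
  "plane_order \<Pi> q \<longleftrightarrow> (\<forall>l\<in>lines \<Pi>. card {x \<in> points \<Pi>. incident \<Pi> x l} = q + 1)"

text \<open>The union of the point set and the line set is rendered as the disjoint sum
  \<open>points \<Pi> <+> lines \<Pi>\<close>, with \<open>Inl\<close> marking points and \<open>Inr\<close> marking lines.\<close>

definition polarity :: "('p, 'l) incidence_structure \<Rightarrow> ('p + 'l \<Rightarrow> 'p + 'l) \<Rightarrow> bool" where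
  "polarity \<Pi> \<phi> \<longleftrightarrow>
     bij_betw \<phi> (points \<Pi> <+> lines \<Pi>) (points \<Pi> <+> lines \<Pi>) \<and>
     \<phi> ` Inl ` points \<Pi> = Inr ` lines \<Pi> \<and>
     \<phi> ` Inr ` lines \<Pi> = Inl ` points \<Pi> \<and>
     (\<forall>z \<in> points \<Pi> <+> lines \<Pi>. \<phi> (\<phi> z) = z) \<and>
     (\<forall>x\<in>points \<Pi>. \<forall>l\<in>lines \<Pi>.
        incident \<Pi> x l \<longleftrightarrow> incident \<Pi> (projl (\<phi> (Inr l))) (projr (\<phi> (Inl x))))"

definition polarity_graph :: "('p, 'l) incidence_structure \<Rightarrow> ('p + 'l \<Rightarrow> 'p + 'l) \<Rightarrow> 'p graph" where
  "polarity_graph \<Pi> \<phi> =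
     \<lparr>vertices = points \<Pi>,
      edges = {{x, y} | x y. x \<in> points \<Pi> \<and> y \<in> points \<Pi> \<and> x \<noteq> y \<and>
                             incident \<Pi> x (projr (\<phi> (Inl y)))}\<rparr>"

text \<open>HOL cannot quantify existentially over the types of points and lines, so they are taken to
  be natural numbers. Since the planes are finite and the graph is only considered up to
  isomorphism, this is no restriction, by \<open>is_polarity_graphI\<close> below.\<close>

definition is_polarity_graph :: "'a graph \<Rightarrow> nat \<Rightarrow> bool" where
  "is_polarity_graph G q \<longleftrightarrow>
     (\<exists>(\<Pi> :: (nat, nat) incidence_structure) \<phi>.
        finite_projective_plane \<Pi> \<and> plane_order \<Pi> q \<and> polarity \<Pi> \<phi> \<and>
        graph_iso G (polarity_graph \<Pi> \<phi>))"

lemma polarity_point: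
  assumes "polarity \<Pi> \<phi>" "x \<in> points \<Pi>"
  obtains l where "l \<in> lines \<Pi>" "\<phi> (Inl x) = Inr l" "\<phi> (Inr l) = Inl x"
proof -
  have "\<phi> (Inl x) \<in> Inr ` lines \<Pi>"
    using assms unfolding polarity_def by blast
  then obtain l where l: "l \<in> lines \<Pi>" "\<phi> (Inl x) = Inr l" by blast
  have "\<phi> (\<phi> (Inl x)) = Inl x"
    using assms unfolding polarity_def by blast
  with l that show ?thesis by simp
qed

lemma polarity_line:
  assumes "polarity \<Pi> \<phi>" "l \<in> lines \<Pi>"
  obtains x where "x \<in> points \<Pi>" "\<phi> (Inr l) = Inl x" "\<phi> (Inl x) = Inr l"
proof -
  have "\<phi> (Inr l) \<in> Inl ` points \<Pi>"
    using assms unfolding polarity_def by blast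
  then obtain x where x: "x \<in> points \<Pi>" "\<phi> (Inr l) = Inl x" by blast
  have "\<phi> (\<phi> (Inr l)) = Inr l"
    using assms unfolding polarity_def by blast
  with x that show ?thesis by simp
qed

lemma polarity_graph_adjacent_iff:
  assumes "polarity \<Pi> \<phi>" "x \<in> points \<Pi>" "y \<in> points \<Pi>"
  shows "{x, y} \<in> edges (polarity_graph \<Pi> \<phi>) \<longleftrightarrow>
         x \<noteq> y \<and> incident \<Pi> x (projr (\<phi> (Inl y)))"
proof -
  have sym: "incident \<Pi> y (projr (\<phi> (Inl x))) \<longleftrightarrow> incident \<Pi> x (projr (\<phi> (Inl y)))"
  proof -
    obtain l where l: "l \<in> lines \<Pi>" "\<phi> (Inl x) = Inr l" "\<phi> (Inr l) = Inl x"
      using polarity_point assms by metis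
    have "incident \<Pi> y l \<longleftrightarrow> incident \<Pi> (projl (\<phi> (Inr l))) (projr (\<phi> (Inl y)))"
      using assms l unfolding polarity_def by blast
    with l show ?thesis by simp
  qed
  show ?thesis
    using assms(2,3) sym by (auto simp: polarity_graph_def doubleton_eq_iff)
qed

lemma is_polarity_graphI:
  fixes \<Pi> :: "('p, 'l) incidence_structure" and G :: "'a graph"
  assumes plane: "finite_projective_plane \<Pi>" and ord: "plane_order \<Pi> q"
    and pol: "polarity \<Pi> \<phi>" and iso: "graph_iso G (polarity_graph \<Pi> \<phi>)"
  shows "is_polarity_graph G q"
proof -
  let ?P = "points \<Pi>" and ?L = "lines \<Pi>"
  have fin: "finite ?P" "finite ?L"
    using plane by (auto simp: finite_projective_plane_def)
  have pl1: "\<And>x y. x \<in> ?P \<Longrightarrow> y \<in> ?P \<Longrightarrow> x \<noteq> y \<Longrightarrow>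
        \<exists>!l. l \<in> ?L \<and> incident \<Pi> x l \<and> incident \<Pi> y l"
    and pl2: "\<And>l m. l \<in> ?L \<Longrightarrow> m \<in> ?L \<Longrightarrow> l \<noteq> m \<Longrightarrow>
        \<exists>!x. x \<in> ?P \<and> incident \<Pi> x l \<and> incident \<Pi> x m"
    and pl3: "\<exists>Q\<subseteq>?P. card Q = 4 \<and>
        (\<forall>T\<subseteq>Q. card T = 3 \<longrightarrow> \<not> (\<exists>l\<in>?L. \<forall>x\<in>T. incident \<Pi> x l))"
    using plane unfolding finite_projective_plane_def by (elim conjE, simp)+
  obtain f :: "'p \<Rightarrow> nat" where f: "inj_on f ?P"
    using finite_imp_inj_to_nat_seg[OF fin(1)] by metis
  obtain g :: "'l \<Rightarrow> nat" where g: "inj_on g ?L"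
    using finite_imp_inj_to_nat_seg[OF fin(2)] by metis
  define f' where "f' = inv_into ?P f"
  define g' where "g' = inv_into ?L g"
  have f'[simp]: "f' (f x) = x" if "x \<in> ?P" for x
    using f that by (simp add: f'_def)
  have g'[simp]: "g' (g l) = l" if "l \<in> ?L" for l
    using g that by (simp add: g'_def)
  define \<Pi>' where "\<Pi>' = \<lparr>points = f ` ?P, lines = g ` ?L,
                           incident = (\<lambda>x l. incident \<Pi> (f' x) (g' l))\<rparr>"
  define \<phi>' where "\<phi>' = map_sum f g \<circ> \<phi> \<circ> map_sum f' g'"
  have sel [simp]: "points \<Pi>' = f ` ?P" "lines \<Pi>' = g ` ?L"
    "\<And>x l. incident \<Pi>' x l = incident \<Pi> (f' x) (g' l)"
    by (simp_all add: \<Pi>'_def)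
  have finj: "f x = f y \<longleftrightarrow> x = y" if "x \<in> ?P" "y \<in> ?P" for x y
    using f that by (auto dest: inj_onD)
  have ginj: "g x = g y \<longleftrightarrow> x = y" if "x \<in> ?L" "y \<in> ?L" for x y
    using g that by (auto dest: inj_onD)
  have plane': "finite_projective_plane \<Pi>'"
    unfolding finite_projective_plane_def
  proof (intro conjI)
    show "\<forall>x\<in>points \<Pi>'. \<forall>y\<in>points \<Pi>'. x \<noteq> y \<longrightarrow>
        (\<exists>!l. l \<in> lines \<Pi>' \<and> incident \<Pi>' x l \<and> incident \<Pi>' y l)"
    proof (intro ballI impI)
      fix x y assume "x \<in> points \<Pi>'" "y \<in> points \<Pi>'" "x \<noteq> y"
      then obtain a b where ab: "a \<in> ?P" "b \<in> ?P" "a \<noteq> b" "x = f a" "y = f b" by auto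
      then have "\<exists>!l. l \<in> ?L \<and> incident \<Pi> a l \<and> incident \<Pi> b l"
        using pl1 by simp
      then obtain l where l: "l \<in> ?L" "incident \<Pi> a l" "incident \<Pi> b l"
        "\<And>m. m \<in> ?L \<Longrightarrow> incident \<Pi> a m \<Longrightarrow> incident \<Pi> b m \<Longrightarrow> m = l" by blast
      show "\<exists>!l. l \<in> lines \<Pi>' \<and> incident \<Pi>' x l \<and> incident \<Pi>' y l"
        by (rule ex1I[of _ "g l"]) (use ab l(1-3) in \<open>auto intro!: arg_cong[of _ _ g] l(4)\<close>)
    qed
    show "\<forall>l\<in>lines \<Pi>'. \<forall>m\<in>lines \<Pi>'. l \<noteq> m \<longrightarrow>
        (\<exists>!x. x \<in> points \<Pi>' \<and> incident \<Pi>' x l \<and> incident \<Pi>' x m)"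
    proof (intro ballI impI)
      fix x y assume "x \<in> lines \<Pi>'" "y \<in> lines \<Pi>'" "x \<noteq> y"
      then obtain a b where ab: "a \<in> ?L" "b \<in> ?L" "a \<noteq> b" "x = g a" "y = g b" by auto
      then have "\<exists>!p. p \<in> ?P \<and> incident \<Pi> p a \<and> incident \<Pi> p b"
        using pl2 by simp
      then obtain p where p: "p \<in> ?P" "incident \<Pi> p a" "incident \<Pi> p b"
        "\<And>r. r \<in> ?P \<Longrightarrow> incident \<Pi> r a \<Longrightarrow> incident \<Pi> r b \<Longrightarrow> r = p" by blast
      show "\<exists>!p. p \<in> points \<Pi>' \<and> incident \<Pi>' p x \<and> incident \<Pi>' p y"
        by (rule ex1I[of _ "f p"]) (use ab p(1-3) in \<open>auto intro!: arg_cong[of _ _ f] p(4)\<close>)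
    qed
    obtain Q where Q: "Q \<subseteq> ?P" "card Q = 4"
      "\<And>T. T \<subseteq> Q \<Longrightarrow> card T = 3 \<Longrightarrow> \<not> (\<exists>l\<in>?L. \<forall>x\<in>T. incident \<Pi> x l)"
      using pl3 by auto
    show "\<exists>Q\<subseteq>points \<Pi>'. card Q = 4 \<and>
        (\<forall>T\<subseteq>Q. card T = 3 \<longrightarrow> \<not> (\<exists>l\<in>lines \<Pi>'. \<forall>x\<in>T. incident \<Pi>' x l))"
    proof (intro exI[of _ "f ` Q"] conjI allI impI)
      show "f ` Q \<subseteq> points \<Pi>'" using Q by auto
      show "card (f ` Q) = 4"
        using Q f by (metis card_image inj_on_subset)
      fix T assume T: "T \<subseteq> f ` Q" "card T = 3"
      then obtain S where S: "S \<subseteq> Q" "T = f ` S" by (meson subset_imageE)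
      have "inj_on f S" using f S Q by (meson inj_on_subset)
      then have "card S = 3" using T S by (simp add: card_image)
      then have "\<not> (\<exists>l\<in>?L. \<forall>x\<in>S. incident \<Pi> x l)" using Q(3) S by blast
      moreover have "f' (f x) = x" if "x \<in> S" for x using that S Q by auto
      ultimately show "\<not> (\<exists>l\<in>lines \<Pi>'. \<forall>x\<in>T. incident \<Pi>' x l)"
        using S by auto
    qed
  qed (use fin in auto)
  have ord': "plane_order \<Pi>' q"
    unfolding plane_order_def
  proof
    fix l assume "l \<in> lines \<Pi>'"
    then obtain m where m: "m \<in> ?L" "l = g m" by auto
    have "{x \<in> points \<Pi>'. incident \<Pi>' x l} = f ` {x \<in> ?P. incident \<Pi> x m}"
      using m by auto
    moreover have "inj_on f {x \<in> ?P. incident \<Pi> x m}"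
      using f by (rule inj_on_subset) auto
    ultimately show "card {x \<in> points \<Pi>'. incident \<Pi>' x l} = q + 1"
      using ord m by (simp add: card_image plane_order_def)
  qed
  have pt: "\<exists>l\<in>?L. \<phi> (Inl x) = Inr l \<and> \<phi> (Inr l) = Inl x" if "x \<in> ?P" for x
    using polarity_point[OF pol that] by metis
  have ln: "\<exists>x\<in>?P. \<phi> (Inr l) = Inl x \<and> \<phi> (Inl x) = Inr l" if "l \<in> ?L" for l
    using polarity_line[OF pol that] by metis
  have phi'_pt: "\<exists>l\<in>?L. \<phi> (Inl x) = Inr l \<and> \<phi>' (Inl (f x)) = Inr (g l) \<and> \<phi>' (Inr (g l)) = Inl (f x)"
    if "x \<in> ?P" for x
    using pt[OF that] that by (auto simp: \<phi>'_def)
  have phi'_ln: "\<exists>x\<in>?P. \<phi> (Inr l) = Inl x \<and> \<phi>' (Inr (g l)) = Inl (f x) \<and> \<phi>' (Inl (f x)) = Inr (g l)"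
    if "l \<in> ?L" for l
    using ln[OF that] that by (auto simp: \<phi>'_def)
  have pol': "polarity \<Pi>' \<phi>'"
    unfolding polarity_def
  proof (intro conjI)
    show inv: "\<forall>z \<in> points \<Pi>' <+> lines \<Pi>'. \<phi>' (\<phi>' z) = z"
      using phi'_pt phi'_ln by fastforce
    show A: "\<phi>' ` Inl ` points \<Pi>' = Inr ` lines \<Pi>'"
    proof
      show "\<phi>' ` Inl ` points \<Pi>' \<subseteq> Inr ` lines \<Pi>'" using phi'_pt by fastforce
      show "Inr ` lines \<Pi>' \<subseteq> \<phi>' ` Inl ` points \<Pi>'"
      proof
        fix z :: "nat + nat" assume "z \<in> Inr ` lines \<Pi>'"
        then obtain l where "l \<in> ?L" "z = Inr (g l)" by auto
        then show "z \<in> \<phi>' ` Inl ` points \<Pi>'"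
          using phi'_ln[of l] by (metis image_eqI sel(1))
      qed
    qed
    show B: "\<phi>' ` Inr ` lines \<Pi>' = Inl ` points \<Pi>'"
    proof
      show "\<phi>' ` Inr ` lines \<Pi>' \<subseteq> Inl ` points \<Pi>'" using phi'_ln by fastforce
      show "Inl ` points \<Pi>' \<subseteq> \<phi>' ` Inr ` lines \<Pi>'"
      proof
        fix z :: "nat + nat" assume "z \<in> Inl ` points \<Pi>'"
        then obtain x where "x \<in> ?P" "z = Inl (f x)" by auto
        then show "z \<in> \<phi>' ` Inr ` lines \<Pi>'"
          using phi'_pt[of x] by (metis image_eqI sel(2))
      qed
    qed
    show "bij_betw \<phi>' (points \<Pi>' <+> lines \<Pi>') (points \<Pi>' <+> lines \<Pi>')"
      unfolding bij_betw_def
    proof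
      show "inj_on \<phi>' (points \<Pi>' <+> lines \<Pi>')"
        by (rule inj_on_inverseI[of _ "\<phi>'"]) (use inv in blast)
      show "\<phi>' ` (points \<Pi>' <+> lines \<Pi>') = points \<Pi>' <+> lines \<Pi>'"
        unfolding Plus_def image_Un A B by blast
    qed
    show "\<forall>x\<in>points \<Pi>'. \<forall>l\<in>lines \<Pi>'.
        incident \<Pi>' x l \<longleftrightarrow> incident \<Pi>' (projl (\<phi>' (Inr l))) (projr (\<phi>' (Inl x)))"
    proof (intro ballI)
      fix x l assume "x \<in> points \<Pi>'" "l \<in> lines \<Pi>'"
      then obtain p m where pm: "p \<in> ?P" "x = f p" "m \<in> ?L" "l = g m" by auto
      then have "incident \<Pi> p m \<longleftrightarrow> incident \<Pi> (projl (\<phi> (Inr m))) (projr (\<phi> (Inl p)))"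
        using pol unfolding polarity_def by blast
      then show "incident \<Pi>' x l \<longleftrightarrow> incident \<Pi>' (projl (\<phi>' (Inr l))) (projr (\<phi>' (Inl x)))"
        using phi'_pt[OF pm(1)] phi'_ln[OF pm(3)] pm by auto
    qed
  qed
  obtain h where h: "bij_betw h (vertices G) (vertices (polarity_graph \<Pi> \<phi>))"
    "\<forall>u\<in>vertices G. \<forall>v\<in>vertices G.
       {u, v} \<in> edges G \<longleftrightarrow> {h u, h v} \<in> edges (polarity_graph \<Pi> \<phi>)"
    using iso unfolding graph_iso_def by blast
  have hP: "bij_betw h (vertices G) ?P" using h(1) by (simp add: polarity_graph_def)
  have "graph_iso G (polarity_graph \<Pi>' \<phi>')"
    unfolding graph_iso_def
  proof (intro exI[of _ "f \<circ> h"] conjI ballI)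
    have "bij_betw f ?P (f ` ?P)" using f by (simp add: bij_betw_def)
    then show "bij_betw (f \<circ> h) (vertices G) (vertices (polarity_graph \<Pi>' \<phi>'))"
      using hP by (auto simp: polarity_graph_def intro: bij_betw_trans)
    fix u v assume uv: "u \<in> vertices G" "v \<in> vertices G"
    have P: "h u \<in> ?P" "h v \<in> ?P" using uv hP by (auto dest: bij_betwE)
    have "{h u, h v} \<in> edges (polarity_graph \<Pi> \<phi>) \<longleftrightarrow>
          {f (h u), f (h v)} \<in> edges (polarity_graph \<Pi>' \<phi>')"
      using polarity_graph_adjacent_iff[OF pol P]
        polarity_graph_adjacent_iff[OF pol', of "f (h u)" "f (h v)"]
        phi'_pt[OF P(2)] P finj by auto
    then show "{u, v} \<in> edges G \<longleftrightarrow> {(f \<circ> h) u, (f \<circ> h) v} \<in> edges (polarity_graph \<Pi>' \<phi>')"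
      using h(2) uv by simp
  qed
  then show ?thesis
    unfolding is_polarity_graph_def using plane' ord' pol' by blast
qed

end

theory Submission
  imports Defs "Jordan_Normal_Form.Char_Poly"
begin

text \<open>Let \<open>L\<close> be the Laplacian of the graph and put \<open>M = (q + 1) I - L\<close>: this is the adjacency matrix
  with the deficiency \<open>\<delta>\<^sub>x = q + 1 - deg x\<close> on the diagonal. Its row sums are all \<open>q + 1\<close>, so the constant
  vector is an eigenvector; let \<open>\<lambda>\<^sub>k\<close>, for \<open>0 < k < n\<close>, be the other eigenvalues. By the matrix-tree theorem
  (\<open>matrix_tree\<close>), \<open>n \<tau>\<close> is the product of the numbers \<open>q + 1 - \<lambda>\<^sub>k\<close>, and the trace of \<open>M\<close> shows that
  the \<open>\<lambda>\<^sub>k\<close> add up to \<open>2 (m\<^sub>q - e(G))\<close>. For a polarity graph \<open>M\<close> is an incidence matrix of the plane and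
  \<open>M\<^sup>2 = J + q I\<close>, so that every \<open>\<lambda>\<^sub>k\<close> is \<open>\<plusminus> sqrt q\<close>. The line \<open>ln n / 2 - A\<^sub>q x\<close> interpolates
  \<open>ln (q + 1 - x)\<close> at these two points; summing over \<open>k\<close> gives the asserted value of \<open>\<tau>\<close>.

  In general, compare \<open>ln (q + 1 - x)\<close> with the cubic \<open>ln n / 2 - A\<^sub>q x + (q - x\<^sup>2) (c + b x)\<close> that also has the
  right slopes at \<open>\<plusminus> sqrt q\<close>. The remainder \<open>R\<close> (cubic minus logarithm) is nonnegative and vanishes at
  these points only (\<open>R_pos\<close>). Hence \<open>ln \<tau>\<close> is the logarithm of the bound minus the sum over \<open>k\<close> of
  \<open>(\<lambda>\<^sub>k\<^sup>2 - q) (c + b \<lambda>\<^sub>k) + R \<lambda>\<^sub>k\<close>, and it has to be shown that this sum is not negative.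

  Its polynomial part is the trace of \<open>E (c I + b M)\<close> for \<open>E = M\<^sup>2 - q I - J\<close>. The diagonal entries of \<open>E\<close>
  are \<open>\<delta>\<^sub>x (\<delta>\<^sub>x - 1)\<close>, its rows add up to \<open>0\<close>, and its entries at nonadjacent pairs are the number of
  common neighbours minus \<open>1\<close>, hence at most \<open>0\<close> in a \<open>C\<^sub>4\<close>-free graph. The row sums allow one to
  eliminate the entries at edges, and the trace becomes the sum over \<open>x\<close> of
  \<open>\<delta>\<^sub>x (\<delta>\<^sub>x - 1) (c + b (\<delta>\<^sub>x - 1))\<close> plus a nonnegative multiple of the number of nonadjacent pairs
  without a common neighbour (\<open>trace_identity\<close>). The summand of \<open>x\<close> is nonnegative, since \<open>\<delta>\<^sub>x\<close> is an
  integer, unless the degree of \<open>x\<close> is large. The negative summands are compensated by the remainders: left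
  of \<open>- sqrt q\<close> the function \<open>R\<close> is convex, and the diagonal entries \<open>\<delta>\<^sub>x\<close> of \<open>M\<close> are means of
  eigenvalues with doubly stochastic weights, so by Jensen's inequality the sum of \<open>R \<delta>\<^sub>x\<close> over the
  vertices with \<open>\<delta>\<^sub>x \<le> - sqrt q\<close> is at most the sum of all \<open>R \<lambda>\<^sub>k\<close> (\<open>sum_R_left_le\<close>). What is left is an
  inequality for a single integer, \<open>defect_plus_R_left\<close>.

  If equality holds, all \<open>\<delta>\<^sub>x\<close> are \<open>0\<close> or \<open>1\<close> and all \<open>R \<lambda>\<^sub>k\<close> vanish. Then \<open>\<lambda>\<^sub>k\<^sup>2 = q\<close> for every \<open>k\<close>, so
  \<open>E = 0\<close>, and \<open>M\<close> is the incidence matrix of a projective plane; as \<open>M\<close> is symmetric, the graph is a polarity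
  graph of it.\<close>

section \<open>Orthogonal diagonalisation of real symmetric matrices\<close>

text \<open>A complex root of the characteristic polynomial exists, and the Hermitian form
  \<open>\<Sum>\<^sub>i\<^sub>j cnj v\<^sub>i A\<^sub>i\<^sub>j v\<^sub>j = k \<bar>v\<bar>\<^sup>2\<close> of its eigenvector equals its own conjugate, so \<open>k\<close> is real.\<close>

lemma symmetric_mat_real_eigenvector:
  fixes A :: "real mat"
  assumes A: "A \<in> carrier_mat n n" and sym: "transpose_mat A = A" and n: "n > 0"
  obtains v k where "v \<in> carrier_vec n" "v \<bullet> v = 1" "A *\<^sub>v v = k \<cdot>\<^sub>v v"
proof -
  interpret of_real_hom: inj_comm_ring_hom complex_of_real
    by unfold_locales auto
  let ?C = "map_mat complex_of_real A"
  have C: "?C \<in> carrier_mat n n" using A by simp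
  obtain as where as: "char_poly ?C = (\<Prod>a\<leftarrow>as. [:- a, 1:])" "length as = n"
    using char_poly_factorized[OF C] by blast
  then obtain k as' where "as = k # as'" using n by (cases as) auto
  then have root: "poly (char_poly ?C) k = 0" using as by simp
  then obtain v where v: "v \<in> carrier_vec n" "v \<noteq> 0\<^sub>v n" "?C *\<^sub>v v = k \<cdot>\<^sub>v v"
    using eigenvalue_root_char_poly[OF C] A unfolding eigenvalue_def eigenvector_def by auto
  have symij: "A $$ (i, j) = A $$ (j, i)" if "i < n" "j < n" for i j
    using arg_cong[OF sym, of "\<lambda>B. B $$ (i, j)"] that A by simp
  define S where "S = (\<Sum>i<n. \<Sum>j<n. cnj (v $ i) * A $$ (i, j) * v $ j)"
  define N where "N = (\<Sum>i<n. (cmod (v $ i))\<^sup>2)"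
  have row: "(\<Sum>j<n. A $$ (i, j) * v $ j) = k * v $ i" if "i < n" for i
    using arg_cong[OF v(3), of "\<lambda>w. w $ i"] that A v(1)
    by (simp add: scalar_prod_def lessThan_atLeast0)
  have "S = (\<Sum>i<n. cnj (v $ i) * (k * v $ i))"
    unfolding S_def by (intro sum.cong refl)
      (simp add: row[symmetric] sum_distrib_left mult.assoc)
  also have "\<dots> = k * of_real N"
    unfolding N_def of_real_sum sum_distrib_left
    by (intro sum.cong refl) (metis (no_types) complex_norm_square mult.commute mult.left_commute of_real_power)
  finally have SN: "S = k * of_real N" .
  have "cnj S = (\<Sum>i<n. \<Sum>j<n. v $ i * A $$ (i, j) * cnj (v $ j))"
    unfolding S_def by simp
  also have "\<dots> = (\<Sum>j<n. \<Sum>i<n. v $ i * A $$ (i, j) * cnj (v $ j))"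
    by (rule sum.swap)
  also have "\<dots> = S" unfolding S_def
    by (intro sum.cong refl) (auto simp: symij mult_ac)
  finally have cS: "cnj S = S" .
  obtain i where i: "i < n" "v $ i \<noteq> 0" using v(1,2) by force
  have "N > 0" unfolding N_def
    by (rule sum_pos2[of _ i]) (use i in auto)
  then have "cnj k = k" using cS unfolding SN by auto
  then obtain r where r: "k = of_real r" by (metis Reals_cases Reals_cnj_iff)
  have "poly (char_poly A) r = 0"
    using root unfolding r of_real_hom.char_poly_hom[OF A] by simp
  then obtain w where w: "w \<in> carrier_vec n" "w \<noteq> 0\<^sub>v n" "A *\<^sub>v w = r \<cdot>\<^sub>v w"
    using eigenvalue_root_char_poly[OF A] A unfolding eigenvalue_def eigenvector_def by auto
  have pos: "w \<bullet> w > 0"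
  proof -
    obtain i where "i < n" "w $ i \<noteq> 0" using w(1,2) by force
    then show ?thesis using w(1) unfolding scalar_prod_def
      by (intro sum_pos2[of _ i]) (auto simp: zero_less_mult_iff linorder_neq_iff)
  qed
  define t where "t = 1 / sqrt (w \<bullet> w)"
  show ?thesis
  proof (rule that[of "t \<cdot>\<^sub>v w" r])
    show "t \<cdot>\<^sub>v w \<in> carrier_vec n" using w by simp
    show "(t \<cdot>\<^sub>v w) \<bullet> (t \<cdot>\<^sub>v w) = 1" using w pos by (simp add: t_def)
    show "A *\<^sub>v (t \<cdot>\<^sub>v w) = r \<cdot>\<^sub>v (t \<cdot>\<^sub>v w)"
      using w A by (simp add: mult_mat_vec smult_smult_assoc mult.commute)
  qed
qed

text \<open>The reflection that exchanges \<open>v\<close> with the first unit vector \<open>e\<^sub>0\<close>: with \<open>w = v - e\<^sub>0\<close> one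
  has \<open>\<bar>w\<bar>\<^sup>2 = 2 (1 - v\<^sub>0)\<close>, so it is \<open>I - w w\<^sup>T / (1 - v\<^sub>0)\<close>. If \<open>v = e\<^sub>0\<close>, the division by zero
  yields \<open>0\<close> and the formula gives the identity, as it should.\<close>

lemma householder:
  fixes v :: "real vec"
  assumes v: "v \<in> carrier_vec (Suc n)" and unit: "v \<bullet> v = 1"
  obtains H where "H \<in> carrier_mat (Suc n) (Suc n)" "transpose_mat H = H"
    "H * H = 1\<^sub>m (Suc n)" "col H 0 = v"
proof -
  let ?n = "Suc n"
  define w where "w i = v $ i - (if i = 0 then 1 else 0)" for i
  define H where "H = Matrix.mat ?n ?n (\<lambda>(i, j). (if i = j then 1 else 0) - w i * w j / (1 - v $ 0))"
  have vv: "(\<Sum>i<?n. v $ i * v $ i) = 1"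
    using unit v by (simp add: scalar_prod_def lessThan_atLeast0)
  have ww: "(\<Sum>i<?n. w i * w i) = 2 * (1 - v $ 0)"
  proof -
    have "(\<Sum>i<?n. w i * w i)
        = (\<Sum>i<?n. v $ i * v $ i + (if i = 0 then 1 - 2 * v $ 0 else 0))"
      by (intro sum.cong refl) (auto simp: w_def algebra_simps)
    also have "\<dots> = 1 + (1 - 2 * v $ 0)"
      unfolding sum.distrib vv by simp
    finally show ?thesis by simp
  qed
  have w0: "w i = 0" if "v $ 0 = 1" "i < ?n" for i
  proof -
    have "(\<Sum>i<?n. w i * w i) = 0" using ww that by simp
    then have "\<forall>i\<in>{..<?n}. w i * w i = 0"
      by (subst (asm) sum_nonneg_eq_0_iff) auto
    then show ?thesis using that by simp
  qed
  have H: "H \<in> carrier_mat ?n ?n" by (simp add: H_def)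
  show ?thesis
  proof (rule that[OF H])
    show "transpose_mat H = H"
      by (rule eq_matI) (auto simp: H_def)
    show "H * H = 1\<^sub>m ?n"
    proof (rule eq_matI)
      fix i j assume "i < dim_row (1\<^sub>m ?n :: real mat)" "j < dim_col (1\<^sub>m ?n :: real mat)"
      then have ij: "i < ?n" "j < ?n" by auto
      define s where "s = 1 / (1 - v $ 0)"
      have "(H * H) $$ (i, j) = (\<Sum>k<?n. ((if i = k then 1 else 0) - w i * w k * s)
              * ((if k = j then 1 else 0) - w k * w j * s))"
        using ij by (simp add: H_def scalar_prod_def lessThan_atLeast0 s_def)
      also have "\<dots> = (\<Sum>k<?n. (if i = k then (if i = j then 1 else 0) - w i * w j * s else 0)
             - (if k = j then w i * w j * s else 0) + (w i * w j * s\<^sup>2) * (w k * w k))"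
        by (intro sum.cong refl) (auto simp: algebra_simps power2_eq_square)
      also have "\<dots> = (if i = j then 1 else 0) - 2 * (w i * w j * s) + (w i * w j * s\<^sup>2) * (2 * (1 - v $ 0))"
        unfolding sum.distrib sum_subtractf sum_distrib_left[symmetric] ww using ij by simp
      also have "\<dots> = (if i = j then 1 else 0)"
      proof (cases "v $ 0 = 1")
        case True
        then show ?thesis using w0 ij by simp
      next
        case False
        then have "s\<^sup>2 * (1 - v $ 0) = s" by (simp add: s_def power2_eq_square)
        then have "(w i * w j * s\<^sup>2) * (2 * (1 - v $ 0)) = 2 * (w i * w j * s)"
          by (metis (no_types, opaque_lifting) mult.assoc mult.left_commute)
        then show ?thesis by simp
      qed
      finally show "(H * H) $$ (i, j) = 1\<^sub>m ?n $$ (i, j)" using ij by simp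
    qed (use H in auto)
    show "col H 0 = v"
    proof (rule eq_vecI)
      fix i assume "i < dim_vec v"
      then have i: "i < ?n" using v by simp
      have "col H 0 $ i = (if i = 0 then 1 else 0) - w i * w 0 / (1 - v $ 0)"
        using i by (simp add: H_def)
      also have "\<dots> = (if i = 0 then 1 else 0) + w i"
      proof (cases "v $ 0 = 1")
        case True
        then show ?thesis using w0 i by simp
      next
        case False
        have "w 0 / (1 - v $ 0) = -1" using False by (simp add: w_def field_simps)
        then show ?thesis by (metis diff_minus_eq_add mult_minus1_right times_divide_eq_right)
      qed
      also have "\<dots> = v $ i" by (simp add: w_def)
      finally show "col H 0 $ i = v $ i" .
    qed (use v H in auto)
  qed
qed

definition orthogonally_diagonal :: "nat \<Rightarrow> real mat \<Rightarrow> real mat \<Rightarrow> (nat \<Rightarrow> real) \<Rightarrow> bool" where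
  "orthogonally_diagonal n A U l \<longleftrightarrow> U \<in> carrier_mat n n \<and> U * transpose_mat U = 1\<^sub>m n \<and>
     A = U * mat_diag n l * transpose_mat U"

text \<open>Conjugating with the reflection that sends the first unit vector to a unit eigenvector
  \<open>v\<close> clears the first row and column off the diagonal; a diagonalisation of the remaining block
  then lifts to one of \<open>A\<close>. The eigenvector \<open>v\<close> stays the first column, so any eigenvector can
  be prescribed.\<close>

lemma symmetric_mat_deflation:
  fixes A :: "real mat"
  assumes A: "A \<in> carrier_mat (Suc n) (Suc n)" and sym: "transpose_mat A = A"
    and v: "v \<in> carrier_vec (Suc n)" "v \<bullet> v = 1" "A *\<^sub>v v = k \<cdot>\<^sub>v v"
    and IH: "\<And>B :: real mat. B \<in> carrier_mat n n \<Longrightarrow> transpose_mat B = B \<Longrightarrow>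
               \<exists>U l. orthogonally_diagonal n B U l"
  shows "\<exists>U l. orthogonally_diagonal (Suc n) A U l \<and> col U 0 = v \<and> l 0 = k"
proof -
  let ?n = "Suc n"
  obtain H where H: "H \<in> carrier_mat ?n ?n" and Ht: "transpose_mat H = H"
    and HH: "H * H = 1\<^sub>m ?n" and H0: "col H 0 = v"
    using householder[OF v(1,2)] .
  define B where "B = H * A * H"
  have B: "B \<in> carrier_mat ?n ?n" using A H by (simp add: B_def)
  have HAH: "H * B * H = A"
  proof -
    have "H * B * H = (H * H) * A * (H * H)"
      using A H by (simp add: B_def assoc_mult_mat[of _ ?n ?n _ ?n _ ?n])
    then show ?thesis using A HH by simp
  qed
  have Bt: "transpose_mat B = B"
    using A H Ht sym unfolding B_def
    by (simp add: transpose_mult[of _ ?n ?n _ ?n] assoc_mult_mat[of _ ?n ?n _ ?n _ ?n])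
  have colB: "col B 0 = k \<cdot>\<^sub>v unit_vec ?n 0"
  proof -
    have "col B 0 = (H * A) *\<^sub>v v"
      unfolding B_def H0[symmetric] using A H by (subst col_mult2[of _ ?n ?n _ ?n]) auto
    also have "\<dots> = H *\<^sub>v (k \<cdot>\<^sub>v v)"
      using A H v by (simp add: assoc_mult_mat_vec[of _ ?n ?n])
    also have "\<dots> = k \<cdot>\<^sub>v (H *\<^sub>v col H 0)"
      using H v H0 by (simp add: mult_mat_vec)
    also have "H *\<^sub>v col H 0 = col (H * H) 0"
      using H by (subst col_mult2[of _ ?n ?n _ ?n]) auto
    also have "\<dots> = unit_vec ?n 0" unfolding HH by simp
    finally show ?thesis .
  qed
  have B0: "B $$ (i, 0) = (if i = 0 then k else 0)" if "i < ?n" for i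
    using arg_cong[OF colB, of "\<lambda>w. w $ i"] that B by simp
  have B0': "B $$ (0, i) = (if i = 0 then k else 0)" if "i < ?n" for i
    using B0[OF that] arg_cong[OF Bt, of "\<lambda>C. C $$ (i, 0)"] that B by simp
  define B' where "B' = Matrix.mat n n (\<lambda>(i, j). B $$ (Suc i, Suc j))"
  have B': "B' \<in> carrier_mat n n" by (simp add: B'_def)
  have B't: "transpose_mat B' = B'"
  proof (rule eq_matI)
    fix i j assume "i < dim_row B'" "j < dim_col B'"
    then show "transpose_mat B' $$ (i, j) = B' $$ (i, j)"
      using arg_cong[OF Bt, of "\<lambda>C. C $$ (Suc i, Suc j)"] B by (simp add: B'_def)
  qed (auto simp: B'_def)
  obtain U' l' where "orthogonally_diagonal n B' U' l'" using IH[OF B' B't] by blast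
  then have U': "U' \<in> carrier_mat n n" "U' * transpose_mat U' = 1\<^sub>m n"
    and BU: "B' = U' * mat_diag n l' * transpose_mat U'"
    by (auto simp: orthogonally_diagonal_def)
  define W where "W = four_block_mat (1\<^sub>m 1) (0\<^sub>m 1 n) (0\<^sub>m n 1) U'"
  define l where "l i = (case i of 0 \<Rightarrow> k | Suc j \<Rightarrow> l' j)" for i
  have W: "W \<in> carrier_mat ?n ?n" unfolding W_def
    using four_block_carrier_mat[of "1\<^sub>m 1" 1 1 U' n n] U'(1) by simp
  have Wt: "transpose_mat W = four_block_mat (1\<^sub>m 1) (0\<^sub>m 1 n) (0\<^sub>m n 1) (transpose_mat U')"
    unfolding W_def using U' by (subst transpose_four_block_mat[of _ 1 1 _ n _ n]) auto
  have WW: "W * transpose_mat W = 1\<^sub>m ?n"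
  proof -
    have "W * transpose_mat W = four_block_mat (1\<^sub>m 1) (0\<^sub>m 1 n) (0\<^sub>m n 1) (1\<^sub>m n)"
      unfolding Wt unfolding W_def using U'
      by (subst mult_four_block_mat[of _ 1 1 _ n _ n _ _ 1 _ n]) auto
    also have "\<dots> = 1\<^sub>m ?n" using four_block_one_mat[of 1 n] by simp
    finally show ?thesis .
  qed
  have dl: "mat_diag ?n l = four_block_mat (k \<cdot>\<^sub>m 1\<^sub>m 1) (0\<^sub>m 1 n) (0\<^sub>m n 1) (mat_diag n l')"
    by (rule eq_matI) (auto simp: mat_diag_def l_def split: nat.splits)
  have Bd: "B = four_block_mat (k \<cdot>\<^sub>m 1\<^sub>m 1) (0\<^sub>m 1 n) (0\<^sub>m n 1) B'"
  proof (rule eq_matI)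
    fix i j assume "i < dim_row (four_block_mat (k \<cdot>\<^sub>m 1\<^sub>m 1) (0\<^sub>m 1 n) (0\<^sub>m n 1) B')"
      "j < dim_col (four_block_mat (k \<cdot>\<^sub>m 1\<^sub>m 1) (0\<^sub>m 1 n) (0\<^sub>m n 1) B')"
    then have ij: "i < ?n" "j < ?n" using B' by auto
    then show "B $$ (i, j) = four_block_mat (k \<cdot>\<^sub>m 1\<^sub>m 1) (0\<^sub>m 1 n) (0\<^sub>m n 1) B' $$ (i, j)"
      using B0 B0' B' by (cases i; cases j) (auto simp: B'_def)
  qed (use B B' in auto)
  have BW: "B = W * mat_diag ?n l * transpose_mat W"
  proof -
    have UD: "U' * mat_diag n l' \<in> carrier_mat n n" using U'(1) by simp
    have UDU: "U' * mat_diag n l' * transpose_mat U' \<in> carrier_mat n n" using mult_carrier_mat[OF UD] U'(1) by simp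
    have z: "0\<^sub>m 1 n * mat_diag n l' = 0\<^sub>m 1 n"
      by (rule left_mult_zero_mat) simp
    have "W * mat_diag ?n l = four_block_mat (k \<cdot>\<^sub>m 1\<^sub>m 1) (0\<^sub>m 1 n) (0\<^sub>m n 1) (U' * mat_diag n l')"
      unfolding dl unfolding W_def using U' z
      by (subst mult_four_block_mat[of _ 1 1 _ n _ n _ _ 1 _ n]) auto
    then have "W * mat_diag ?n l * transpose_mat W
        = four_block_mat (k \<cdot>\<^sub>m 1\<^sub>m 1) (0\<^sub>m 1 n) (0\<^sub>m n 1) (U' * mat_diag n l' * transpose_mat U')"
      unfolding Wt using U' right_mult_zero_mat[OF UD, of 1] left_add_zero_mat[OF UDU]
      by (simp, subst mult_four_block_mat[of _ 1 1 _ n _ n _ _ 1 _ n]) auto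
    then show ?thesis unfolding Bd BU by simp
  qed
  define U where "U = H * W"
  have D: "mat_diag ?n l \<in> carrier_mat ?n ?n" by simp
  have Wtc: "transpose_mat W \<in> carrier_mat ?n ?n" using W by simp
  have Ut: "transpose_mat U = transpose_mat W * H"
    using H W Ht by (simp add: U_def transpose_mult[of _ ?n ?n _ ?n])
  have UU: "U * transpose_mat U = 1\<^sub>m ?n"
  proof -
    have "U * transpose_mat U = H * (W * transpose_mat W) * H"
      unfolding Ut unfolding U_def using H W Wtc by (simp add: assoc_mult_mat[of _ ?n ?n _ ?n _ ?n])
    then show ?thesis using WW H HH by simp
  qed
  have "A = U * mat_diag ?n l * transpose_mat U"
  proof -
    have "U * mat_diag ?n l * transpose_mat U = H * (W * mat_diag ?n l * transpose_mat W) * H"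
      unfolding Ut unfolding U_def
      using H W Wtc D mult_carrier_mat[OF D Wtc] mult_carrier_mat[OF W mult_carrier_mat[OF D Wtc]]
      by (simp add: assoc_mult_mat[of _ ?n ?n _ ?n _ ?n])
    then show ?thesis using HAH BW by simp
  qed
  moreover have "col U 0 = v"
  proof -
    have "col U 0 = H *\<^sub>v col W 0" unfolding U_def using H W by (subst col_mult2[of _ ?n ?n _ ?n]) auto
    also have "col W 0 = unit_vec ?n 0"
      using W U'(1) by (intro eq_vecI) (auto simp: W_def)
    also have "\<dots> = col (1\<^sub>m ?n) 0" by simp
    also have "H *\<^sub>v col (1\<^sub>m ?n) 0 = col (H * 1\<^sub>m ?n) 0"
      using H by (subst col_mult2[of _ ?n ?n _ ?n]) auto
    also have "\<dots> = col H 0" using H by simp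
    finally show ?thesis using H0 by simp
  qed
  ultimately show ?thesis
    unfolding orthogonally_diagonal_def using UU H W by (intro exI[of _ U] exI[of _ l]) (auto simp: U_def l_def)
qed

lemma symmetric_mat_orthogonally_diagonal:
  fixes A :: "real mat"
  assumes "A \<in> carrier_mat n n" "transpose_mat A = A"
  shows "\<exists>U l. orthogonally_diagonal n A U l"
  using assms
proof (induction n arbitrary: A)
  case 0
  then show ?case
    by (intro exI[of _ "1\<^sub>m 0"] exI[of _ "\<lambda>_. 0"]) (auto simp: orthogonally_diagonal_def)
next
  case (Suc n)
  obtain v k where "v \<in> carrier_vec (Suc n)" "v \<bullet> v = 1" "A *\<^sub>v v = k \<cdot>\<^sub>v v"
    using symmetric_mat_real_eigenvector[OF Suc.prems] by auto
  from symmetric_mat_deflation[OF Suc.prems this] Suc.IH show ?case by blast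
qed

text \<open>The entrywise form in which the diagonalisation is used: every unit eigenvector extends
  to an orthonormal eigenbasis, whose \<open>k\<close>-th vector has the entries \<open>u i k\<close>.\<close>

lemma symmetric_eigenbasis_extension:
  fixes a :: "nat \<Rightarrow> nat \<Rightarrow> real"
  assumes sym: "\<And>i j. i < n \<Longrightarrow> j < n \<Longrightarrow> a i j = a j i" and n: "n > 0"
    and unit: "(\<Sum>i<n. (v i)\<^sup>2) = 1"
    and eig: "\<And>i. i < n \<Longrightarrow> (\<Sum>j<n. a i j * v j) = k * v i"
  obtains u l where
    "\<And>i j. i < n \<Longrightarrow> j < n \<Longrightarrow> (\<Sum>k<n. u i k * u j k) = (if i = j then 1 else 0)"
    "\<And>i j. i < n \<Longrightarrow> j < n \<Longrightarrow> (\<Sum>k<n. u k i * u k j) = (if i = j then 1 else 0)"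
    "\<And>i j. i < n \<Longrightarrow> j < n \<Longrightarrow> a i j = (\<Sum>k<n. l k * (u i k * u j k))"
    "\<And>i. i < n \<Longrightarrow> u i 0 = v i" "l 0 = k"
proof -
  obtain m where m: "n = Suc m" using n by (cases n) auto
  define A where "A = Matrix.mat n n (\<lambda>(i, j). a i j)"
  have A: "A \<in> carrier_mat n n" by (simp add: A_def)
  have At: "transpose_mat A = A" by (rule eq_matI) (auto simp: A_def sym)
  define w where "w = Matrix.vec n v"
  have w: "w \<in> carrier_vec n" "w \<bullet> w = 1" "A *\<^sub>v w = k \<cdot>\<^sub>v w"
    using unit eig by (auto simp: w_def A_def scalar_prod_def lessThan_atLeast0 power2_eq_square
        intro!: eq_vecI)
  obtain U l where U: "orthogonally_diagonal n A U l" "col U 0 = w" "l 0 = k"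
    using symmetric_mat_deflation[of A m w k] A At w symmetric_mat_orthogonally_diagonal
    unfolding m by blast
  have Uc: "U \<in> carrier_mat n n" and UU: "U * transpose_mat U = 1\<^sub>m n"
    and AU: "A = U * mat_diag n l * transpose_mat U"
    using U(1) by (auto simp: orthogonally_diagonal_def)
  have UU': "transpose_mat U * U = 1\<^sub>m n"
    using mat_mult_left_right_inverse[OF Uc _ UU] Uc by simp
  show ?thesis
  proof (rule that[of "\<lambda>i j. U $$ (i, j)" l])
    fix i j assume ij: "i < n" "j < n"
    show "(\<Sum>k<n. U $$ (i, k) * U $$ (j, k)) = (if i = j then 1 else 0)"
      using arg_cong[OF UU, of "\<lambda>B. B $$ (i, j)"] ij Uc
      by (simp add: scalar_prod_def lessThan_atLeast0)
    show "(\<Sum>k<n. U $$ (k, i) * U $$ (k, j)) = (if i = j then 1 else 0)"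
      using arg_cong[OF UU', of "\<lambda>B. B $$ (i, j)"] ij Uc
      by (simp add: scalar_prod_def lessThan_atLeast0)
    show "a i j = (\<Sum>k<n. l k * (U $$ (i, k) * U $$ (j, k)))"
      using arg_cong[OF AU, of "\<lambda>B. B $$ (i, j)"] ij Uc
      unfolding mat_diag_mult_right[OF Uc]
      by (simp add: A_def scalar_prod_def lessThan_atLeast0 mult_ac)
  next
    fix i assume "i < n"
    then show "U $$ (i, 0) = v i"
      using arg_cong[OF U(2), of "\<lambda>x. x $ i"] Uc n by (simp add: w_def)
  qed (rule U(3))
qed

lemma det_orthogonal_conjugate:
  fixes u :: "nat \<Rightarrow> nat \<Rightarrow> real"
  assumes u: "\<And>i j. i < n \<Longrightarrow> j < n \<Longrightarrow> (\<Sum>k<n. u i k * u j k) = (if i = j then 1 else 0)"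
  shows "det (Matrix.mat n n (\<lambda>(i, j). \<Sum>k<n. l k * (u i k * u j k))) = (\<Prod>k<n. l k)"
proof -
  define U where "U = Matrix.mat n n (\<lambda>(i, j). u i j)"
  have U: "U \<in> carrier_mat n n" by (simp add: U_def)
  have UU: "U * transpose_mat U = 1\<^sub>m n"
    by (rule eq_matI) (auto simp: U_def scalar_prod_def u lessThan_atLeast0[symmetric])
  have e: "Matrix.mat n n (\<lambda>(i, j). \<Sum>k<n. l k * (u i k * u j k)) = U * mat_diag n l * transpose_mat U"
    unfolding mat_diag_mult_right[OF U]
    by (rule eq_matI) (auto simp: U_def scalar_prod_def lessThan_atLeast0 mult_ac)
  have "det (U * mat_diag n l * transpose_mat U) = det U * det (mat_diag n l) * det (transpose_mat U)"
    using U by (simp add: det_mult[of _ n])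
  moreover have "det U * det (transpose_mat U) = 1"
    using arg_cong[OF UU, of det] U by (simp add: det_mult[of _ n])
  moreover have "det (mat_diag n l) = (\<Prod>k<n. l k)"
  proof -
    have "det (mat_diag n l) = prod_list (diag_mat (mat_diag n l))"
      by (rule det_upper_triangular) (auto simp: mat_diag_def)
    also have "\<dots> = (\<Prod>k<n. l k)"
      by (simp add: diag_mat_def mat_diag_def prod.list_conv_set_nth lessThan_atLeast0)
    finally show ?thesis .
  qed
  ultimately have "det (U * mat_diag n l * transpose_mat U) = (\<Prod>k<n. l k)" by simp
  then show ?thesis unfolding e .
qed

section \<open>Spanning trees as parent maps\<close>

lemma walk_imp_path:
  assumes "(u, v) \<in> {(x, y). {x, y} \<in> E}\<^sup>*"
  shows "\<exists>xs. xs \<noteq> [] \<and> hd xs = u \<and> last xs = v \<and> distinct xs \<and>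
           (\<forall>i. Suc i < length xs \<longrightarrow> {xs ! i, xs ! Suc i} \<in> E)"
  using assms
proof (induction rule: converse_rtrancl_induct)
  case base
  then show ?case by (intro exI[of _ "[v]"]) auto
next
  case (step y z)
  then obtain xs where xs: "xs \<noteq> []" "hd xs = z" "last xs = v" "distinct xs"
    "\<And>i. Suc i < length xs \<Longrightarrow> {xs ! i, xs ! Suc i} \<in> E" by blast
  show ?case
  proof (cases "y \<in> set xs")
    case True
    then obtain k where k: "k < length xs" "xs ! k = y" by (auto simp: in_set_conv_nth)
    then show ?thesis
      by (intro exI[of _ "drop k xs"]) (use xs in \<open>auto simp: hd_drop_conv_nth last_drop\<close>)
  next
    case False
    have "{(y # xs) ! i, (y # xs) ! Suc i} \<in> E" if "Suc i < length (y # xs)" for i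
      using that xs step(1) by (cases i) (auto simp: hd_conv_nth)
    then show ?thesis
      by (intro exI[of _ "y # xs"]) (use xs False in auto)
  qed
qed

text \<open>An edge whose ends are already joined by other edges of \<open>T\<close> would close up a cycle.\<close>

lemma acyclic_edge_not_in_connected_part:
  assumes "\<nexists>xs. graph_cycle T xs" and "{u, v} \<in> edges T" and "u \<noteq> v"
    and "E \<subseteq> edges T" and "(u, v) \<in> {(x, y). {x, y} \<in> E}\<^sup>*"
    and V: "\<And>e. e \<in> edges T \<Longrightarrow> e \<subseteq> vertices T"
  shows "{u, v} \<in> E"
proof (rule ccontr)
  assume uv: "{u, v} \<notin> E"
  obtain xs where xs: "xs \<noteq> []" "hd xs = u" "last xs = v" "distinct xs"
    "\<And>i. Suc i < length xs \<Longrightarrow> {xs ! i, xs ! Suc i} \<in> E"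
    using walk_imp_path[OF assms(5)] by blast
  have h0: "xs ! 0 = u" and l0: "xs ! (length xs - 1) = v"
    using xs by (auto simp: hd_conv_nth last_conv_nth)
  have n1: "length xs \<noteq> 1" using h0 l0 assms(3) by auto
  have n2: "length xs \<noteq> 2" using h0 l0 uv xs(5)[of 0] by auto
  have len: "length xs \<ge> 3" using n1 n2 xs(1) by (cases "length xs") auto
  have ed: "{xs ! i, xs ! (Suc i mod length xs)} \<in> edges T" if "i < length xs" for i
  proof (cases "Suc i < length xs")
    case True
    then show ?thesis using xs(5)[of i] assms(4) by auto
  next
    case False
    then have sl: "Suc i = length xs" using that by auto
    then have i: "i = length xs - 1" by linarith
    have "xs ! i = v" using l0 unfolding i .
    moreover have "xs ! (Suc i mod length xs) = u" unfolding sl using h0 by simp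
    ultimately show ?thesis using assms(2) by (simp add: insert_commute)
  qed
  have "set xs \<subseteq> vertices T"
    using ed V by (fastforce simp: in_set_conv_nth)
  then have "graph_cycle T xs" using len xs(4) ed by (auto simp: graph_cycle_def)
  then show False using assms(1) by blast
qed

text \<open>Spanning trees are counted through their parent maps: orienting a tree towards the root
  \<open>r\<close>, every other vertex has exactly one outgoing edge. The map is the identity at the root and
  off the graph, so that it is determined by its tree.\<close>

definition rooted_parent_maps :: "'a graph \<Rightarrow> 'a \<Rightarrow> ('a \<Rightarrow> 'a) set" where
  "rooted_parent_maps G r = {p. p r = r \<and> (\<forall>v. v \<notin> vertices G \<longrightarrow> p v = v) \<and>
     (\<forall>v\<in>vertices G - {r}. p v \<in> vertices G \<and> {v, p v} \<in> edges G) \<and>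
     (\<forall>v\<in>vertices G. \<exists>k. (p ^^ k) v = r)}"

definition parent_tree :: "'a graph \<Rightarrow> 'a \<Rightarrow> ('a \<Rightarrow> 'a) \<Rightarrow> 'a graph" where
  "parent_tree G r p = \<lparr>vertices = vertices G, edges = {{v, p v} | v. v \<in> vertices G - {r}}\<rparr>"

definition depth :: "'a \<Rightarrow> ('a \<Rightarrow> 'a) \<Rightarrow> 'a \<Rightarrow> nat" where
  "depth r p v = (LEAST k. (p ^^ k) v = r)"

lemma depth_parent:
  assumes "\<exists>k. (p ^^ k) v = r" and "v \<noteq> r"
  shows "depth r p v = Suc (depth r p (p v))"
proof -
  obtain k where k: "(p ^^ k) v = r" using assms(1) by blast
  have "(LEAST k. (p ^^ k) v = r) = Suc (LEAST k. (p ^^ Suc k) v = r)"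
    by (rule Least_Suc[where P = "\<lambda>k. (p ^^ k) v = r" and n = k]) (use assms(2) k in simp_all)
  then show ?thesis unfolding depth_def by (simp add: funpow_swap1)
qed

lemma parent_map_no_two_cycle:
  assumes "p \<in> rooted_parent_maps G r" "v \<in> vertices G" "v \<noteq> r"
  shows "p (p v) \<noteq> v" and "p v \<noteq> v"
proof -
  have reach: "\<exists>k. (p ^^ k) w = r" if "w \<in> vertices G" for w
    using assms(1) that by (auto simp: rooted_parent_maps_def)
  have pv: "p v \<in> vertices G" using assms by (auto simp: rooted_parent_maps_def)
  have pr: "p r = r" using assms(1) by (simp add: rooted_parent_maps_def)
  have d: "depth r p v = Suc (depth r p (p v))" using depth_parent reach assms(2,3) by metis
  show "p v \<noteq> v" using d by auto
  show "p (p v) \<noteq> v"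
  proof
    assume a: "p (p v) = v"
    then have "p v \<noteq> r" using pr assms(3) by auto
    then have "depth r p (p v) = Suc (depth r p v)" using depth_parent reach pv a by metis
    then show False using d by simp
  qed
qed

text \<open>On a cycle, a vertex of maximal depth would have two different neighbours, but each of
  them would have to be its parent.\<close>

lemma parent_tree_spanning:
  assumes G: "simple_graph G" and p: "p \<in> rooted_parent_maps G r" and r: "r \<in> vertices G"
  shows "parent_tree G r p \<in> spanning_trees G"
proof -
  let ?T = "parent_tree G r p" and ?V = "vertices G"
  have pv: "p v \<in> ?V" "{v, p v} \<in> edges G" if "v \<in> ?V" "v \<noteq> r" for v
    using p that by (auto simp: rooted_parent_maps_def)
  have reach: "\<exists>k. (p ^^ k) w = r" if "w \<in> ?V" for w
    using p that by (auto simp: rooted_parent_maps_def)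
  have sel: "vertices ?T = ?V" "edges ?T = {{v, p v} | v. v \<in> ?V - {r}}"
    by (auto simp: parent_tree_def)
  have simple: "simple_graph ?T"
    unfolding simple_graph_def
  proof (intro conjI subsetI)
    show "finite (vertices ?T)" using G by (simp add: simple_graph_def sel)
    fix e assume "e \<in> edges ?T"
    then obtain v where v: "v \<in> ?V" "v \<noteq> r" "e = {v, p v}" by (auto simp: sel)
    then have "p v \<in> ?V" "v \<noteq> p v" using pv parent_map_no_two_cycle(2)[OF p v(1,2)] by auto
    then show "e \<in> {{u, w} | u w. u \<in> vertices ?T \<and> w \<in> vertices ?T \<and> u \<noteq> w}"
      unfolding sel using v by blast
  qed
  have sub: "subgraph_of ?T G"
    using simple pv by (auto simp: subgraph_of_def sel)
  let ?R = "{(x, y). {x, y} \<in> edges ?T}"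
  have symR: "sym (?R\<^sup>*)"
    by (intro sym_rtrancl symI) (auto simp: insert_commute)
  have toroot: "(v, r) \<in> ?R\<^sup>*" if "v \<in> ?V" for v
    using that
  proof (induction "depth r p v" arbitrary: v)
    case 0
    have "(p ^^ depth r p v) v = r" unfolding depth_def using reach[OF 0(2)] by (rule LeastI_ex)
    then show ?case using 0 by simp
  next
    case (Suc d)
    show ?case
    proof (cases "v = r")
      case False
      then have "(p v, r) \<in> ?R\<^sup>*"
        using Suc depth_parent[OF reach False] pv by auto
      moreover have "(v, p v) \<in> ?R" using False Suc(3) by (auto simp: sel)
      ultimately show ?thesis by (meson converse_rtrancl_into_rtrancl)
    qed simp
  qed
  have conn: "connected_graph ?T"
    unfolding connected_graph_def sel(1)
  proof (intro conjI ballI)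
    show "?V \<noteq> {}" using r by blast
    fix u v assume "u \<in> ?V" "v \<in> ?V"
    then have "(u, r) \<in> ?R\<^sup>*" "(r, v) \<in> ?R\<^sup>*" using toroot symD[OF symR] by auto
    then show "(u, v) \<in> ?R\<^sup>*" by (rule rtrancl_trans)
  qed
  have "\<not> graph_cycle ?T xs" for xs
  proof
    assume c: "graph_cycle ?T xs"
    let ?n = "length xs"
    have len: "?n \<ge> 3" and dist: "distinct xs" and inV: "set xs \<subseteq> ?V"
      and ed: "\<And>i. i < ?n \<Longrightarrow> {xs ! i, xs ! (Suc i mod ?n)} \<in> edges ?T"
      using c by (auto simp: graph_cycle_def sel)
    define m where "m = (ARG_MAX (\<lambda>i. depth r p (xs ! i)) i. i < ?n)"
    have m: "m < ?n" and mmax: "\<And>i. i < ?n \<Longrightarrow> depth r p (xs ! i) \<le> depth r p (xs ! m)"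
    proof -
      define M where "M = Max ((\<lambda>i. depth r p (xs ! i)) ` {..<?n})"
      have b: "\<And>i. i < ?n \<Longrightarrow> depth r p (xs ! i) < Suc M"
        unfolding M_def by (simp add: le_imp_less_Suc)
      have "m < ?n \<and> (\<forall>i. i < ?n \<longrightarrow> depth r p (xs ! i) \<le> depth r p (xs ! m))"
        unfolding m_def by (rule arg_max_nat_lemma[of _ 0 _ "Suc M"]) (use b len in auto)
      then show "m < ?n" "\<And>i. i < ?n \<Longrightarrow> depth r p (xs ! i) \<le> depth r p (xs ! m)" by auto
    qed
    \<comment> \<open>A neighbour of a vertex of maximal depth on the cycle can only be its parent.\<close>
    have up: "xs ! j = p (xs ! m)" if j: "j < ?n" and e: "{xs ! m, xs ! j} \<in> edges ?T" for j
    proof -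
      obtain v where v: "v \<in> ?V" "v \<noteq> r" "{xs ! m, xs ! j} = {v, p v}" using e by (auto simp: sel)
      then consider "v = xs ! m" "p v = xs ! j" | "v = xs ! j" "p v = xs ! m"
        by (auto simp: doubleton_eq_iff)
      then show ?thesis
      proof cases
        case 2
        then have "depth r p (xs ! j) = Suc (depth r p (xs ! m))"
          using depth_parent[OF reach[OF v(1)] v(2)] by simp
        then show ?thesis using mmax[OF j] by simp
      qed simp
    qed
    define s where "s = Suc m mod ?n"
    define t where "t = (m + ?n - 1) mod ?n"
    have n0: "?n > 0" using len by linarith
    have s: "s < ?n" and t: "t < ?n" unfolding s_def t_def by (rule mod_less_divisor[OF n0])+
    have st: "Suc t mod ?n = m" "s \<noteq> t"
    proof -
      show "Suc t mod ?n = m"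
      proof -
        have "Suc (m + ?n - 1) = m + ?n" using n0 by linarith
        then show ?thesis unfolding t_def mod_Suc_eq using m by simp
      qed
      show "s \<noteq> t"
        unfolding s_def t_def using m len
        by (cases "m = 0"; cases "Suc m = ?n") (auto simp: mod_if)
    qed
    have "xs ! s = p (xs ! m)" using up[OF s] ed[OF m] by (simp add: s_def)
    moreover have "xs ! t = p (xs ! m)" using up[OF t] ed[OF t] st by (simp add: insert_commute)
    ultimately show False using st(2) dist s t nth_eq_iff_index_eq by metis
  qed
  then show ?thesis using sub simple conn by (auto simp: spanning_trees_def tree_graph_def sel)
qed

text \<open>If two parent maps with the same edges differ at \<open>v\<close>, then the second one sends the
  parent of \<open>v\<close> back to \<open>v\<close>. Taking \<open>v\<close> of least depth, the first one does so too, which is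
  impossible.\<close>

lemma inj_on_parent_tree:
  assumes "r \<in> vertices G"
  shows "inj_on (parent_tree G r) (rooted_parent_maps G r)"
proof (rule inj_onI)
  fix p g assume p: "p \<in> rooted_parent_maps G r" and g: "g \<in> rooted_parent_maps G r"
    and eq: "parent_tree G r p = parent_tree G r g"
  let ?V = "vertices G"
  have E: "{{v, p v} | v. v \<in> ?V - {r}} = {{v, g v} | v. v \<in> ?V - {r}}"
    using eq by (simp add: parent_tree_def)
  have reach: "\<exists>k. (p ^^ k) w = r" if "w \<in> ?V" for w
    using p that by (auto simp: rooted_parent_maps_def)
  have "p v = g v" if "v \<in> ?V" for v
    using that
  proof (induction "depth r p v" arbitrary: v rule: less_induct)
    case less
    show ?case
    proof (cases "v = r")
      case True
      then show ?thesis using p g by (simp add: rooted_parent_maps_def)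
    next
      case False
      show ?thesis
      proof (rule ccontr)
        assume ne: "p v \<noteq> g v"
        have "{v, p v} \<in> {{v, g v} | v. v \<in> ?V - {r}}" using E False less(2) by blast
        then obtain w where w: "w \<in> ?V" "w \<noteq> r" "{v, p v} = {w, g w}" by auto
        then have w': "w = p v" "g w = v" using ne by (auto simp: doubleton_eq_iff)
        have "depth r p w < depth r p v"
          using depth_parent[OF reach[OF less(2)] False] w' by simp
        then have "p w = g w" using less(1) w(1) by blast
        then have "p (p v) = v" using w' by simp
        then show False using parent_map_no_two_cycle(1)[OF p less(2) False] by simp
      qed
    qed
  qed
  moreover have "p v = g v" if "v \<notin> ?V" for v
    using p g that by (simp add: rooted_parent_maps_def)
  ultimately show "p = g" by blast
qed

text \<open>Sending each vertex to a neighbour closer to the root gives a parent map whose tree is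
  contained in \<open>T\<close>. It is connected, hence any further edge of \<open>T\<close> would close up a cycle.\<close>

lemma spanning_tree_is_parent_tree:
  assumes T: "T \<in> spanning_trees G" and r: "r \<in> vertices G"
  shows "T \<in> parent_tree G r ` rooted_parent_maps G r"
proof -
  let ?V = "vertices G" and ?R = "{(x, y). {x, y} \<in> edges T}"
  have TV: "vertices T = ?V" and ET: "edges T \<subseteq> edges G" and simple: "simple_graph T"
    and conn: "connected_graph T" and acyc: "\<nexists>xs. graph_cycle T xs"
    using T by (auto simp: spanning_trees_def subgraph_of_def tree_graph_def)
  have eV: "\<And>e. e \<in> edges T \<Longrightarrow> e \<subseteq> vertices T"
    using simple by (fastforce simp: simple_graph_def)
  have ex: "\<exists>k. (v, r) \<in> ?R ^^ k" if "v \<in> ?V" for v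
    using conn that r TV unfolding connected_graph_def by (metis rtrancl_imp_relpow)
  define h where "h v = (LEAST k. (v, r) \<in> ?R ^^ k)" for v
  have hv: "(v, r) \<in> ?R ^^ h v" if "v \<in> ?V" for v
    unfolding h_def using ex[OF that] by (rule LeastI_ex)
  have hr: "h r = 0" unfolding h_def by (rule Least_equality) auto
  have step: "\<exists>w. {v, w} \<in> edges T \<and> w \<in> ?V \<and> h w < h v" if v: "v \<in> ?V" "v \<noteq> r" for v
  proof -
    obtain k where k: "h v = Suc k" using hv[OF v(1)] v(2) by (cases "h v") auto
    then obtain w where w: "(v, w) \<in> ?R" "(w, r) \<in> ?R ^^ k"
      using hv[OF v(1)] by (metis relpow_Suc_D2)
    have "h w \<le> k" unfolding h_def using w(2) by (rule Least_le)
    then show ?thesis using w eV[of "{v, w}"] TV k by auto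
  qed
  define p where "p v = (if v \<in> ?V - {r} then SOME w. {v, w} \<in> edges T \<and> w \<in> ?V \<and> h w < h v else v)" for v
  have p: "{v, p v} \<in> edges T" "p v \<in> ?V" "h (p v) < h v" if "v \<in> ?V" "v \<noteq> r" for v
    using someI_ex[OF step[OF that]] that by (auto simp: p_def)
  have reach: "\<exists>k. (p ^^ k) v = r" if "v \<in> ?V" for v
    using that
  proof (induction "h v" arbitrary: v rule: less_induct)
    case less
    show ?case
    proof (cases "v = r")
      case True
      then show ?thesis by (intro exI[of _ 0]) simp
    next
      case False
      then obtain k where "(p ^^ k) (p v) = r" using less p by meson
      then show ?thesis by (intro exI[of _ "Suc k"]) (simp add: funpow_swap1)
    qed
  qed
  have pm: "p \<in> rooted_parent_maps G r"
    unfolding rooted_parent_maps_def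
  proof (intro CollectI conjI allI impI ballI)
    fix v assume "v \<in> ?V - {r}"
    then show "p v \<in> ?V" "{v, p v} \<in> edges G" using p ET by auto
  qed (auto simp: reach, auto simp: p_def)
  let ?P = "parent_tree G r p"
  have sub: "edges ?P \<subseteq> edges T" using p by (auto simp: parent_tree_def)
  have GV: "simple_graph \<lparr>vertices = ?V, edges = edges T\<rparr>" using simple TV by (simp add: simple_graph_def)
  have pm': "p \<in> rooted_parent_maps \<lparr>vertices = ?V, edges = edges T\<rparr> r"
    using pm p by (auto simp: rooted_parent_maps_def)
  have connP: "connected_graph ?P"
    using parent_tree_spanning[OF GV pm'] r
    by (auto simp: spanning_trees_def tree_graph_def parent_tree_def)
  have "edges T \<subseteq> edges ?P"
  proof
    fix e assume e: "e \<in> edges T"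
    then obtain u v where uv: "e = {u, v}" "u \<in> ?V" "v \<in> ?V" "u \<noteq> v"
      using simple TV by (auto simp: simple_graph_def)
    have "(u, v) \<in> {(x, y). {x, y} \<in> edges ?P}\<^sup>*"
      using connP uv unfolding connected_graph_def by (auto simp: parent_tree_def)
    then show "e \<in> edges ?P"
      using acyclic_edge_not_in_connected_part[OF acyc _ uv(4) sub _ eV] e uv(1) by blast
  qed
  then have "edges T = edges ?P" using sub by blast
  then have "T = ?P" using TV by (simp add: parent_tree_def)
  then show ?thesis using pm by blast
qed

lemma card_rooted_parent_maps:
  assumes "simple_graph G" "r \<in> vertices G"
  shows "card (rooted_parent_maps G r) = num_spanning_trees G"
proof -
  have "bij_betw (parent_tree G r) (rooted_parent_maps G r) (spanning_trees G)"
    unfolding bij_betw_def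
    using inj_on_parent_tree[OF assms(2)] parent_tree_spanning[OF assms(1) _ assms(2)]
      spanning_tree_is_parent_tree[OF _ assms(2)] by blast
  then show ?thesis unfolding num_spanning_trees_def by (rule bij_betw_same_card)
qed

section \<open>The matrix-tree theorem\<close>

text \<open>If every index is led to \<open>0\<close>, only the identity contributes to the Leibniz sum: a
  permutation that moves \<open>i\<close> must follow \<open>f\<close> along the whole orbit of \<open>i\<close>, which ends in \<open>0\<close>.
  Otherwise the indicator vector of the indices that never reach \<open>0\<close> is in the kernel.\<close>

lemma det_rooted_map:
  fixes f :: "nat \<Rightarrow> nat"
  assumes n: "n > 0" and f0: "f 0 = 0" and fn: "\<And>i. i < n \<Longrightarrow> f i < n"
  shows "det (Matrix.mat n n (\<lambda>(i, k). if i = 0 then (if k = 0 then 1 else 0)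
            else (if k = i then 1 else 0) - (if k = f i \<and> k \<noteq> 0 then 1 else 0)))
       = (if \<forall>i<n. \<exists>k. (f ^^ k) i = 0 then 1 else (0::real))" (is "det ?B = _")
proof -
  have B: "?B \<in> carrier_mat n n" by simp
  show ?thesis
  proof (cases "\<forall>i<n. \<exists>k. (f ^^ k) i = 0")
    case True
    have diag: "f i \<noteq> i" if "i < n" "i \<noteq> 0" for i
    proof
      assume "f i = i"
      then have "(f ^^ k) i = i" for k by (induction k) auto
      then show False using True that by metis
    qed
    have vanish: "(\<Prod>i = 0..<n. ?B $$ (i, p i)) = 0" if p: "p permutes {0..<n}" and "p \<noteq> id" for p
    proof (rule ccontr)
      assume nz: "(\<Prod>i = 0..<n. ?B $$ (i, p i)) \<noteq> 0"
      have pn: "p i < n" if "i < n" for i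
        using permutes_in_image[OF p, of i] that by simp
      have choice: "p i = i \<or> (i \<noteq> 0 \<and> p i = f i \<and> f i \<noteq> 0)" if i: "i < n" for i
      proof -
        have "?B $$ (i, p i) \<noteq> 0" using nz i by auto
        then show ?thesis using i pn[OF i] by (auto split: if_splits)
      qed
      obtain i where i: "p i \<noteq> i" using \<open>p \<noteq> id\<close> by (auto simp: fun_eq_iff)
      then have i_n: "i < n" using p by (metis atLeastLessThan_iff permutes_not_in zero_le)
      have "(f ^^ k) i < n \<and> p ((f ^^ k) i) \<noteq> (f ^^ k) i" for k
      proof (induction k)
        case (Suc k)
        let ?x = "(f ^^ k) i"
        have x: "?x < n" "p ?x \<noteq> ?x" using Suc by auto
        then have "p ?x = f ?x" using choice by auto
        moreover have "p (f ?x) \<noteq> f ?x"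
          using x(2) calculation permutes_inj[OF p] by (metis injD)
        ultimately show ?case using fn x(1) by simp
      qed (use i i_n in auto)
      moreover obtain k where "(f ^^ k) i = 0" using True i_n by blast
      moreover have "p 0 = 0" using choice[OF n] by auto
      ultimately show False by metis
    qed
    have "det ?B = (\<Sum>p\<in>{p. p permutes {0..<n}}. signof p * (\<Prod>i = 0..<n. ?B $$ (i, p i)))"
      by (rule det_def'[OF B])
    also have "\<dots> = (\<Sum>p\<in>{id}. signof p * (\<Prod>i = 0..<n. ?B $$ (i, p i)))"
    proof (rule sum.mono_neutral_right)
      show "\<forall>p\<in>{p. p permutes {0..<n}} - {id}. signof p * (\<Prod>i = 0..<n. ?B $$ (i, p i)) = 0"
        using vanish by (metis (no_types, lifting) DiffE insertCI mem_Collect_eq mult_zero_right)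
    qed (auto simp: finite_permutations permutes_id)
    also have "\<dots> = (\<Prod>i = 0..<n. ?B $$ (i, i))" by simp
    also have "\<dots> = 1" using diag diag[symmetric] by (intro prod.neutral) auto
    finally show ?thesis using True by simp
  next
    case False
    define C where "C i \<longleftrightarrow> (\<forall>k. (f ^^ k) i \<noteq> 0)" for i
    have C0: "\<not> C 0" unfolding C_def by (auto intro!: exI[of _ 0])
    have Cf: "C i \<longleftrightarrow> C (f i)" if "i \<noteq> 0" for i
    proof
      assume "C i"
      then show "C (f i)" unfolding C_def by (metis comp_apply funpow_Suc_right)
    next
      assume "C (f i)"
      then show "C i" unfolding C_def using that
        by (metis comp_apply funpow_0 funpow_Suc_right not0_implies_Suc)
    qed
    define w where "w = Matrix.vec n (\<lambda>i. if C i then 1 else (0::real))"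
    have w: "w \<in> carrier_vec n" by (simp add: w_def)
    obtain i where i: "i < n" "C i" using False by (auto simp: C_def)
    have "w \<noteq> 0\<^sub>v n"
    proof
      assume "w = 0\<^sub>v n"
      then have "w $ i = 0" using i by simp
      then show False using i by (simp add: w_def)
    qed
    moreover have "?B *\<^sub>v w = 0\<^sub>v n"
    proof (rule eq_vecI)
      fix i assume "i < dim_vec (0\<^sub>v n :: real vec)"
      then have i: "i < n" by simp
      have "(?B *\<^sub>v w) $ i = (\<Sum>k<n. ?B $$ (i, k) * w $ k)"
        using i w by (simp add: scalar_prod_def lessThan_atLeast0)
      also have "\<dots> = 0"
      proof (cases "i = 0")
        case True
        have "(\<Sum>k<n. ?B $$ (i, k) * w $ k) = (\<Sum>k<n. if k = 0 then w $ k else 0)"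
          using True n by (intro sum.cong refl) auto
        then show ?thesis using n C0 by (simp add: w_def)
      next
        case False
        have "(\<Sum>k<n. ?B $$ (i, k) * w $ k)
            = (\<Sum>k<n. (if k = i then w $ k else 0) - (if k = f i then (if C (f i) then 1 else 0) else 0))"
          using False i C0 by (intro sum.cong refl) (auto simp: w_def)
        also have "\<dots> = (if C i then 1 else 0) - (if C (f i) then 1 else 0)"
          using i fn[OF i] unfolding sum_subtractf by (simp add: w_def)
        finally show ?thesis using Cf[OF False] by simp
      qed
      finally show "(?B *\<^sub>v w) $ i = 0\<^sub>v n $ i" using i by simp
    qed simp
    ultimately have "det ?B = 0" using det_0_iff_vec_prod_zero[OF B] w by blast
    then show ?thesis using False by auto
  qed
qed

definition laplacian :: "nat \<Rightarrow> (nat \<Rightarrow> nat \<Rightarrow> real) \<Rightarrow> nat \<Rightarrow> nat \<Rightarrow> real" where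
  "laplacian n a i j = (if i = j then \<Sum>k<n. a i k else 0) - a i j"

text \<open>The Laplacian with the row and the column of the root \<open>0\<close> replaced by those of the
  identity. Its determinant is that of the reduced Laplacian, while all matrices keep the size
  \<open>n\<close>.\<close>

definition grounded_laplacian :: "nat \<Rightarrow> (nat \<Rightarrow> nat \<Rightarrow> real) \<Rightarrow> real mat" where
  "grounded_laplacian n a = Matrix.mat n n (\<lambda>(i, j).
     if i = 0 \<or> j = 0 then (if i = j then 1 else 0) else laplacian n a i j)"

definition rooted_nat_maps :: "nat \<Rightarrow> (nat \<Rightarrow> nat \<Rightarrow> bool) \<Rightarrow> (nat \<Rightarrow> nat) set" where
  "rooted_nat_maps n adj = {f. f 0 = 0 \<and> (\<forall>i. i \<notin> {0..<n} \<longrightarrow> f i = i) \<and>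
     (\<forall>i\<in>{0..<n}. f i \<in> {0..<n}) \<and> (\<forall>i\<in>{0<..<n}. adj i (f i)) \<and> (\<forall>i<n. \<exists>k. (f ^^ k) i = 0)}"

text \<open>Row \<open>i\<close> of the matrix is the sum over the neighbours \<open>j\<close> of \<open>i\<close> of \<open>e\<^sub>i - e\<^sub>j\<close> (or of \<open>e\<^sub>i\<close>,
  if \<open>j\<close> is the root). Expanding the determinant in all rows at once gives one summand for each
  choice of a neighbour \<open>f i\<close> for every \<open>i\<close>, and the summand is \<open>1\<close> or \<open>0\<close> according to whether
  \<open>f\<close> leads to the root.\<close>

lemma det_grounded_laplacian:
  assumes n: "n > 0"
  shows "det (grounded_laplacian n (\<lambda>i j. of_bool (adj i j))) = real (card (rooted_nat_maps n adj))"
proof -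
  let ?S = "{0..<n}"
  define a where "a i j = Matrix.vec n (\<lambda>k. if i = 0 then (if j = 0 \<and> k = 0 then 1 else 0)
     else if adj i j then (if k = i then 1 else 0) - (if k = j \<and> k \<noteq> 0 then 1 else 0) else (0::real))"
    for i j
  let ?F = "{f. (\<forall>i\<in>?S. f i \<in> ?S) \<and> (\<forall>i. i \<notin> ?S \<longrightarrow> f i = i)}"
  have a: "a i j \<in> carrier_vec n" for i j by (simp add: a_def)
  have "grounded_laplacian n (\<lambda>i j. of_bool (adj i j))
      = mat\<^sub>r n n (\<lambda>i. finsum_vec TYPE(real) n (a i) ?S)"
  proof (rule eq_matI)
    fix i k assume "i < dim_row (mat\<^sub>r n n (\<lambda>i. finsum_vec TYPE(real) n (a i) ?S))"
      "k < dim_col (mat\<^sub>r n n (\<lambda>i. finsum_vec TYPE(real) n (a i) ?S))"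
    then have ik: "i < n" "k < n" by auto
    have "mat\<^sub>r n n (\<lambda>i. finsum_vec TYPE(real) n (a i) ?S) $$ (i, k) = (\<Sum>j<n. a i j $ k)"
      using ik a by (simp add: index_finsum_vec lessThan_atLeast0)
    also have "\<dots> = grounded_laplacian n (\<lambda>i j. of_bool (adj i j)) $$ (i, k)"
    proof (cases "i = 0")
      case True
      have "(\<Sum>j<n. a i j $ k) = (\<Sum>j<n. if j = 0 then of_bool (k = 0) else 0)"
        using True ik by (intro sum.cong refl) (auto simp: a_def)
      then show ?thesis using True ik by (auto simp: grounded_laplacian_def)
    next
      case False
      have "(\<Sum>j<n. a i j $ k) = (\<Sum>j<n. (if k = i then of_bool (adj i j) else 0)
              - (if j = k then of_bool (k \<noteq> 0 \<and> adj i k) else 0))"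
        using False ik by (intro sum.cong refl) (auto simp: a_def)
      also have "\<dots> = (if k = i then \<Sum>j<n. of_bool (adj i j) else 0) - of_bool (k \<noteq> 0 \<and> adj i k)"
        unfolding sum_subtractf using ik by simp
      finally show ?thesis using False ik by (auto simp: grounded_laplacian_def laplacian_def)
    qed
    finally show "grounded_laplacian n (\<lambda>i j. of_bool (adj i j)) $$ (i, k)
        = mat\<^sub>r n n (\<lambda>i. finsum_vec TYPE(real) n (a i) ?S) $$ (i, k)" by simp
  qed (auto simp: grounded_laplacian_def)
  then have "det (grounded_laplacian n (\<lambda>i j. of_bool (adj i j)))
      = (\<Sum>f\<in>?F. det (mat\<^sub>r n n (\<lambda>i. a i (f i))))"
    using det_linear_rows_sum[of ?S a n] a by auto
  also have "\<dots> = (\<Sum>f\<in>?F. if f \<in> rooted_nat_maps n adj then 1 else 0)"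
  proof (rule sum.cong[OF refl])
    fix f assume f: "f \<in> ?F"
    then have fn: "\<And>i. i < n \<Longrightarrow> f i < n" by auto
    have c: "mat\<^sub>r n n (\<lambda>i. a i (f i)) \<in> carrier_mat n n" by simp
    show "det (mat\<^sub>r n n (\<lambda>i. a i (f i))) = (if f \<in> rooted_nat_maps n adj then 1 else 0)"
    proof (cases "f 0 = 0 \<and> (\<forall>i\<in>{0<..<n}. adj i (f i))")
      case True
      then have "mat\<^sub>r n n (\<lambda>i. a i (f i)) = Matrix.mat n n (\<lambda>(i, k). if i = 0 then (if k = 0 then 1 else 0)
            else (if k = i then 1 else 0) - (if k = f i \<and> k \<noteq> 0 then 1 else 0))"
        by (intro eq_matI) (auto simp: a_def)
      then show ?thesis using det_rooted_map[OF n _ fn] True f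
        by (simp add: rooted_nat_maps_def)
    next
      case False
      then obtain i where i: "i < n" "i = 0 \<and> f 0 \<noteq> 0 \<or> i \<noteq> 0 \<and> \<not> adj i (f i)" using n by auto
      have "mat\<^sub>r n n (\<lambda>i. a i (f i)) = mat\<^sub>r n n (\<lambda>j. if j = i then 0\<^sub>v n else a j (f j))"
        using i by (intro eq_matI) (auto simp: a_def)
      then have "det (mat\<^sub>r n n (\<lambda>i. a i (f i))) = 0"
        using det_row_0[OF i(1), of "\<lambda>j. a j (f j)"] a by simp
      then show ?thesis using False by (auto simp: rooted_nat_maps_def)
    qed
  qed
  also have "\<dots> = real (card (?F \<inter> rooted_nat_maps n adj))"
    using finite_bounded_functions[of ?S ?S] by (simp add: sum.If_cases Int_def conj_commute)
  also have "?F \<inter> rooted_nat_maps n adj = rooted_nat_maps n adj"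
    by (auto simp: rooted_nat_maps_def)
  finally show ?thesis .
qed

text \<open>Both sides are computed from one matrix: adding all rows and then all columns of \<open>L + J\<close>
  to the first ones leads to the same result as \<open>Z L\<^sub>0 Z\<^sup>T\<close>, where \<open>L\<^sub>0\<close> is the grounded Laplacian
  and \<open>Z\<close> is lower triangular with determinant \<open>n\<close>.\<close>

lemma det_laplacian_plus_ones:
  assumes n: "n > 0" and sym: "\<And>i j. i < n \<Longrightarrow> j < n \<Longrightarrow> a i j = a j i"
  shows "det (Matrix.mat n n (\<lambda>(i, j). laplacian n a i j + 1))
       = (real n)\<^sup>2 * det (grounded_laplacian n a)"
proof -
  define X where "X = Matrix.mat n n (\<lambda>(i, j). laplacian n a i j + 1)"
  define T where "T = Matrix.mat n n (\<lambda>(i, j). if i = 0 \<or> i = j then 1 else (0::real))"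
  define Z where "Z = Matrix.mat n n (\<lambda>(i, j). if i = 0 then (if j = 0 then real n else 0)
      else if j = 0 \<or> i = j then 1 else 0)"
  let ?g = "grounded_laplacian n a"
  have c: "X \<in> carrier_mat n n" "T \<in> carrier_mat n n" "Z \<in> carrier_mat n n" "?g \<in> carrier_mat n n"
    by (auto simp: X_def T_def Z_def grounded_laplacian_def)
  have rows: "(\<Sum>k<n. laplacian n a i k) = 0" if "i < n" for i
    using that by (simp add: laplacian_def sum_subtractf)
  have lsym: "laplacian n a i j = laplacian n a j i" if "i < n" "j < n" for i j
    using sym[OF that] by (simp add: laplacian_def)
  have cols: "(\<Sum>k<n. laplacian n a k i) = 0" if "i < n" for i
    using rows[OF that] lsym that by (metis (no_types, lifting) lessThan_iff sum.cong)
  have TX: "T * X = Matrix.mat n n (\<lambda>(i, j). if i = 0 then real n else laplacian n a i j + 1)"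
  proof (rule eq_matI, goal_cases)
    case (1 i j)
    then have ij: "i < n" "j < n" by auto
    have "(T * X) $$ (i, j) = (\<Sum>k<n. T $$ (i, k) * X $$ (k, j))"
      using ij c by (simp add: scalar_prod_def lessThan_atLeast0)
    also have "\<dots> = (\<Sum>k<n. (if i = 0 then laplacian n a k j + 1 else
              if i = k then laplacian n a i j + 1 else 0))"
      using ij by (intro sum.cong refl) (auto simp: T_def X_def)
    finally show ?case using ij cols[OF ij(2)] by (simp add: sum.distrib)
  qed (use c in auto)
  have TXT: "T * X * transpose_mat T = Matrix.mat n n (\<lambda>(i, j). if i = 0 then (if j = 0 then real n * real n else real n)
      else if j = 0 then real n else laplacian n a i j + 1)"
    unfolding TX
  proof (rule eq_matI, goal_cases)
    case (1 i j)
    then have ij: "i < n" "j < n" by auto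
    have "(Matrix.mat n n (\<lambda>(i, j). if i = 0 then real n else laplacian n a i j + 1) * transpose_mat T) $$ (i, j)
       = (\<Sum>k<n. (if i = 0 then real n else laplacian n a i k + 1) * T $$ (j, k))"
      using ij c by (simp add: scalar_prod_def lessThan_atLeast0)
    also have "\<dots> = (\<Sum>k<n. (if j = 0 then (if i = 0 then real n else laplacian n a i k + 1) else
              if j = k then (if i = 0 then real n else laplacian n a i j + 1) else 0))"
      using ij by (intro sum.cong refl) (auto simp: T_def)
    finally show ?case using ij rows[OF ij(1)] by (simp add: sum.distrib)
  qed (use c in auto)
  have Zg: "Z * ?g = Matrix.mat n n (\<lambda>(i, j). if i = 0 then (if j = 0 then real n else 0)
       else if j = 0 then 1 else laplacian n a i j)"
  proof (rule eq_matI, goal_cases)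
    case (1 i j)
    then have ij: "i < n" "j < n" by auto
    have "(Z * ?g) $$ (i, j) = (\<Sum>k<n. Z $$ (i, k) * ?g $$ (k, j))"
      using ij c by (simp add: scalar_prod_def lessThan_atLeast0)
    also have "\<dots> = (\<Sum>k<n. (if k = 0 then (if i = 0 then real n else 1) * of_bool (j = 0) else 0)
              + (if k = i then if i = 0 then 0 else if j = 0 then 0 else laplacian n a i j else 0))"
      using ij by (intro sum.cong refl) (auto simp: Z_def grounded_laplacian_def)
    finally show ?case using ij n by (simp add: sum.distrib)
  qed (use c in auto)
  have ZgZ: "Z * ?g * transpose_mat Z = Matrix.mat n n (\<lambda>(i, j). if i = 0 then (if j = 0 then real n * real n else real n)
      else if j = 0 then real n else laplacian n a i j + 1)"
    unfolding Zg
  proof (rule eq_matI, goal_cases)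
    case (1 i j)
    then have ij: "i < n" "j < n" by auto
    have "(Matrix.mat n n (\<lambda>(i, j). if i = 0 then (if j = 0 then real n else 0)
       else if j = 0 then 1 else laplacian n a i j) * transpose_mat Z) $$ (i, j)
       = (\<Sum>k<n. (if i = 0 then (if k = 0 then real n else 0)
            else if k = 0 then 1 else laplacian n a i k) * Z $$ (j, k))"
      using ij c by (simp add: scalar_prod_def lessThan_atLeast0)
    also have "\<dots> = (\<Sum>k<n. (if k = 0 then (if i = 0 then real n else 1) * (if j = 0 then real n else 1) else 0)
              + (if k = j then if j = 0 then 0 else if i = 0 then 0 else laplacian n a i j else 0))"
      using ij by (intro sum.cong refl) (auto simp: Z_def)
    finally show ?case using ij n by (simp add: sum.distrib)
  qed (use c in auto)
  have dT: "det T = 1"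
  proof -
    have "det T = prod_list (diag_mat T)"
      by (rule det_upper_triangular[OF _ c(2)]) (auto simp: T_def)
    then show ?thesis by (simp add: diag_mat_def T_def prod.list_conv_set_nth)
  qed
  have dZ: "det Z = real n"
  proof -
    have "det Z = prod_list (diag_mat Z)"
      by (rule det_lower_triangular[OF _ c(3)]) (auto simp: Z_def)
    also have "\<dots> = (\<Prod>i = 0..<n. Z $$ (i, i))"
      using c by (simp add: diag_mat_def prod.list_conv_set_nth)
    also have "\<dots> = (\<Prod>i = 0..<n. if i = 0 then real n else 1)"
      by (intro prod.cong refl) (auto simp: Z_def)
    also have "\<dots> = real n" using n by simp
    finally show ?thesis .
  qed
  have "det X = det (T * X * transpose_mat T)"
    using c dT by (simp add: det_mult[of _ n] det_transpose[of _ n])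
  also have "\<dots> = det (Z * ?g * transpose_mat Z)" unfolding TXT ZgZ ..
  also have "\<dots> = (real n)\<^sup>2 * det ?g"
    using c dZ by (simp add: det_mult[of _ n] det_transpose[of _ n] power2_eq_square)
  finally show ?thesis unfolding X_def .
qed

lemma card_rooted_nat_maps:
  assumes e: "bij_betw e {..<n} (vertices G)" and n: "n > 0"
  shows "card (rooted_nat_maps n (\<lambda>i j. {e i, e j} \<in> edges G)) = card (rooted_parent_maps G (e 0))"
proof -
  let ?V = "vertices G"
  define d where "d = inv_into {..<n} e"
  have de: "d (e i) = i" if "i < n" for i
    using e that by (simp add: d_def bij_betw_def)
  have ed: "e (d v) = v" "d v < n" if "v \<in> ?V" for v
    using bij_betw_inv_into_right[OF e that] bij_betwE[OF bij_betw_inv_into[OF e]] that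
    by (auto simp: d_def)
  have eV: "e i \<in> ?V" if "i < n" for i using e that by (auto dest: bij_betwE)
  define \<Phi> where "\<Phi> f v = (if v \<in> ?V then e (f (d v)) else v)" for f v
  define \<Psi> where "\<Psi> p i = (if i < n then d (p (e i)) else i)" for p i
  have \<Phi>k: "(\<Phi> f ^^ k) (e i) = e ((f ^^ k) i) \<and> (f ^^ k) i < n" if "\<And>i. i < n \<Longrightarrow> f i < n" "i < n" for f k i
  proof (induction k)
    case (Suc k)
    then show ?case using that eV de by (auto simp: \<Phi>_def)
  qed (use that in auto)
  have \<Psi>k: "(\<Psi> p ^^ k) (d v) = d ((p ^^ k) v) \<and> (p ^^ k) v \<in> ?V" if "\<And>v. v \<in> ?V \<Longrightarrow> p v \<in> ?V" "v \<in> ?V" for p k v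
  proof (induction k)
    case (Suc k)
    then show ?case using that ed by (auto simp: \<Psi>_def)
  qed (use that in auto)
  have "bij_betw \<Phi> (rooted_nat_maps n (\<lambda>i j. {e i, e j} \<in> edges G)) (rooted_parent_maps G (e 0))"
  proof (rule bij_betw_byWitness[where f' = \<Psi>])
    show "\<forall>f\<in>rooted_nat_maps n (\<lambda>i j. {e i, e j} \<in> edges G). \<Psi> (\<Phi> f) = f"
      using eV de by (auto simp: rooted_nat_maps_def \<Psi>_def \<Phi>_def fun_eq_iff)
    show "\<forall>p\<in>rooted_parent_maps G (e 0). \<Phi> (\<Psi> p) = p"
    proof
      fix p assume p: "p \<in> rooted_parent_maps G (e 0)"
      have "p v \<in> ?V" if "v \<in> ?V" for v
        using p that eV[OF n] by (cases "v = e 0") (auto simp: rooted_parent_maps_def)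
      then show "\<Phi> (\<Psi> p) = p" using p ed by (auto simp: rooted_parent_maps_def \<Psi>_def \<Phi>_def fun_eq_iff)
    qed
    show "\<Phi> ` rooted_nat_maps n (\<lambda>i j. {e i, e j} \<in> edges G) \<subseteq> rooted_parent_maps G (e 0)"
    proof
      fix p assume "p \<in> \<Phi> ` rooted_nat_maps n (\<lambda>i j. {e i, e j} \<in> edges G)"
      then obtain f where f: "f \<in> rooted_nat_maps n (\<lambda>i j. {e i, e j} \<in> edges G)" "p = \<Phi> f" by blast
      have fn: "\<And>i. i < n \<Longrightarrow> f i < n" using f(1) by (auto simp: rooted_nat_maps_def)
      have pv: "p v \<in> ?V" if "v \<in> ?V" for v using that f(2) eV fn ed by (auto simp: \<Phi>_def)
      have e0: "p (e 0) = e 0" using f eV[OF n] de[OF n] by (auto simp: \<Phi>_def rooted_nat_maps_def)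
      have ad: "{v, p v} \<in> edges G" if v: "v \<in> ?V" "v \<noteq> e 0" for v
      proof -
        have "d v \<noteq> 0" using v ed(1) by metis
        then have "{e (d v), e (f (d v))} \<in> edges G" using f(1) ed(2)[OF v(1)] by (auto simp: rooted_nat_maps_def)
        then show ?thesis using v ed(1) f(2) by (simp add: \<Phi>_def)
      qed
      have reach: "\<exists>k. (p ^^ k) v = e 0" if v: "v \<in> ?V" for v
      proof -
        obtain k where "(f ^^ k) (d v) = 0" using f(1) ed(2)[OF v] by (auto simp: rooted_nat_maps_def)
        then have "(p ^^ k) (e (d v)) = e 0" using \<Phi>k[OF fn ed(2)[OF v], where k = k] f(2) by auto
        then show ?thesis using ed(1)[OF v] by auto
      qed
      show "p \<in> rooted_parent_maps G (e 0)"
        unfolding rooted_parent_maps_def using pv e0 ad reach f(2) by (auto simp: \<Phi>_def)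
    qed
    show "\<Psi> ` rooted_parent_maps G (e 0) \<subseteq> rooted_nat_maps n (\<lambda>i j. {e i, e j} \<in> edges G)"
    proof
      fix f assume "f \<in> \<Psi> ` rooted_parent_maps G (e 0)"
      then obtain p where p: "p \<in> rooted_parent_maps G (e 0)" "f = \<Psi> p" by blast
      have e0: "p (e 0) = e 0" using p(1) by (simp add: rooted_parent_maps_def)
      have pv: "p v \<in> ?V" if "v \<in> ?V" for v
        using p that eV[OF n] e0 by (cases "v = e 0") (auto simp: rooted_parent_maps_def)
      have fn: "f i < n" if "i < n" for i using that p(2) eV pv ed by (auto simp: \<Psi>_def)
      have f0: "f 0 = 0" using p(2) n e0 de by (simp add: \<Psi>_def)
      have ad: "{e i, e (f i)} \<in> edges G" if i: "i < n" "i \<noteq> 0" for i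
      proof -
        have "e i \<noteq> e 0" using i de n by metis
        then have "{e i, p (e i)} \<in> edges G" using p(1) eV[OF i(1)] by (auto simp: rooted_parent_maps_def)
        then show ?thesis using i p(2) ed(1)[OF pv[OF eV[OF i(1)]]] by (simp add: \<Psi>_def)
      qed
      have reach: "\<exists>k. (f ^^ k) i = 0" if i: "i < n" for i
      proof -
        obtain k where "(p ^^ k) (e i) = e 0" using p(1) eV[OF i] by (auto simp: rooted_parent_maps_def)
        then have "(f ^^ k) (d (e i)) = d (e 0)" using \<Psi>k[OF pv eV[OF i], where k = k] p(2) by auto
        then show ?thesis using de i n by auto
      qed
      show "f \<in> rooted_nat_maps n (\<lambda>i j. {e i, e j} \<in> edges G)"
        unfolding rooted_nat_maps_def using fn f0 ad reach p(2) by (auto simp: \<Psi>_def)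
    qed
  qed
  then show ?thesis by (rule bij_betw_same_card)
qed

theorem matrix_tree:
  assumes G: "simple_graph G" and e: "bij_betw e {..<n} (vertices G)" and n: "n > 0"
  shows "det (Matrix.mat n n (\<lambda>(i, j). laplacian n (\<lambda>i j. of_bool ({e i, e j} \<in> edges G)) i j + 1))
       = (real n)\<^sup>2 * real (num_spanning_trees G)"
proof -
  have e0: "e 0 \<in> vertices G" using e n by (auto dest: bij_betwE)
  show ?thesis
    using det_laplacian_plus_ones[OF n, of "\<lambda>i j. of_bool ({e i, e j} \<in> edges G)"]
      det_grounded_laplacian[OF n, of "\<lambda>i j. {e i, e j} \<in> edges G"]
      card_rooted_nat_maps[OF e n] card_rooted_parent_maps[OF G e0]
    by (simp add: insert_commute)
qed

section \<open>Interpolating the logarithm\<close>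

text \<open>The first two terms of the series of \<open>2 artanh u\<close>; all terms of that series are
  nonnegative.\<close>

lemma ln_quotient_lower_bound:
  fixes u :: real
  assumes "0 \<le> u" "u < 1"
  shows "2 * u + 2 * u ^ 3 / 3 \<le> ln ((1 + u) / (1 - u))"
proof -
  define h where "h x = ln (1 + x) - ln (1 - x) - 2 * x - 2 * x ^ 3 / 3" for x :: real
  have "h 0 \<le> h u"
  proof (rule DERIV_nonneg_imp_nondecreasing[OF assms(1)])
    fix x assume x: "0 \<le> x" "x \<le> u"
    then have x1: "x < 1" using assms by simp
    have "(h has_real_derivative 1 / (1 + x) + 1 / (1 - x) - 2 - 2 * x\<^sup>2) (at x)"
      unfolding h_def using x x1
      by (auto intro!: derivative_eq_intros)
    moreover have "1 / (1 + x) + 1 / (1 - x) - 2 - 2 * x\<^sup>2 = 2 * x ^ 4 / ((1 + x) * (1 - x))"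
    proof -
      have "(1 - x) * (1 + x) \<noteq> 0" using x x1 by simp
      then have "1 - x * x \<noteq> 0" by (simp add: algebra_simps)
      then show ?thesis using x x1 by (simp add: field_simps power2_eq_square power4_eq_xxxx)
    qed
    moreover have "2 * x ^ 4 / ((1 + x) * (1 - x)) \<ge> 0" using x x1 by simp
    ultimately show "\<exists>y. (h has_real_derivative y) (at x) \<and> 0 \<le> y" by metis
  qed
  then show ?thesis using assms by (simp add: h_def ln_div)
qed

text \<open>The cubic \<open>ln N / 2 - A x + (q - x\<^sup>2) (c + b x)\<close> is the Hermite interpolation of
  \<open>ln (q + 1 - x)\<close>, with matching values and slopes, at the two points \<open>\<plusminus> sqrt q\<close>. The nodes are
  the eigenvalues of the incidence matrix of a polarity on the orthogonal complement of the
  constant vectors. The remainder \<open>R\<close> has derivative \<open>R'\<close>, where \<open>\<rho>\<close> is the third zero of this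
  derivative.\<close>

locale plane_parameter =
  fixes q :: nat
  assumes q2: "q \<ge> 2"
begin

definition N :: real where "N = (real q)\<^sup>2 + real q + 1"
definition A :: real where
  "A = 1 / (2 * sqrt (real q)) * ln ((real q + 1 + sqrt (real q)) / (real q + 1 - sqrt (real q)))"
definition b :: real where "b = ((real q + 1) / N - A) / (2 * real q)"
definition c :: real where "c = 1 / (2 * N)"
definition R :: "real \<Rightarrow> real" where
  "R x = ln N / 2 - A * x + (real q - x\<^sup>2) * (c + b * x) - ln (real q + 1 - x)"
definition \<rho> :: real where "\<rho> = real q + 1 - 1 / (3 * b * N)"
definition R' :: "real \<Rightarrow> real" where
  "R' x = 3 * b * (x\<^sup>2 - real q) * (x - \<rho>) / (real q + 1 - x)"

lemma q_ge: "real q \<ge> 2" using q2 by simp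
lemma N_pos: "N > 0" unfolding N_def using q_ge by (simp add: add_nonneg_pos)
lemma sqrt_bounds: "0 < sqrt (real q)" "sqrt (real q) < real q"
proof -
  show "0 < sqrt (real q)" using q_ge by simp
  have "sqrt (real q) * 1 < sqrt (real q) * sqrt (real q)" by (rule mult_strict_left_mono) (use q_ge in auto)
  then show "sqrt (real q) < real q" by simp
qed

lemma roots_pos: "real q + 1 - sqrt (real q) > 0" "real q + 1 + sqrt (real q) > 0"
  using sqrt_bounds by linarith+

lemma left_of_roots: "x \<le> sqrt (real q) \<Longrightarrow> x < real q + 1" "x \<le> - sqrt (real q) \<Longrightarrow> x < real q + 1"
  using sqrt_bounds by linarith+

lemma N_factor: "(real q + 1 - sqrt (real q)) * (real q + 1 + sqrt (real q)) = N"
  by (simp add: N_def algebra_simps power2_eq_square)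

lemma ln_N: "ln N = ln (real q + 1 - sqrt (real q)) + ln (real q + 1 + sqrt (real q))"
  unfolding N_factor[symmetric] using roots_pos by (intro ln_mult_pos) auto

lemma A_sqrt: "A * sqrt (real q) = (ln (real q + 1 + sqrt (real q)) - ln (real q + 1 - sqrt (real q))) / 2"
  using sqrt_bounds roots_pos by (simp add: A_def ln_div)

lemma R_nodes: "R (sqrt (real q)) = 0" "R (- sqrt (real q)) = 0"
proof -
  have "R (sqrt (real q)) = ln N / 2 - A * sqrt (real q) - ln (real q + 1 - sqrt (real q))"
    "R (- sqrt (real q)) = ln N / 2 + A * sqrt (real q) - ln (real q + 1 + sqrt (real q))"
    by (simp_all add: R_def)
  note R = this
  show "R (sqrt (real q)) = 0" unfolding R(1) A_sqrt ln_N by (simp add: field_simps)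
  show "R (- sqrt (real q)) = 0" unfolding R(2) A_sqrt ln_N by (simp add: field_simps)
qed

lemma A_lower: "A \<ge> 1 / (real q + 1) + real q / (3 * (real q + 1) ^ 3)"
proof -
  define u where "u = sqrt (real q) / (real q + 1)"
  have u: "0 \<le> u" "u < 1" using sqrt_bounds by (auto simp: u_def)
  have q1: "real q + 1 > 0" by simp
  have "(1 + u) / (1 - u) = (real q + 1 + sqrt (real q)) / (real q + 1 - sqrt (real q))"
  proof -
    have "1 + u = (real q + 1 + sqrt (real q)) / (real q + 1)" "1 - u = (real q + 1 - sqrt (real q)) / (real q + 1)"
      using q1 by (auto simp: u_def add_divide_distrib diff_divide_distrib)
    then show ?thesis using q1 by simp
  qed
  then have "A = 1 / (2 * sqrt (real q)) * ln ((1 + u) / (1 - u))" by (simp add: A_def)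
  also have "\<dots> \<ge> 1 / (2 * sqrt (real q)) * (2 * u + 2 * u ^ 3 / 3)"
    by (rule mult_left_mono[OF ln_quotient_lower_bound[OF u]]) simp
  also have "1 / (2 * sqrt (real q)) * (2 * u + 2 * u ^ 3 / 3) = 1 / (real q + 1) + real q / (3 * (real q + 1) ^ 3)"
  proof -
    have s: "u = sqrt (real q) * (1 / (real q + 1))" by (simp add: u_def)
    have "1 / (2 * sqrt (real q)) * (2 * u + 2 * u ^ 3 / 3) = (u / sqrt (real q)) + (u / sqrt (real q)) * u\<^sup>2 / 3"
      using sqrt_bounds by (simp add: field_simps power2_eq_square power3_eq_cube)
    also have "u / sqrt (real q) = 1 / (real q + 1)" using sqrt_bounds by (simp add: u_def)
    also have "u\<^sup>2 = real q / (real q + 1)\<^sup>2" by (simp add: u_def power_divide)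
    finally show ?thesis by (simp add: power2_eq_square power3_eq_cube mult_ac)
  qed
  finally show ?thesis by simp
qed

definition b_bound :: real where
  "b_bound = (2 * real q + 1) * (real q + 2) / (6 * N * (real q + 1) ^ 3)"

text \<open>Since \<open>b\<close> decreases in \<open>A\<close>, this is the lower bound for \<open>A\<close> in another form. It controls
  the negative defects, which belong to vertices of degree greater than \<open>q + 1\<close>.\<close>

lemma b_upper: "b \<le> b_bound"
proof -
  define x where "x = real q"
  have x: "x > 0" using q_ge by (simp add: x_def)
  have Nx: "N = x\<^sup>2 + x + 1" by (simp add: N_def x_def)
  have Np: "x\<^sup>2 + x + 1 > 0" using N_pos Nx by simp
  have "b \<le> ((x + 1) / N - (1 / (x + 1) + x / (3 * (x + 1) ^ 3))) / (2 * x)"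
    unfolding b_def using A_lower x unfolding x_def by (intro divide_right_mono) auto
  also have "\<dots> = b_bound"
  proof -
    have "(x + 1) / N - (1 / (x + 1) + x / (3 * (x + 1) ^ 3))
        = x * ((2 * x + 1) * (x + 2)) / (3 * N * (x + 1) ^ 3)"
      unfolding Nx using x Np
      by (simp add: divide_simps) (simp add: algebra_simps power2_eq_square power3_eq_cube)
    then show ?thesis using x by (simp add: b_bound_def x_def)
  qed
  finally show ?thesis .
qed

text \<open>Multiplied by \<open>q + 1 - x\<close>, the derivative is a cubic polynomial. It vanishes at
  \<open>\<plusminus> sqrt q\<close> by the choice of \<open>b\<close> and \<open>c\<close>, so that only a linear factor remains.\<close>

lemma R_has_derivative_raw:
  assumes x: "x < real q + 1"
  shows "(R has_real_derivative (x\<^sup>2 - real q) * (3 * b * x + 1 / N - 3 * b * (real q + 1)) / (real q + 1 - x)) (at x)"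
proof -
  have d: "(R has_real_derivative - A - 2 * x * (c + b * x) + (real q - x\<^sup>2) * b + 1 / (real q + 1 - x)) (at x)"
    unfolding R_def using x by (auto intro!: derivative_eq_intros)
  have A: "A = (real q + 1) / N - 2 * real q * b" using q_ge by (simp add: b_def)
  have p: "real q + 1 - x \<noteq> 0" using x by simp
  have "(- A - 2 * x * (c + b * x) + (real q - x\<^sup>2) * b) * (real q + 1 - x) + 1
      = (x\<^sup>2 - real q) * (3 * b * x + 1 / N - 3 * b * (real q + 1))
        + (1 - ((real q + 1)\<^sup>2 - real q) * (1 / N))"
    unfolding A c_def by (simp add: algebra_simps power2_eq_square power3_eq_cube add_divide_distrib diff_divide_distrib)
  also have "((real q + 1)\<^sup>2 - real q) * (1 / N) = 1"
    using N_pos by (simp add: N_def algebra_simps power2_eq_square)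
  finally have "- A - 2 * x * (c + b * x) + (real q - x\<^sup>2) * b + 1 / (real q + 1 - x)
      = (x\<^sup>2 - real q) * (3 * b * x + 1 / N - 3 * b * (real q + 1)) / (real q + 1 - x)"
    using p by (simp add: field_simps)
  with d show ?thesis by simp
qed

text \<open>As \<open>R\<close> vanishes at both nodes, Rolle's theorem locates the third zero of its derivative
  between them. Since the linear factor is \<open>1 / N\<close> at \<open>q + 1\<close>, to the right of its zero, its
  slope \<open>3 b\<close> is positive.\<close>

lemma b_pos_and_rho: "b > 0" "- sqrt (real q) < \<rho>" "\<rho> < sqrt (real q)"
proof -
  have lt: "x < real q + 1" if "x \<le> sqrt (real q)" for x using sqrt_bounds that by simp
  have "\<exists>z>- sqrt (real q). z < sqrt (real q) \<and> DERIV R z :> 0"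
  proof (rule Rolle)
    show "continuous_on {- sqrt (real q)..sqrt (real q)} R"
      using R_has_derivative_raw lt
      by (intro continuous_at_imp_continuous_on ballI DERIV_isCont) auto
    show "R differentiable (at x)" if "- sqrt (real q) < x" "x < sqrt (real q)" for x
      using R_has_derivative_raw[OF lt[of x]] that
      by (auto simp: real_differentiable_def)
  qed (use sqrt_bounds R_nodes in auto)
  then obtain z where z: "- sqrt (real q) < z" "z < sqrt (real q)" "DERIV R z :> 0" by blast
  have zq: "real q + 1 - z > 0" using lt[of z] z by simp
  have "z\<^sup>2 < real q" using z by (metis abs_less_iff minus_less_iff real_less_lsqrt real_sqrt_abs real_sqrt_less_iff)
  moreover have "(z\<^sup>2 - real q) * (3 * b * z + 1 / N - 3 * b * (real q + 1)) / (real q + 1 - z) = 0"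
    using DERIV_unique[OF R_has_derivative_raw[OF lt[of z]] z(3)] z by simp
  ultimately have "3 * b * z + 1 / N - 3 * b * (real q + 1) = 0" using zq by simp
  then have e: "1 / N = 3 * b * (real q + 1 - z)" by (simp add: algebra_simps)
  have "3 * b * (real q + 1 - z) > 0" using e N_pos by (metis zero_less_divide_1_iff)
  then show "b > 0" using zq by (simp add: zero_less_mult_iff)
  then have "1 / (3 * b * N) = real q + 1 - z" using e N_pos by (simp add: field_simps)
  then have "\<rho> = z" by (simp add: \<rho>_def)
  then show "- sqrt (real q) < \<rho>" "\<rho> < sqrt (real q)" using z by auto
qed

lemmas b_pos = b_pos_and_rho(1)

lemma R_has_derivative:
  assumes "x < real q + 1"
  shows "(R has_real_derivative R' x) (at x)"
proof -
  have e: "3 * b * x + 1 / N - 3 * b * (real q + 1) = 3 * b * (x - \<rho>)"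
    using b_pos N_pos by (simp add: \<rho>_def field_simps)
  have "R' x = (x\<^sup>2 - real q) * (3 * b * (x - \<rho>)) / (real q + 1 - x)"
    unfolding R'_def by (simp only: mult_ac)
  then show ?thesis using R_has_derivative_raw[OF assms] unfolding e by simp
qed

lemma sq_less_iff: "x\<^sup>2 < real q \<longleftrightarrow> - sqrt (real q) < x \<and> x < sqrt (real q)"
  by (metis abs_less_iff minus_less_iff real_sqrt_abs real_sqrt_less_iff)

lemma sq_greater_iff: "x\<^sup>2 > real q \<longleftrightarrow> x < - sqrt (real q) \<or> x > sqrt (real q)"
  using real_sqrt_less_iff[of "real q" "x\<^sup>2"] by (auto simp: abs_if split: if_splits)

text \<open>By the signs of \<open>R'\<close>, the remainder decreases up to \<open>- sqrt q\<close>, increases up to \<open>\<rho>\<close>,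
  decreases up to \<open>sqrt q\<close> and increases afterwards.\<close>

lemma R_pos:
  assumes x: "x < real q + 1" and ne: "x\<^sup>2 \<noteq> real q"
  shows "R x > 0"
proof -
  note rho = b_pos_and_rho
  consider "x < - sqrt (real q)" | "- sqrt (real q) < x" "x \<le> \<rho>" | "\<rho> < x" "x < sqrt (real q)" | "sqrt (real q) < x"
    using ne by (metis linorder_less_linear not_le_imp_less power2_minus real_sqrt_pow2 of_nat_0_le_iff)
  then show ?thesis
  proof cases
    case 1
    have "R x > R (- sqrt (real q))"
    proof (rule DERIV_neg_imp_decreasing_open[OF 1])
      fix y assume y: "x < y" "y < - sqrt (real q)"
      have "y < real q + 1" using y sqrt_bounds by linarith
      moreover have "R' y < 0"
      proof -
        have "y\<^sup>2 > real q" using y sq_greater_iff by blast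
        then have "3 * b * (y\<^sup>2 - real q) > 0" using rho by simp
        moreover have "y - \<rho> < 0" using y rho by linarith
        ultimately show ?thesis unfolding R'_def using \<open>y < real q + 1\<close>
          by (intro divide_neg_pos mult_pos_neg) auto
      qed
      ultimately show "\<exists>z. DERIV R y :> z \<and> z < 0" using R_has_derivative by blast
    next
      show "continuous_on {x..- sqrt (real q)} R"
        using left_of_roots
        by (intro continuous_at_imp_continuous_on ballI DERIV_isCont[OF R_has_derivative]) auto
    qed
    then show ?thesis using R_nodes by simp
  next
    case 2
    have "R x > R (- sqrt (real q))"
    proof (rule DERIV_pos_imp_increasing_open[OF 2(1)])
      fix y assume y: "- sqrt (real q) < y" "y < x"
      have yq: "y < real q + 1" using y x by linarith
      moreover have "R' y > 0"
      proof -
        have "y\<^sup>2 < real q" using y 2 rho sq_less_iff by auto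
        then have "3 * b * (y\<^sup>2 - real q) < 0" using rho by (intro mult_pos_neg) auto
        moreover have "y - \<rho> < 0" using y 2 by linarith
        ultimately show ?thesis unfolding R'_def using yq
          by (intro divide_pos_pos[OF mult_neg_neg]) auto
      qed
      ultimately show "\<exists>z. DERIV R y :> z \<and> z > 0" using R_has_derivative by blast
    next
      show "continuous_on {- sqrt (real q)..x} R"
        using x by (intro continuous_at_imp_continuous_on ballI DERIV_isCont[OF R_has_derivative]) auto
    qed
    then show ?thesis using R_nodes by simp
  next
    case 3
    have "R x > R (sqrt (real q))"
    proof (rule DERIV_neg_imp_decreasing_open[OF 3(2)])
      fix y assume y: "x < y" "y < sqrt (real q)"
      have yq: "y < real q + 1" using y sqrt_bounds by linarith
      moreover have "R' y < 0"
      proof -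
        have "y\<^sup>2 < real q" using y 3 rho sq_less_iff by auto
        then have "3 * b * (y\<^sup>2 - real q) < 0" using rho by (intro mult_pos_neg) auto
        moreover have "y - \<rho> > 0" using y 3 by linarith
        ultimately show ?thesis unfolding R'_def using yq
          by (intro divide_neg_pos[OF mult_neg_pos]) auto
      qed
      ultimately show "\<exists>z. DERIV R y :> z \<and> z < 0" using R_has_derivative by blast
    next
      show "continuous_on {x..sqrt (real q)} R"
        using left_of_roots
        by (intro continuous_at_imp_continuous_on ballI DERIV_isCont[OF R_has_derivative]) auto
    qed
    then show ?thesis using R_nodes by simp
  next
    case 4
    have "R x > R (sqrt (real q))"
    proof (rule DERIV_pos_imp_increasing_open[OF 4])
      fix y assume y: "sqrt (real q) < y" "y < x"
      have yq: "y < real q + 1" using y x by linarith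
      moreover have "R' y > 0"
      proof -
        have "y\<^sup>2 > real q" using y sq_greater_iff by auto
        moreover have "y - \<rho> > 0" using y rho by linarith
        ultimately show ?thesis unfolding R'_def using rho yq
          by (intro divide_pos_pos mult_pos_pos) auto
      qed
      ultimately show "\<exists>z. DERIV R y :> z \<and> z > 0" using R_has_derivative by blast
    next
      show "continuous_on {sqrt (real q)..x} R"
        using x by (intro continuous_at_imp_continuous_on ballI DERIV_isCont[OF R_has_derivative]) auto
    qed
    then show ?thesis using R_nodes by simp
  qed
qed

lemma R_zero: "x\<^sup>2 = real q \<Longrightarrow> R x = 0"
  using R_nodes by (metis abs_real_def real_sqrt_abs minus_minus)

lemma R_nonneg: "x < real q + 1 \<Longrightarrow> R x \<ge> 0"
  using R_pos R_zero by (metis order.strict_implies_order order_refl)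

text \<open>The part of the remainder left of the nodes. It is convex, in contrast to \<open>R\<close> itself, and
  it lives on the half-line that contains the deficiencies of the vertices of large degree.\<close>

definition R_left :: "real \<Rightarrow> real" where
  "R_left x = (if x \<le> - sqrt (real q) then R x else 0)"

lemma R_left_le:
  assumes "x < real q + 1"
  shows "R_left x \<le> R x"
  using R_nonneg[OF assms] by (simp add: R_left_def)

text \<open>Convexity: on this half-line \<open>- R'\<close> is \<open>3 b\<close> times the product of \<open>x\<^sup>2 - q\<close> and
  \<open>(\<rho> - x) / (q + 1 - x)\<close>, both of which are nonnegative and decreasing.\<close>

lemma R'_mono_left:
  assumes "u \<le> v" "v \<le> - sqrt (real q)"
  shows "R' u \<le> R' v"
proof -
  have pos: "0 < real q + 1 - v" "0 < real q + 1 - u"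
    using assms left_of_roots(2)[of v] left_of_roots(2)[of u] by auto
  have eq: "R' x = - (3 * b * ((x\<^sup>2 - real q) * (1 - (real q + 1 - \<rho>) / (real q + 1 - x))))"
    if "0 < real q + 1 - x" for x
    using that by (simp add: R'_def field_simps)
  have sq: "v\<^sup>2 \<le> u\<^sup>2" using assms sqrt_bounds(1) by (intro abs_le_square_iff[THEN iffD1]) linarith
  have v2: "v\<^sup>2 \<ge> real q" using assms sq_less_iff[of v] by auto
  have "(real q + 1 - \<rho>) / (real q + 1 - u) \<le> (real q + 1 - \<rho>) / (real q + 1 - v)"
    using assms pos b_pos_and_rho sqrt_bounds by (intro divide_left_mono) auto
  moreover have "(real q + 1 - \<rho>) / (real q + 1 - v) \<le> 1"
    using assms pos b_pos_and_rho by simp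
  ultimately have "(v\<^sup>2 - real q) * (1 - (real q + 1 - \<rho>) / (real q + 1 - v))
      \<le> (u\<^sup>2 - real q) * (1 - (real q + 1 - \<rho>) / (real q + 1 - u))"
    using sq v2 by (intro mult_mono) auto
  then show ?thesis unfolding eq[OF pos(1)] eq[OF pos(2)] using b_pos by simp
qed

lemma R'_nonpos_left: "u \<le> - sqrt (real q) \<Longrightarrow> R' u \<le> 0"
  using R'_mono_left[of u "- sqrt (real q)"] by (simp add: R'_def)

lemma tangent_left:
  assumes d: "d \<le> - sqrt (real q)" and l: "l \<le> - sqrt (real q)"
  shows "R d + R' d * (l - d) \<le> R l"
proof -
  have der: "DERIV R x :> R' x" if "x \<le> - sqrt (real q)" for x
    using R_has_derivative left_of_roots(2) that by blast
  consider "l = d" | "l < d" | "d < l" by linarith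
  then show ?thesis
  proof cases
    case 2
    then obtain z where z: "l < z" "z < d" "R d - R l = (d - l) * R' z"
      using MVT2[of l d R R'] der d by auto
    have "(d - l) * R' z \<le> (d - l) * R' d"
      using R'_mono_left[of z d] z d 2 by (intro mult_left_mono) auto
    then show ?thesis using z by (simp add: algebra_simps)
  next
    case 3
    then obtain z where z: "d < z" "z < l" "R l - R d = (l - d) * R' z"
      using MVT2[of d l R R'] der l by auto
    have "(l - d) * R' d \<le> (l - d) * R' z"
      using R'_mono_left[of d z] z l 3 by (intro mult_left_mono) auto
    then show ?thesis using z by (simp add: algebra_simps)
  qed simp
qed

lemma tangent_R_left:
  assumes d: "d \<le> - sqrt (real q)"
  shows "R d + R' d * (l - d) \<le> R_left l"
proof (cases "l \<le> - sqrt (real q)")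
  case True
  then show ?thesis using tangent_left[OF d True] by (simp add: R_left_def)
next
  case False
  have "R' d * (l - d) \<le> R' d * (- sqrt (real q) - d)"
    using R'_nonpos_left[OF d] False by (intro mult_left_mono_neg) auto
  then have "R d + R' d * (l - d) \<le> R (- sqrt (real q))"
    using tangent_left[OF d, of "- sqrt (real q)"] by simp
  then show ?thesis using False R_nodes by (simp add: R_left_def)
qed

text \<open>Jensen's inequality, with the tangent of \<open>R\<close> at the mean value as supporting line. The
  tangent also lies below \<open>R_left\<close> at \<open>q + 1\<close>, where \<open>R\<close> itself has its pole.\<close>

lemma jensen_R_left:
  assumes "finite I" "\<And>i. i \<in> I \<Longrightarrow> w i \<ge> 0" "sum w I = 1" "(\<Sum>i\<in>I. w i * l i) = d"
    and "\<And>i. i \<in> I \<Longrightarrow> l i \<le> real q + 1"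
  shows "R_left d \<le> (\<Sum>i\<in>I. w i * R_left (l i))"
proof (cases "d \<le> - sqrt (real q)")
  case True
  have "R_left d = (\<Sum>i\<in>I. w i * (R d + R' d * (l i - d)))"
  proof -
    have "(\<Sum>i\<in>I. w i * (R d + R' d * (l i - d)))
        = (R d - R' d * d) * sum w I + R' d * (\<Sum>i\<in>I. w i * l i)"
    proof -
      have "w i * (R d + R' d * (l i - d)) = (R d - R' d * d) * w i + R' d * (w i * l i)" for i
        by (simp add: algebra_simps)
      then show ?thesis by (simp add: sum.distrib sum_distrib_left)
    qed
    then show ?thesis using assms(3,4) True by (simp add: R_left_def algebra_simps)
  qed
  also have "\<dots> \<le> (\<Sum>i\<in>I. w i * R_left (l i))"
    using tangent_R_left[OF True] assms(2) by (intro sum_mono mult_left_mono) auto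
  finally show ?thesis .
next
  case False
  have "R_left x \<ge> 0" for x
    using R_nonneg[OF left_of_roots(2)[of x]] by (simp add: R_left_def)
  then have "(\<Sum>i\<in>I. w i * R_left (l i)) \<ge> 0" using assms(2) by (intro sum_nonneg) auto
  then show ?thesis using False by (simp add: R_left_def)
qed

text \<open>The contribution of a vertex of deficiency \<open>d\<close> to the trace of
  \<open>(M\<^sup>2 - q I - J) (c I + b M)\<close>, apart from the pairs of vertices without a common neighbour; see
  the trace identity below.\<close>

definition defect :: "real \<Rightarrow> real" where
  "defect d = d * (d - 1) * (c + b * (d - 1))"

lemma ln3_bound: "ln 3 \<le> (11/10 :: real)"
proof -
  have "(1 + 11/160 + (11/160)\<^sup>2 / 2) \<le> exp (11/160 :: real)"
    using exp_lower_Taylor_quadratic[of "11/160::real"] by simp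
  then have "(1 + 11/160 + (11/160)\<^sup>2 / 2) ^ 16 \<le> exp (11/160 :: real) ^ 16"
    by (intro power_mono) auto
  also have "exp (11/160 :: real) ^ 16 = exp (11/10)" by (simp add: exp_of_nat_mult[symmetric])
  finally have "(3 :: real) \<le> exp (11/10)"
    by (rule order_trans[rotated]) (simp add: power2_eq_square eval_nat_numeral)
  then show ?thesis by (metis exp_gt_zero exp_le_cancel_iff exp_ln_iff zero_less_numeral)
qed

text \<open>The tangent at \<open>3\<close>. Its slope suits both ends of the interval on which it is used: there
  the argument grows from about \<open>2\<close> to about \<open>q\<close>.\<close>

lemma ln_tangent3:
  assumes "y > 0"
  shows "ln y \<le> y / 3 + (1/10 :: real)"
proof -
  have "ln (y / 3) \<le> y / 3 - 1" using assms by (intro ln_le_minus_one) auto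
  then show ?thesis using assms ln3_bound by (simp add: ln_div)
qed

text \<open>A rational lower bound for \<open>defect (- D) + R (- D)\<close>, obtained by bounding \<open>b\<close> from above
  and the logarithm by its tangent. It is a concave quadratic polynomial in \<open>D\<close>, so only the
  ends of the interval matter.\<close>

definition F_lower :: "real \<Rightarrow> real" where
  "F_lower D = (D * (2 * real q + 3) + real q) / (2 * N) - b_bound * D * (2 * D + 3 * real q + 1)
     - (real q + 1 + D) / (3 * (real q + 1 / 2)) - 1 / 10"

lemma b_bound_pos: "b_bound > 0" using b_upper b_pos by linarith

lemma F_lower_concave:
  assumes "lo \<le> D" "D \<le> hi" "F_lower lo > 0" "F_lower hi > 0"
  shows "F_lower D > 0"
proof (cases "lo = hi")
  case True
  then show ?thesis using assms by auto
next
  case False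
  then have h: "hi - lo > 0" using assms by simp
  define \<beta> where "\<beta> = (2 * real q + 3) / (2 * N) - b_bound * (3 * real q + 1) - 1 / (3 * (real q + 1 / 2))"
  define \<gamma> where "\<gamma> = real q / (2 * N) - (real q + 1) / (3 * (real q + 1 / 2)) - 1 / 10"
  have F: "F_lower x = \<gamma> + \<beta> * x - 2 * b_bound * x\<^sup>2" for x
    unfolding F_lower_def \<beta>_def \<gamma>_def
    by (simp add: add_divide_distrib algebra_simps power2_eq_square)
  have "F_lower D * (hi - lo) = F_lower lo * (hi - D) + F_lower hi * (D - lo)
      + 2 * b_bound * ((D - lo) * (hi - D) * (hi - lo))"
    unfolding F by (simp add: algebra_simps power2_eq_square)
  moreover have "2 * b_bound * ((D - lo) * (hi - D) * (hi - lo)) \<ge> 0"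
    using assms h b_bound_pos by simp
  moreover have "F_lower lo * (hi - D) + F_lower hi * (D - lo) > 0"
  proof (cases "D = lo")
    case True
    then show ?thesis using assms h by simp
  next
    case False
    then show ?thesis using assms by (intro add_nonneg_pos mult_pos_pos) auto
  qed
  ultimately have "F_lower D * (hi - lo) > 0" by linarith
  then show ?thesis using h by (simp add: zero_less_mult_iff)
qed

lemma F_lower_ends: "F_lower (real q + 1) > 0" "F_lower ((real q)\<^sup>2 - 1) > 0"
proof -
  \<comment> \<open>The substitution makes all coefficients of both numerators positive.\<close>
  define t where "t = real q - 2"
  have t: "t \<ge> 0" and q: "real q = t + 2" using q_ge by (auto simp: t_def)
  have Nq: "N = (t + 2)\<^sup>2 + (t + 2) + 1" by (simp add: N_def q)
  have Np: "(t + 2)\<^sup>2 + (t + 2) + 1 > 0" using N_pos Nq by simp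
  have den: "30 * N * (real q + 1) ^ 3 * (2 * real q + 1) > 0" using N_pos by simp
  have "F_lower D * (30 * N * (real q + 1) ^ 3 * (2 * real q + 1))
     = 15 * (D * (2 * real q + 3) + real q) * (real q + 1) ^ 3 * (2 * real q + 1)
       - 5 * (2 * real q + 1)\<^sup>2 * (real q + 2) * D * (2 * D + 3 * real q + 1)
       - 20 * (real q + 1 + D) * N * (real q + 1) ^ 3 - 3 * N * (real q + 1) ^ 3 * (2 * real q + 1)" for D
  proof -
    have q1: "(real q + 1) ^ 3 \<noteq> 0" "N \<noteq> 0" "2 * real q + 1 \<noteq> 0" using N_pos by auto
    have h: "3 * (real q + 1 / 2) = 3 * (2 * real q + 1) / 2" by simp
    have 1: "(D * (2 * real q + 3) + real q) / (2 * N) * (30 * N * (real q + 1) ^ 3 * (2 * real q + 1))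
        = 15 * (D * (2 * real q + 3) + real q) * (real q + 1) ^ 3 * (2 * real q + 1)"
      using q1 by simp
    have 2: "b_bound * D * (2 * D + 3 * real q + 1) * (30 * N * (real q + 1) ^ 3 * (2 * real q + 1))
        = 5 * (2 * real q + 1)\<^sup>2 * (real q + 2) * D * (2 * D + 3 * real q + 1)"
      unfolding b_bound_def using q1 by (simp add: power2_eq_square)
    have 3: "(real q + 1 + D) / (3 * (real q + 1 / 2)) * (30 * N * (real q + 1) ^ 3 * (2 * real q + 1))
        = 20 * (real q + 1 + D) * N * (real q + 1) ^ 3"
    proof -
      have "X / (3 * w / 2) * (30 * N * Q * w) = 20 * X * N * Q" if "w \<noteq> 0" for X w Q :: real
        using that by (simp add: field_simps)
      then show ?thesis unfolding h using q1(3) by blast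
    qed
    show ?thesis unfolding F_lower_def left_diff_distrib 1 2 3 by simp
  qed
  note F = this
  have "F_lower (real q + 1) * (30 * N * (real q + 1) ^ 3 * (2 * real q + 1))
      = 14 * t ^ 6 + 231 * t ^ 5 + 1506 * t ^ 4 + 4935 * t ^ 3 + 8396 * t\<^sup>2 + 6646 * t + 1560"
    by (subst F, unfold Nq q) (simp add: algebra_simps eval_nat_numeral)
  also have "\<dots> > 0" using t by (simp add: add_nonneg_pos)
  finally show "F_lower (real q + 1) > 0" using zero_less_mult_pos2[OF _ den] by blast
  have "F_lower ((real q)\<^sup>2 - 1) * (30 * N * (real q + 1) ^ 3 * (2 * real q + 1))
      = 14 * t ^ 6 + 266 * t ^ 5 + 1931 * t ^ 4 + 6835 * t ^ 3 + 12111 * t\<^sup>2 + 9331 * t + 1560"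
    by (subst F, unfold Nq q) (simp add: algebra_simps eval_nat_numeral)
  also have "\<dots> > 0" using t by (simp add: add_nonneg_pos)
  finally show "F_lower ((real q)\<^sup>2 - 1) > 0" using zero_less_mult_pos2[OF _ den] by blast
qed

text \<open>The defect is of order \<open>- b D\<^sup>3\<close>. The remainder at \<open>- D\<close> contains the same cubic term with
  the opposite sign, so that the sum is a quadratic polynomial minus a logarithm.\<close>

lemma defect_plus_R_large_degree:
  assumes D: "real q + 1 \<le> D" "D \<le> (real q)\<^sup>2 - 1"
  shows "defect (- D) + R (- D) > 0"
proof -
  have D0: "D > 0" using D by linarith
  have A: "A = (real q + 1) / N - 2 * real q * b" using q_ge by (simp add: b_def)
  have eq: "defect (- D) + R (- D) = ln N / 2 + (D * (2 * real q + 3) + real q) / (2 * N)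
      - b * (D * (2 * D + 3 * real q + 1)) - ln (real q + 1 + D)"
    unfolding defect_def R_def A c_def
    by (simp add: algebra_simps power2_eq_square add_divide_distrib diff_divide_distrib)
  have bb: "b * (D * (2 * D + 3 * real q + 1)) \<le> b_bound * (D * (2 * D + 3 * real q + 1))"
    using D0 b_upper by (intro mult_right_mono) auto
  have sN: "sqrt N \<ge> real q + 1 / 2"
    by (rule real_le_rsqrt) (simp add: N_def power2_eq_square algebra_simps)
  have "ln (real q + 1 + D) - ln N / 2 = ln ((real q + 1 + D) / sqrt N)"
    using D0 N_pos by (simp add: ln_div ln_sqrt)
  also have "\<dots> \<le> (real q + 1 + D) / sqrt N / 3 + 1 / 10"
    by (rule ln_tangent3) (use D0 N_pos in auto)
  also have "(real q + 1 + D) / sqrt N / 3 \<le> (real q + 1 + D) / (3 * (real q + 1 / 2))"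
    using sN D0 by (simp add: frac_le mult.commute)
  finally have "defect (- D) + R (- D) \<ge> F_lower D"
    unfolding eq F_lower_def using bb by (simp add: mult.assoc)
  moreover have "F_lower D > 0" using F_lower_concave[OF D] F_lower_ends by blast
  ultimately show ?thesis by linarith
qed

text \<open>For a degree of at most \<open>2 q + 1\<close> the factor \<open>c - b (D + 1)\<close> is still positive.\<close>

lemma defect_pos_small_degree:
  assumes D: "1 \<le> D" "D \<le> real q"
  shows "defect (- D) > 0"
proof -
  have "b_bound * (real q + 1) < c"
  proof -
    have q1: "real q + 1 > 0" by simp
    have "(2 * real q + 1) * (real q + 2) < 3 * (real q + 1)\<^sup>2"
      using N_pos unfolding N_def by (simp add: algebra_simps power2_eq_square)
    then have "(2 * real q + 1) * (real q + 2) / (6 * N * (real q + 1)\<^sup>2) < 3 * (real q + 1)\<^sup>2 / (6 * N * (real q + 1)\<^sup>2)"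
      using N_pos q1 by (intro divide_strict_right_mono) auto
    also have "\<dots> = c" using q1 by (simp add: c_def)
    also have "(2 * real q + 1) * (real q + 2) / (6 * N * (real q + 1)\<^sup>2) = b_bound * (real q + 1)"
      using q1 by (simp add: b_bound_def power2_eq_square power3_eq_cube)
    finally show ?thesis .
  qed
  moreover have "b * (D + 1) \<le> b_bound * (real q + 1)"
    using b_upper b_bound_pos D by (intro mult_mono) auto
  ultimately have "c - b * (D + 1) > 0" by linarith
  then have "D * (D + 1) * (c - b * (D + 1)) > 0" using D by simp
  then show ?thesis by (simp add: defect_def algebra_simps)
qed

text \<open>The range of \<open>k\<close> is that of the deficiency \<open>q + 1 - deg x\<close> for degrees of at most
  \<open>q\<^sup>2 + q\<close>. Integrality matters: between \<open>0\<close> and \<open>1\<close> the defect is negative.\<close>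

theorem defect_plus_R_left:
  fixes k :: int
  assumes k: "- ((real q)\<^sup>2 - 1) \<le> real_of_int k"
  shows "defect k + R_left k \<ge> 0" and "defect k + R_left k = 0 \<Longrightarrow> k = 0 \<or> k = 1"
proof -
  have Rl: "R_left x \<ge> 0" for x
    using R_nonneg[OF left_of_roots(2)[of x]] by (simp add: R_left_def)
  have z: "k \<in> {0, 1} \<Longrightarrow> defect k + R_left k = 0"
  proof -
    have "\<not> sqrt (real q) \<le> - 1" using sqrt_bounds(1) by linarith
    then show "k \<in> {0, 1} \<Longrightarrow> defect k + R_left k = 0" using q_ge by (auto simp: defect_def R_left_def)
  qed
  have "defect k + R_left k > 0" if ne: "k \<notin> {0, 1}"
  proof (cases "k \<ge> 0")
    case True
    then have k2: "real_of_int k \<ge> 2" using ne by force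
    have "c + b * (k - 1) > 0" using k2 b_pos N_pos by (simp add: c_def add_pos_nonneg)
    then have "defect k > 0" using k2 by (simp add: defect_def)
    then show ?thesis using Rl[of k] by linarith
  next
    case False
    define D where "D = - real_of_int k"
    have D1: "D \<ge> 1" and kD: "real_of_int k = - D" using False by (auto simp: D_def)
    show ?thesis
    proof (cases "D \<le> real q")
      case True
      then show ?thesis using defect_pos_small_degree[OF D1] Rl[of k] kD by (simp add: add_pos_nonneg)
    next
      case False
      then have "- k > int q" by (simp add: D_def)
      then have "- k \<ge> int q + 1" by simp
      then have "D \<ge> real q + 1" unfolding D_def by linarith
      moreover have "D \<le> (real q)\<^sup>2 - 1" using k by (simp add: D_def)
      ultimately have "defect k + R k > 0" using defect_plus_R_large_degree[of D] kD by simp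
      moreover have "real_of_int k \<le> - sqrt (real q)" using False kD sqrt_bounds by simp
      ultimately show ?thesis by (simp add: R_left_def)
    qed
  qed
  note pos = this
  show "defect k + R_left k \<ge> 0" using z pos by (cases "k \<in> {0, 1}") auto
  show "k = 0 \<or> k = 1" if "defect k + R_left k = 0" using that pos by auto
qed

end

section \<open>The spectrum of a \<open>C\<^sub>4\<close>-free graph on \<open>q\<^sup>2 + q + 1\<close> vertices\<close>

lemma C4_free_common_neighbours:
  assumes free: "C4_free G" and G: "simple_graph G"
    and e: "{x, z} \<in> edges G" "{z, y} \<in> edges G" "{x, w} \<in> edges G" "{w, y} \<in> edges G"
    and ne: "x \<noteq> y"
  shows "z = w"
proof (rule ccontr)
  assume zw: "z \<noteq> w"
  have dist: "x \<noteq> z" "z \<noteq> y" "x \<noteq> w" "w \<noteq> y"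
    using e G unfolding simple_graph_def by (force simp: doubleton_eq_iff)+
  have V: "x \<in> vertices G" "y \<in> vertices G" "z \<in> vertices G" "w \<in> vertices G"
    using e G unfolding simple_graph_def by (force simp: doubleton_eq_iff)+
  define H where "H = \<lparr>vertices = {x, z, y, w}, edges = {{x, z}, {z, y}, {y, w}, {w, x}}\<rparr>"
  have "subgraph_of H G"
    unfolding subgraph_of_def simple_graph_def H_def using e V dist ne zw
    by (auto simp: insert_commute)
  moreover have "graph_iso H C4"
    unfolding graph_iso_def
  proof (intro exI[of _ "\<lambda>v. if v = x then 0 else if v = z then 1 else if v = y then 2 else 3"] conjI ballI)
    show "bij_betw (\<lambda>v. if v = x then 0 else if v = z then 1 else if v = y then 2 else 3) (vertices H) (vertices C4)"
      using dist ne zw by (auto simp: bij_betw_def inj_on_def H_def C4_def)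
    fix a b assume "a \<in> vertices H" "b \<in> vertices H"
    then have ab: "a = x \<or> a = z \<or> a = y \<or> a = w" "b = x \<or> b = z \<or> b = y \<or> b = w"
      by (auto simp: H_def)
    show "({a, b} \<in> edges H) = ({if a = x then 0 else if a = z then 1 else if a = y then 2 else 3,
        if b = x then 0 else if b = z then 1 else if b = y then 2 else 3} \<in> edges C4)"
      using ab dist ne zw
      by (elim disjE) (simp_all add: H_def C4_def doubleton_eq_iff)
  qed
  ultimately show False using free by (auto simp: C4_free_def)
qed

text \<open>Every edge is counted once in each direction.\<close>

lemma card_ordered_adjacent_pairs:
  assumes G: "simple_graph G"
  shows "card {(x, y) \<in> vertices G \<times> vertices G. {x, y} \<in> edges G} = 2 * num_edges G"
proof -
  let ?V = "vertices G"
  have fV: "finite ?V" using G by (simp add: simple_graph_def)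
  have ed: "\<exists>u v. d = {u, v} \<and> u \<in> ?V \<and> v \<in> ?V \<and> u \<noteq> v" if "d \<in> edges G" for d
    using G that by (auto simp: simple_graph_def)
  have "edges G \<subseteq> Pow ?V" using ed by fastforce
  then have fE: "finite (edges G)" using fV by (meson finite_Pow_iff finite_subset)
  have "{(x, y) \<in> ?V \<times> ?V. {x, y} \<in> edges G} = (\<Union>d\<in>edges G. {(x, y). {x, y} = d})"
  proof (intro equalityI subsetI)
    fix p assume "p \<in> (\<Union>d\<in>edges G. {(x, y). {x, y} = d})"
    then obtain x y where p: "p = (x, y)" "{x, y} \<in> edges G" by auto
    then have "x \<in> ?V" "y \<in> ?V" using ed[OF p(2)] by (auto simp: doubleton_eq_iff)
    then show "p \<in> {(x, y) \<in> ?V \<times> ?V. {x, y} \<in> edges G}" using p by auto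
  qed auto
  also have "card \<dots> = (\<Sum>d\<in>edges G. card {(x, y). {x, y} = d})"
  proof (rule card_UN_disjoint[OF fE])
    show "\<forall>d\<in>edges G. finite {(x, y). {x, y} = d}"
    proof
      fix d assume "d \<in> edges G"
      then have "{(x, y). {x, y} = d} \<subseteq> ?V \<times> ?V" using ed[of d] by (auto simp: doubleton_eq_iff)
      then show "finite {(x, y). {x, y} = d}" using fV by (meson finite_SigmaI finite_subset)
    qed
  qed auto
  also have "\<dots> = (\<Sum>d\<in>edges G. 2)"
  proof (rule sum.cong[OF refl])
    fix d assume "d \<in> edges G"
    then obtain u v where "d = {u, v}" "u \<noteq> v" using ed by blast
    then have "{(x, y). {x, y} = d} = {(u, v), (v, u)}" by (auto simp: doubleton_eq_iff)
    then show "card {(x, y). {x, y} = d} = 2" using \<open>u \<noteq> v\<close> by simp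
  qed
  finally show ?thesis by (simp add: num_edges_def)
qed

text \<open>The vertices are numbered by \<open>e\<close>. The matrix \<open>M\<close> is \<open>(q + 1) I - L\<close> for the Laplacian
  \<open>L\<close>, that is, the adjacency matrix with the deficiencies \<open>\<delta> i = q + 1 - deg i\<close> on the
  diagonal; for a polarity graph it is the incidence matrix of the plane. The matrix
  \<open>E = M\<^sup>2 - q I - J\<close> measures how far \<open>M\<close> is from being one, and \<open>missing\<close> counts the ordered
  pairs of distinct nonadjacent vertices without a common neighbour.\<close>

locale plane_graph = plane_parameter q for q :: nat +
  fixes G :: "'a graph" and e :: "nat \<Rightarrow> 'a" and n :: nat
  assumes simple: "simple_graph G" and e: "bij_betw e {..<n} (vertices G)"
    and n_def: "n = q ^ 2 + q + 1" and free: "C4_free G"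
begin

definition a :: "nat \<Rightarrow> nat \<Rightarrow> real" where "a i j = of_bool ({e i, e j} \<in> edges G)"
definition \<delta> :: "nat \<Rightarrow> real" where "\<delta> i = real q + 1 - (\<Sum>j<n. a i j)"
definition M :: "nat \<Rightarrow> nat \<Rightarrow> real" where "M i j = a i j + (if i = j then \<delta> i else 0)"
definition E :: "nat \<Rightarrow> nat \<Rightarrow> real" where
  "E i j = (\<Sum>m<n. M i m * M m j) - (if i = j then real q else 0) - 1"
definition missing :: real where
  "missing = (\<Sum>i<n. \<Sum>j<n. if i \<noteq> j \<and> a i j = 0 then - E i j else 0)"

lemma n_pos: "n > 0" by (simp add: n_def)
lemma real_n: "real n = N" by (simp add: n_def N_def)
lemma N_sq: "(real q + 1)\<^sup>2 = N + real q" by (simp add: N_def power2_eq_square algebra_simps)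

lemma e_inj: "i < n \<Longrightarrow> j < n \<Longrightarrow> e i = e j \<longleftrightarrow> i = j"
  using e by (auto simp: bij_betw_def dest: inj_onD)

lemma a_sym: "a i j = a j i" by (simp add: a_def insert_commute)
lemma a_cases: "a i j = 0 \<or> a i j = 1" by (simp add: a_def)
lemma a_nonneg: "a i j \<ge> 0" using a_cases[of i j] by auto
lemma a_diag: "a i i = 0"
  using simple by (auto simp: a_def simple_graph_def doubleton_eq_iff)
lemma M_sym: "M i j = M j i" using a_sym by (auto simp: M_def)
lemma M_off: "i \<noteq> j \<Longrightarrow> M i j = a i j" by (simp add: M_def)
lemma M_diag: "M i i = \<delta> i" by (simp add: M_def a_diag)

lemma M_row_sum: "i < n \<Longrightarrow> (\<Sum>j<n. M i j) = real q + 1"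
  by (simp add: M_def sum.distrib \<delta>_def)

lemma E_row_sum:
  assumes "i < n" shows "(\<Sum>j<n. E i j) = 0"
proof -
  have "(\<Sum>j<n. \<Sum>m<n. M i m * M m j) = (\<Sum>m<n. M i m * (\<Sum>j<n. M m j))"
    by (subst sum.swap) (simp add: sum_distrib_left)
  also have "\<dots> = (real q + 1)\<^sup>2"
    using assms by (simp add: M_row_sum sum_distrib_right[symmetric] power2_eq_square)
  finally have "(\<Sum>j<n. \<Sum>m<n. M i m * M m j) = N + real q" unfolding N_sq .
  then show ?thesis using assms by (simp add: E_def sum_subtractf real_n)
qed

lemma E_diag:
  assumes "i < n" shows "E i i = \<delta> i * (\<delta> i - 1)"
proof -
  have "(\<Sum>m<n. M i m * M m i) = (\<Sum>m<n. a i m + (if i = m then (\<delta> i)\<^sup>2 else 0))"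
  proof (intro sum.cong refl)
    fix m
    show "M i m * M m i = a i m + (if i = m then (\<delta> i)\<^sup>2 else 0)"
      using a_cases[of i m] a_sym[of m i]
      by (cases "i = m") (auto simp: M_off M_diag a_diag power2_eq_square)
  qed
  then show ?thesis using assms
    by (simp add: E_def sum.distrib \<delta>_def algebra_simps power2_eq_square)
qed

lemma common_neighbours_le_1:
  assumes "i < n" "j < n" "i \<noteq> j"
  shows "(\<Sum>m<n. a i m * a m j) \<le> 1"
proof -
  let ?S = "{m \<in> {..<n}. {e i, e m} \<in> edges G \<and> {e m, e j} \<in> edges G}"
  have "(\<Sum>m<n. a i m * a m j) = (\<Sum>m<n. of_bool ({e i, e m} \<in> edges G \<and> {e m, e j} \<in> edges G))"
    by (intro sum.cong refl) (auto simp: a_def)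
  also have "\<dots> = real (card ?S)"
    by (simp add: sum.If_cases of_bool_def Int_def)
  also have "card ?S \<le> 1"
  proof (rule card_le_Suc0_iff_eq[THEN iffD2, unfolded One_nat_def[symmetric]])
    show "\<forall>m\<in>?S. \<forall>m'\<in>?S. m = m'"
    proof (intro ballI)
      fix m m' assume m: "m \<in> ?S" and m': "m' \<in> ?S"
      have "e i \<noteq> e j" using e_inj assms by blast
      with m m' have "e m = e m'"
        using C4_free_common_neighbours[OF free simple, of "e i" "e m" "e j" "e m'"] by simp
      then show "m = m'" using e_inj m m' by simp
    qed
  qed simp
  finally show ?thesis by simp
qed

text \<open>Here the absence of \<open>C\<^sub>4\<close> enters: for nonadjacent \<open>i\<close> and \<open>j\<close> the entry is the number of
  their common neighbours minus \<open>1\<close>.\<close>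

lemma E_nonadjacent:
  assumes "i < n" "j < n" "i \<noteq> j" "a i j = 0"
  shows "E i j \<le> 0"
proof -
  have "(\<Sum>m<n. M i m * M m j) = (\<Sum>m<n. a i m * a m j)"
    using assms a_sym by (intro sum.cong refl) (auto simp: M_def a_diag)
  then show ?thesis using common_neighbours_le_1[OF assms(1-3)] assms(3) by (simp add: E_def)
qed

lemma missing_nonneg: "missing \<ge> 0"
  unfolding missing_def by (intro sum_nonneg) (auto simp: E_nonadjacent)

text \<open>For adjacent vertices the entries of \<open>E\<close> have no useful sign, as they involve the number
  of triangles. They are eliminated with the vanishing row sums of \<open>E\<close>: the sum of \<open>E i j\<close> over
  the neighbours \<open>j\<close> of \<open>i\<close> is minus the sum over all other vertices, including \<open>i\<close> itself.\<close>

lemma trace_identity: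
  "c * (\<Sum>i<n. E i i) + b * (\<Sum>i<n. \<Sum>j<n. E i j * M i j) = (\<Sum>i<n. defect (\<delta> i)) + b * missing"
proof -
  have row: "(\<Sum>j<n. E i j * M i j) = E i i * (\<delta> i - 1)
      + (\<Sum>j<n. if i \<noteq> j \<and> a i j = 0 then - E i j else 0)" if i: "i < n" for i
  proof -
    have "(\<Sum>j<n. E i j * M i j) = (\<Sum>j<n. E i j + (if i = j then E i i * (\<delta> i - 1) else 0)
            + (if i \<noteq> j \<and> a i j = 0 then - E i j else 0))"
    proof (intro sum.cong refl)
      fix j
      show "E i j * M i j = E i j + (if i = j then E i i * (\<delta> i - 1) else 0)
            + (if i \<noteq> j \<and> a i j = 0 then - E i j else 0)"
        using a_cases[of i j] by (auto simp: M_off M_diag algebra_simps)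
    qed
    then show ?thesis using i by (simp add: sum.distrib E_row_sum)
  qed
  have "c * (\<Sum>i<n. E i i) + b * (\<Sum>i<n. \<Sum>j<n. E i j * M i j)
      = (\<Sum>i<n. c * E i i + b * (E i i * (\<delta> i - 1))) + b * missing"
    by (simp add: row missing_def sum.distrib sum_distrib_left distrib_left add.assoc)
  also have "(\<Sum>i<n. c * E i i + b * (E i i * (\<delta> i - 1))) = (\<Sum>i<n. defect (\<delta> i))"
    by (intro sum.cong refl) (simp add: E_diag defect_def algebra_simps)
  finally show ?thesis .
qed

lemma \<delta>_int:
  assumes i: "i < n"
  obtains k :: int where "\<delta> i = real_of_int k" "- ((real q)\<^sup>2 - 1) \<le> real_of_int k"
proof -
  let ?S = "{j \<in> {..<n}. {e i, e j} \<in> edges G}"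
  have s: "(\<Sum>j<n. a i j) = real (card ?S)"
    by (simp add: a_def sum.If_cases of_bool_def Int_def)
  have "?S \<subseteq> {..<n} - {i}" using a_diag[of i] by (auto simp: a_def)
  then have "card ?S \<le> n - 1" using i card_mono[of "{..<n} - {i}" ?S] by simp
  then have "real (card ?S) \<le> (real q)\<^sup>2 + real q"
    using n_def by (metis add_diff_cancel_right' of_nat_add of_nat_le_iff of_nat_power)
  then show ?thesis
    by (intro that[of "int q + 1 - int (card ?S)"]) (auto simp: \<delta>_def s)
qed

lemma sum_\<delta>: "(\<Sum>i<n. \<delta> i) = N * (real q + 1) - 2 * real (num_edges G)"
proof -
  let ?P = "{(i, j) \<in> {..<n} \<times> {..<n}. {e i, e j} \<in> edges G}"
  let ?Q = "{(x, y) \<in> vertices G \<times> vertices G. {x, y} \<in> edges G}"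
  have "bij_betw (map_prod e e) ({..<n} \<times> {..<n}) (vertices G \<times> vertices G)"
    using bij_betw_map_prod[OF e e] .
  moreover have "map_prod e e ` ?P = ?Q"
  proof (intro equalityI subsetI)
    fix p assume "p \<in> ?Q"
    then obtain x y where p: "p = (x, y)" "x \<in> vertices G" "y \<in> vertices G" "{x, y} \<in> edges G" by auto
    then obtain i j where "i < n" "j < n" "x = e i" "y = e j"
      using e by (metis bij_betw_imp_surj_on imageE lessThan_iff)
    then show "p \<in> map_prod e e ` ?P" using p by (intro image_eqI[of _ _ "(i, j)"]) auto
  next
    fix p assume "p \<in> map_prod e e ` ?P"
    then obtain i j where "p = (e i, e j)" "i < n" "j < n" "{e i, e j} \<in> edges G" by auto
    moreover have "e i \<in> vertices G" if "i < n" for i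
      using bij_betwE[OF e] that by blast
    ultimately show "p \<in> ?Q" by simp
  qed
  ultimately have "bij_betw (map_prod e e) ?P ?Q"
    using bij_betw_subset[of "map_prod e e" "{..<n} \<times> {..<n}" _ ?P ?Q] by blast
  then have "card ?P = card ?Q" by (rule bij_betw_same_card)
  moreover have "(\<Sum>i<n. \<Sum>j<n. a i j) = real (card ?P)"
  proof -
    have "(\<Sum>i<n. \<Sum>j<n. a i j) = (\<Sum>p\<in>{..<n} \<times> {..<n}. of_bool (p \<in> ?P))"
      unfolding sum.cartesian_product by (intro sum.cong refl) (auto simp: a_def)
    also have "\<dots> = real (card (({..<n} \<times> {..<n}) \<inter> ?P))"
      by (simp add: of_bool_def sum.If_cases)
    also have "({..<n} \<times> {..<n}) \<inter> ?P = ?P" by blast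
    finally show ?thesis .
  qed
  ultimately have "(\<Sum>i<n. \<Sum>j<n. a i j) = 2 * real (num_edges G)"
    using card_ordered_adjacent_pairs[OF simple] by simp
  then show ?thesis by (simp add: \<delta>_def sum_subtractf real_n algebra_simps)
qed

lemma laplacian_eq:
  assumes "i < n" "j < n"
  shows "laplacian n a i j = (if i = j then real q + 1 else 0) - M i j"
  by (auto simp: laplacian_def M_def \<delta>_def)

text \<open>The form is half the sum of \<open>a i j (x i - x j)\<^sup>2\<close>.\<close>

lemma laplacian_quadratic_form:
  "(\<Sum>i<n. \<Sum>j<n. laplacian n a i j * (x i * x j)) \<ge> 0"
proof -
  have "laplacian n a i j * (x i * x j) = (if i = j then \<Sum>k<n. a i k * (x i)\<^sup>2 else 0) - a i j * (x i * x j)" for i j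
    by (simp add: laplacian_def power2_eq_square sum_distrib_right left_diff_distrib)
  then have "(\<Sum>i<n. \<Sum>j<n. laplacian n a i j * (x i * x j))
      = (\<Sum>i<n. \<Sum>j<n. a i j * (x i)\<^sup>2) - (\<Sum>i<n. \<Sum>j<n. a i j * (x i * x j))"
    by (simp add: sum_subtractf)
  moreover have "(\<Sum>i<n. \<Sum>j<n. a i j * (x i)\<^sup>2) = (\<Sum>i<n. \<Sum>j<n. a i j * (x j)\<^sup>2)"
    using a_sym by (subst sum.swap) (metis (no_types, lifting) sum.cong)
  ultimately have "2 * (\<Sum>i<n. \<Sum>j<n. laplacian n a i j * (x i * x j))
      = (\<Sum>i<n. \<Sum>j<n. a i j * (x i)\<^sup>2) + (\<Sum>i<n. \<Sum>j<n. a i j * (x j)\<^sup>2)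
        - 2 * (\<Sum>i<n. \<Sum>j<n. a i j * (x i * x j))" by linarith
  also have "\<dots> = (\<Sum>i<n. \<Sum>j<n. a i j * (x i - x j)\<^sup>2)"
  proof -
    have "a i j * (x i - x j)\<^sup>2 = a i j * (x i)\<^sup>2 + a i j * (x j)\<^sup>2 - 2 * (a i j * (x i * x j))" for i j
      by (simp add: power2_eq_square algebra_simps)
    then show ?thesis by (simp only: sum.distrib sum_subtractf sum_distrib_left)
  qed
  also have "\<dots> \<ge> 0" using a_nonneg by (intro sum_nonneg) auto
  finally show ?thesis by linarith
qed

end

text \<open>Matrices that are diagonal in a common orthonormal basis are multiplied eigenvalue by
  eigenvalue.\<close>

lemma spectral_mult:
  fixes u :: "nat \<Rightarrow> nat \<Rightarrow> real"
  assumes u: "\<And>i j. i < n \<Longrightarrow> j < n \<Longrightarrow> (\<Sum>k<n. u k i * u k j) = (if i = j then 1 else 0)"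
  shows "(\<Sum>j<n. (\<Sum>k<n. f k * (u i k * u j k)) * (\<Sum>m<n. g m * (u j m * u p m)))
       = (\<Sum>k<n. f k * g k * (u i k * u p k))"
proof -
  have "(\<Sum>j<n. (\<Sum>k<n. f k * (u i k * u j k)) * (\<Sum>m<n. g m * (u j m * u p m)))
      = (\<Sum>j<n. \<Sum>k<n. \<Sum>m<n. f k * u i k * g m * u p m * (u j k * u j m))"
    by (simp add: sum_product mult_ac)
  also have "\<dots> = (\<Sum>k<n. \<Sum>m<n. \<Sum>j<n. f k * u i k * g m * u p m * (u j k * u j m))"
    by (subst sum.swap) (intro sum.cong refl sum.swap)
  also have "\<dots> = (\<Sum>k<n. \<Sum>m<n. f k * u i k * g m * u p m * (if k = m then 1 else 0))"
    by (intro sum.cong refl) (simp add: sum_distrib_left[symmetric] u)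
  also have "\<dots> = (\<Sum>k<n. f k * g k * (u i k * u p k))"
    by (intro sum.cong refl) (simp add: if_distrib mult_ac cong: if_cong)
  finally show ?thesis .
qed

text \<open>An orthonormal eigenbasis of \<open>M\<close> that starts with the constant vector, of eigenvalue
  \<open>q + 1\<close>. The eigenvalues \<open>\<eta>\<close> of \<open>E\<close> are \<open>l k\<^sup>2 - q\<close> except for the first one, where subtracting
  \<open>J\<close> turns \<open>(q + 1)\<^sup>2 - q = n\<close> into \<open>0\<close>; the eigenvalues of the Laplacian are \<open>\<mu>\<close>.\<close>

locale plane_graph_spectrum = plane_graph q G e n for q :: nat and G :: "'a graph" and e n +
  fixes u :: "nat \<Rightarrow> nat \<Rightarrow> real" and l :: "nat \<Rightarrow> real"
  assumes rows: "\<And>i j. i < n \<Longrightarrow> j < n \<Longrightarrow> (\<Sum>k<n. u i k * u j k) = (if i = j then 1 else 0)"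
    and cols: "\<And>i j. i < n \<Longrightarrow> j < n \<Longrightarrow> (\<Sum>k<n. u k i * u k j) = (if i = j then 1 else 0)"
    and M_spec: "\<And>i j. i < n \<Longrightarrow> j < n \<Longrightarrow> M i j = (\<Sum>k<n. l k * (u i k * u j k))"
    and u0: "\<And>i. i < n \<Longrightarrow> u i 0 = 1 / sqrt (real n)"
    and l0: "l 0 = real q + 1"
begin

definition \<eta> :: "nat \<Rightarrow> real" where "\<eta> k = (if k = 0 then 0 else (l k)\<^sup>2 - real q)"
definition \<mu> :: "nat \<Rightarrow> real" where "\<mu> k = real q + 1 - l k"

lemma sum_split: "(\<Sum>k<n. f k) = f 0 + (\<Sum>k\<in>{0<..<n}. f k)" for f :: "nat \<Rightarrow> real"
proof -
  have "{..<n} = insert 0 {0<..<n}" using n_pos by auto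
  then show ?thesis by simp
qed

lemma u0_u0: "i < n \<Longrightarrow> j < n \<Longrightarrow> u i 0 * u j 0 = 1 / N"
  using n_pos by (simp add: u0 real_n[symmetric])

lemma E_spec:
  assumes ij: "i < n" "j < n"
  shows "E i j = (\<Sum>k<n. \<eta> k * (u i k * u j k))"
proof -
  have "(\<Sum>m<n. M i m * M m j) = (\<Sum>m<n. (\<Sum>k<n. l k * (u i k * u m k)) * (\<Sum>k<n. l k * (u m k * u j k)))"
    using ij by (intro sum.cong refl) (simp add: M_spec)
  also have "\<dots> = (\<Sum>k<n. (l k)\<^sup>2 * (u i k * u j k))"
    by (subst spectral_mult[OF cols]) (simp_all add: power2_eq_square)
  finally have "E i j = (\<Sum>k<n. (l k)\<^sup>2 * (u i k * u j k)) - (\<Sum>k<n. real q * (u i k * u j k)) - N * (u i 0 * u j 0)"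
    using ij rows N_pos by (simp add: E_def sum_distrib_left[symmetric] u0_u0)
  also have "\<dots> = (\<Sum>k<n. \<eta> k * (u i k * u j k))"
    unfolding sum_subtractf[symmetric] unfolding sum_split \<eta>_def l0 N_sq
    by (simp add: algebra_simps)
  finally show ?thesis .
qed

lemma trace_spec: "(\<Sum>i<n. \<Sum>k<n. f k * (u i k * u i k)) = (\<Sum>k<n. f k)"
proof -
  have "(\<Sum>i<n. \<Sum>k<n. f k * (u i k * u i k)) = (\<Sum>k<n. f k * (\<Sum>i<n. u i k * u i k))"
    by (subst sum.swap) (simp add: sum_distrib_left)
  then show ?thesis by (simp add: cols)
qed

lemma trace_E: "(\<Sum>i<n. E i i) = (\<Sum>k<n. \<eta> k)"
  by (subst trace_spec[symmetric]) (intro sum.cong refl, simp add: E_spec)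

lemma trace_EM: "(\<Sum>i<n. \<Sum>j<n. E i j * M i j) = (\<Sum>k<n. \<eta> k * l k)"
proof -
  have "(\<Sum>j<n. E i j * M i j) = (\<Sum>k<n. \<eta> k * l k * (u i k * u i k))" if i: "i < n" for i
  proof -
    have "(\<Sum>j<n. E i j * M i j) = (\<Sum>j<n. (\<Sum>k<n. \<eta> k * (u i k * u j k)) * (\<Sum>m<n. l m * (u j m * u i m)))"
      using i by (intro sum.cong refl) (simp add: E_spec M_spec mult.commute)
    then show ?thesis by (simp add: spectral_mult[OF cols])
  qed
  then show ?thesis using trace_spec[of "\<lambda>k. \<eta> k * l k"] by simp
qed

lemma trace_M: "(\<Sum>i<n. \<delta> i) = (\<Sum>k<n. l k)"
  by (subst trace_spec[symmetric]) (intro sum.cong refl, simp add: M_spec M_diag[symmetric])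

text \<open>Both sides are the trace of \<open>E (c I + b M)\<close>.\<close>

lemma cubic_trace:
  "(\<Sum>k\<in>{0<..<n}. ((l k)\<^sup>2 - real q) * (c + b * l k)) = (\<Sum>i<n. defect (\<delta> i)) + b * missing"
proof -
  have "(\<Sum>k\<in>{0<..<n}. ((l k)\<^sup>2 - real q) * (c + b * l k)) = (\<Sum>k<n. \<eta> k * (c + b * l k))"
    unfolding sum_split by (simp add: \<eta>_def)
  also have "\<dots> = c * (\<Sum>k<n. \<eta> k) + b * (\<Sum>k<n. \<eta> k * l k)"
    by (simp add: sum_distrib_left sum.distrib algebra_simps)
  finally show ?thesis using trace_identity trace_E trace_EM by simp
qed

lemma laplacian_spec:
  assumes "i < n" "j < n"
  shows "laplacian n a i j = (\<Sum>k<n. \<mu> k * (u i k * u j k))"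
proof -
  have "(\<Sum>k<n. \<mu> k * (u i k * u j k)) = (real q + 1) * (\<Sum>k<n. u i k * u j k) - M i j"
    using assms by (simp add: \<mu>_def left_diff_distrib sum_subtractf M_spec sum_distrib_left)
  then show ?thesis using assms by (simp add: laplacian_eq rows)
qed

lemma quadratic_form_spec:
  assumes k: "k < n" and f: "\<And>i j. i < n \<Longrightarrow> j < n \<Longrightarrow> F i j = (\<Sum>m<n. y m * (u i m * u j m))"
  shows "(\<Sum>i<n. \<Sum>j<n. F i j * (u i k * u j k)) = y k"
proof -
  have "(\<Sum>i<n. \<Sum>j<n. F i j * (u i k * u j k)) = (\<Sum>i<n. \<Sum>j<n. \<Sum>m<n. y m * (u i m * u i k) * (u j m * u j k))"
    by (intro sum.cong refl) (simp add: f sum_distrib_left sum_distrib_right mult_ac)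
  also have "\<dots> = (\<Sum>i<n. \<Sum>m<n. \<Sum>j<n. y m * (u i m * u i k) * (u j m * u j k))"
    by (intro sum.cong refl sum.swap)
  also have "\<dots> = (\<Sum>i<n. y k * (u i k * u i k))"
    by (intro sum.cong refl)
      (simp add: sum_distrib_left[symmetric] cols k if_distrib cong: if_cong)
  also have "\<dots> = y k" by (simp add: sum_distrib_left[symmetric] cols k)
  finally show ?thesis .
qed

lemma \<mu>_nonneg: "k < n \<Longrightarrow> \<mu> k \<ge> 0"
  using quadratic_form_spec[of k "laplacian n a" \<mu>] laplacian_spec
    laplacian_quadratic_form[of "\<lambda>i. u i k"] by simp

text \<open>Adding the all-ones matrix \<open>J\<close> replaces the eigenvalue \<open>0\<close> of the constant vector by \<open>n\<close>.\<close>

lemma spanning_trees_spec: "real n * real (num_spanning_trees G) = (\<Prod>k\<in>{0<..<n}. \<mu> k)"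
proof -
  define y where "y k = (if k = 0 then real n else \<mu> k)" for k
  have "Matrix.mat n n (\<lambda>(i, j). laplacian n a i j + 1)
      = Matrix.mat n n (\<lambda>(i, j). \<Sum>k<n. y k * (u i k * u j k))"
  proof (rule cong_mat, goal_cases)
    case (3 i j)
    have "\<mu> 0 = 0" by (simp add: \<mu>_def l0)
    then show ?case using 3 N_pos
      by (simp add: laplacian_spec sum_split y_def u0_u0 real_n)
  qed auto
  then have "det (Matrix.mat n n (\<lambda>(i, j). laplacian n a i j + 1)) = (\<Prod>k<n. y k)"
    using det_orthogonal_conjugate[OF rows, of y] by simp
  also have "{..<n} = insert 0 {0<..<n}" using n_pos by auto
  also have "(\<Prod>k\<in>insert 0 {0<..<n}. y k) = real n * (\<Prod>k\<in>{0<..<n}. \<mu> k)"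
    by (simp add: y_def)
  also have "det (Matrix.mat n n (\<lambda>(i, j). laplacian n a i j + 1)) = (real n)\<^sup>2 * real (num_spanning_trees G)"
    using matrix_tree[OF simple e n_pos] by (simp add: a_def[abs_def])
  finally have "real n * (real n * real (num_spanning_trees G)) = real n * (\<Prod>k\<in>{0<..<n}. \<mu> k)"
    by (simp add: power2_eq_square)
  then show ?thesis using n_pos by simp
qed

definition bound :: real where
  "bound = real n powr ((real n - 3) / 2)
     * exp (- 2 * A * (1 / 2 * real q * (real q + 1)\<^sup>2 - real (num_edges G)))"

definition slack :: real where
  "slack = (\<Sum>i<n. defect (\<delta> i)) + b * missing + (\<Sum>k\<in>{0<..<n}. R (l k))"

lemma sum_l: "(\<Sum>k\<in>{0<..<n}. l k) = 2 * (1 / 2 * real q * (real q + 1)\<^sup>2 - real (num_edges G))"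
proof -
  have "(\<Sum>k\<in>{0<..<n}. l k) = N * (real q + 1) - 2 * real (num_edges G) - (real q + 1)"
    using trace_M sum_\<delta> sum_split[of l] l0 by simp
  also have "N * (real q + 1) - (real q + 1) = real q * (real q + 1)\<^sup>2"
    by (simp add: N_def power2_eq_square algebra_simps)
  ultimately show ?thesis by (simp add: algebra_simps)
qed

text \<open>The sum over \<open>k\<close> of the identity that defines \<open>R\<close>, where the linear terms add up to the
  trace of \<open>M\<close> without its first eigenvalue, which is determined by the number of edges, and the
  cubic terms are given by the trace identity.\<close>

lemma spanning_trees_slack:
  assumes pos: "\<And>k. k \<in> {0<..<n} \<Longrightarrow> \<mu> k > 0"
  shows "real (num_spanning_trees G) = bound * exp (- slack)"
proof -
  have prod: "real n * real (num_spanning_trees G) > 0"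
    unfolding spanning_trees_spec using pos by (intro prod_pos) auto
  then have t: "real (num_spanning_trees G) > 0" using n_pos by (simp add: zero_less_mult_iff)
  have "ln (real n) + ln (real (num_spanning_trees G)) = (\<Sum>k\<in>{0<..<n}. ln (\<mu> k))"
  proof -
    have "ln (real n) + ln (real (num_spanning_trees G)) = ln (\<Prod>k\<in>{0<..<n}. \<mu> k)"
      unfolding spanning_trees_spec[symmetric] using t n_pos by (simp add: ln_mult_pos)
    also have "\<dots> = (\<Sum>k\<in>{0<..<n}. ln (\<mu> k))"
    proof (rule ln_prod)
      fix k assume "k \<in> {0<..<n}"
      from pos[OF this] show "\<mu> k \<noteq> 0" by simp
    qed simp
    finally show ?thesis .
  qed
  also have "\<dots> = (\<Sum>k\<in>{0<..<n}. ln N / 2 - A * l k - (((l k)\<^sup>2 - real q) * (c + b * l k) + R (l k)))"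
    by (intro sum.cong refl) (simp add: R_def \<mu>_def algebra_simps)
  also have "\<dots> = (real n - 1) * (ln N / 2) - A * (\<Sum>k\<in>{0<..<n}. l k) - slack"
    using n_pos by (simp add: sum_subtractf sum.distrib cubic_trace slack_def sum_distrib_left of_nat_diff)
  finally have "ln (real (num_spanning_trees G)) = (real n - 3) / 2 * ln (real n)
      + (- 2 * A * (1 / 2 * real q * (real q + 1)\<^sup>2 - real (num_edges G))) - slack"
    unfolding sum_l real_n by (simp add: field_simps)
  then have "real (num_spanning_trees G) = exp ((real n - 3) / 2 * ln (real n)
      + (- 2 * A * (1 / 2 * real q * (real q + 1)\<^sup>2 - real (num_edges G))) + - slack)"
    using t by (metis exp_ln diff_conv_add_uminus)
  also have "\<dots> = bound * exp (- slack)"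
    unfolding exp_add bound_def powr_def using n_pos by simp
  finally show ?thesis .
qed

text \<open>The diagonal entry \<open>\<delta> i\<close> is the mean of the eigenvalues with the weights \<open>(u i k)\<^sup>2\<close>.
  These are doubly stochastic, so that summing Jensen's inequality over \<open>i\<close> yields every
  eigenvalue once.\<close>

lemma sum_R_left_le: "(\<Sum>i<n. R_left (\<delta> i)) \<le> (\<Sum>k\<in>{0<..<n}. R_left (l k))"
proof -
  have le: "l k \<le> real q + 1" if "k < n" for k using \<mu>_nonneg[OF that] by (simp add: \<mu>_def)
  have "R_left (\<delta> i) \<le> (\<Sum>k<n. u i k * u i k * R_left (l k))" if i: "i < n" for i
  proof (rule jensen_R_left)
    show "(\<Sum>k<n. u i k * u i k * l k) = \<delta> i"
      using M_spec[OF i i] by (simp add: M_diag mult_ac)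
    show "(\<Sum>k<n. u i k * u i k) = 1" using rows[OF i i] by simp
  qed (use le in auto)
  then have "(\<Sum>i<n. R_left (\<delta> i)) \<le> (\<Sum>i<n. \<Sum>k<n. R_left (l k) * (u i k * u i k))"
    by (intro sum_mono) (simp add: mult_ac)
  also have "\<dots> = (\<Sum>k<n. R_left (l k))" by (rule trace_spec)
  also have "\<dots> = (\<Sum>k\<in>{0<..<n}. R_left (l k))"
  proof -
    have "\<not> real q + 1 \<le> - sqrt (real q)" using sqrt_bounds(1) by linarith
    then show ?thesis by (simp add: sum_split l0 R_left_def)
  qed
  finally show ?thesis .
qed

text \<open>The remainders are split into \<open>R_left\<close>, which goes to the vertices by Jensen's
  inequality, and the nonnegative rest. If the total is zero, then first all deficiencies are
  \<open>0\<close> or \<open>1\<close>; after that nothing but the remainders themselves is left, and they vanish only at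
  the nodes.\<close>

lemma slack_nonneg:
  assumes pos: "\<And>k. k \<in> {0<..<n} \<Longrightarrow> \<mu> k > 0"
  shows "slack \<ge> 0"
    and "slack = 0 \<Longrightarrow> i < n \<Longrightarrow> \<delta> i = 0 \<or> \<delta> i = 1"
    and "slack = 0 \<Longrightarrow> i < n \<Longrightarrow> j < n \<Longrightarrow> E i j = 0"
proof -
  have lt: "l k < real q + 1" if "k \<in> {0<..<n}" for k using pos[OF that] by (simp add: \<mu>_def)
  have d: "defect (\<delta> i) + R_left (\<delta> i) \<ge> 0"
      "defect (\<delta> i) + R_left (\<delta> i) = 0 \<Longrightarrow> \<delta> i = 0 \<or> \<delta> i = 1" if i: "i < n" for i
  proof -
    obtain k :: int where k: "\<delta> i = real_of_int k" "- ((real q)\<^sup>2 - 1) \<le> real_of_int k"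
      using \<delta>_int[OF i] by blast
    show "defect (\<delta> i) + R_left (\<delta> i) \<ge> 0"
      using defect_plus_R_left(1)[OF k(2)] k(1) by simp
    show "\<delta> i = 0 \<or> \<delta> i = 1" if "defect (\<delta> i) + R_left (\<delta> i) = 0"
      using defect_plus_R_left(2)[OF k(2)] that k(1) by auto
  qed
  let ?D = "\<Sum>i<n. defect (\<delta> i) + R_left (\<delta> i)"
  let ?R = "\<Sum>k\<in>{0<..<n}. R (l k) - R_left (l k)"
  have D0: "?D \<ge> 0" using d(1) by (intro sum_nonneg) auto
  have R0: "?R \<ge> 0" using R_left_le[OF lt] by (intro sum_nonneg) auto
  have M0: "b * missing \<ge> 0" using b_pos missing_nonneg by simp
  have ge: "slack \<ge> ?D + b * missing + ?R"
    unfolding slack_def sum.distrib sum_subtractf using sum_R_left_le by linarith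
  then show "slack \<ge> 0" using D0 R0 M0 by linarith
  {
    assume s: "slack = 0"
    have "?D = 0" using ge D0 R0 M0 s by linarith
    then have "\<forall>i\<in>{..<n}. defect (\<delta> i) + R_left (\<delta> i) = 0"
      using d(1) by (subst (asm) sum_nonneg_eq_0_iff) auto
    then show D: "\<And>i. i < n \<Longrightarrow> \<delta> i = 0 \<or> \<delta> i = 1" using d(2) by blast
    have "(\<Sum>i<n. defect (\<delta> i)) = 0"
      using D by (intro sum.neutral) (auto simp: defect_def)
    then have "(\<Sum>k\<in>{0<..<n}. R (l k)) \<le> 0" using s M0 by (simp add: slack_def)
    moreover have Rk: "R (l k) \<ge> 0" if "k \<in> {0<..<n}" for k using R_nonneg[OF lt[OF that]] .
    ultimately have "(\<Sum>k\<in>{0<..<n}. R (l k)) = 0" by (meson order_antisym sum_nonneg)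
    then have R0: "R (l k) = 0" if "k \<in> {0<..<n}" for k
      using sum_nonneg_eq_0_iff[of "{0<..<n}" "\<lambda>k. R (l k)"] Rk that by blast
    have "\<eta> k = 0" if "k < n" for k
    proof (cases "k = 0")
      case False
      then have k: "k \<in> {0<..<n}" using that by simp
      then show ?thesis using R_pos[OF lt[OF k]] R0[OF k] by (auto simp: \<eta>_def)
    qed (simp add: \<eta>_def)
    then show "\<And>i j. i < n \<Longrightarrow> j < n \<Longrightarrow> E i j = 0" by (simp add: E_spec)
  }
qed

lemma spanning_trees_of_polar:
  assumes \<delta>: "\<And>i. i < n \<Longrightarrow> \<delta> i = 0 \<or> \<delta> i = 1"
    and E: "\<And>i j. i < n \<Longrightarrow> j < n \<Longrightarrow> E i j = 0"
  shows "real (num_spanning_trees G) = bound"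
proof -
  have \<eta>: "\<eta> k = 0" if "k < n" for k
    using quadratic_form_spec[OF that, of E \<eta>] E_spec E by simp
  have l: "(l k)\<^sup>2 = real q" if "k \<in> {0<..<n}" for k
    using \<eta>[of k] that by (simp add: \<eta>_def)
  have pos: "\<mu> k > 0" if "k \<in> {0<..<n}" for k
  proof -
    have "l k \<le> sqrt (real q)" using l[OF that] by (metis abs_le_D1 order_refl real_sqrt_abs)
    then show ?thesis using sqrt_bounds by (simp add: \<mu>_def)
  qed
  have "slack = 0"
  proof -
    have "(\<Sum>i<n. defect (\<delta> i)) = 0"
      using \<delta> by (intro sum.neutral) (auto simp: defect_def)
    moreover have "missing = 0" unfolding missing_def by (intro sum.neutral ballI) (simp add: E)
    moreover have "(\<Sum>k\<in>{0<..<n}. R (l k)) = 0" using R_zero l by (intro sum.neutral) auto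
    ultimately show ?thesis by (simp add: slack_def)
  qed
  then show ?thesis using spanning_trees_slack[OF pos] by simp
qed

text \<open>If some \<open>\<mu> k\<close> with \<open>k > 0\<close> vanishes, there are no spanning trees and the bound is strict.\<close>

theorem spanning_trees_bound:
  "real (num_spanning_trees G) \<le> bound"
  "real (num_spanning_trees G) = bound \<longleftrightarrow>
     (\<forall>i<n. \<delta> i = 0 \<or> \<delta> i = 1) \<and> (\<forall>i<n. \<forall>j<n. E i j = 0)"
proof -
  have bpos: "bound > 0" using n_pos by (simp add: bound_def)
  have "real (num_spanning_trees G) \<le> bound \<and> (real (num_spanning_trees G) = bound \<longrightarrow>
     (\<forall>i<n. \<delta> i = 0 \<or> \<delta> i = 1) \<and> (\<forall>i<n. \<forall>j<n. E i j = 0))"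
  proof (cases "\<forall>k\<in>{0<..<n}. \<mu> k > 0")
    case True
    then have pos: "\<And>k. k \<in> {0<..<n} \<Longrightarrow> \<mu> k > 0" by blast
    note t = spanning_trees_slack[OF pos]
    have "bound * exp (- slack) \<le> bound * 1"
      using slack_nonneg(1)[OF pos] bpos by (intro mult_left_mono) auto
    moreover have "slack = 0" if "bound * exp (- slack) = bound" using that bpos by simp
    ultimately show ?thesis using t slack_nonneg(2,3)[OF pos] by auto
  next
    case False
    then obtain k where "k \<in> {0<..<n}" "\<mu> k = 0" using \<mu>_nonneg by fastforce
    then have "(\<Prod>k\<in>{0<..<n}. \<mu> k) = 0" by (intro prod_zero) auto
    then have "real n * real (num_spanning_trees G) = 0" using spanning_trees_spec by metis
    then have "num_spanning_trees G = 0" using n_pos by simp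
    then show ?thesis using bpos by simp
  qed
  then show "real (num_spanning_trees G) \<le> bound"
    "real (num_spanning_trees G) = bound \<longleftrightarrow>
     (\<forall>i<n. \<delta> i = 0 \<or> \<delta> i = 1) \<and> (\<forall>i<n. \<forall>j<n. E i j = 0)"
    using spanning_trees_of_polar by blast+
qed

end

section \<open>Polarity graphs\<close>

text \<open>Two points on each of two lines, all different from the intersection of these lines, form
  a quadrangle.\<close>

lemma finite_projective_planeI:
  assumes fin: "finite (points Pl)" "finite (lines Pl)"
    and pts: "\<And>x y. x \<in> points Pl \<Longrightarrow> y \<in> points Pl \<Longrightarrow> x \<noteq> y \<Longrightarrow>
        \<exists>!k. k \<in> lines Pl \<and> incident Pl x k \<and> incident Pl y k"
    and lns: "\<And>k m. k \<in> lines Pl \<Longrightarrow> m \<in> lines Pl \<Longrightarrow> k \<noteq> m \<Longrightarrow>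
        \<exists>!x. x \<in> points Pl \<and> incident Pl x k \<and> incident Pl x m"
    and thick: "\<And>k. k \<in> lines Pl \<Longrightarrow> card {x \<in> points Pl. incident Pl x k} \<ge> 3"
    and two: "k1 \<in> lines Pl" "k2 \<in> lines Pl" "k1 \<noteq> k2"
  shows "finite_projective_plane Pl"
proof -
  let ?on = "\<lambda>k. {x \<in> points Pl. incident Pl x k}"
  obtain p where p: "p \<in> points Pl" "incident Pl p k1" "incident Pl p k2"
    using lns[OF two] by blast
  have pick: "\<exists>x y. x \<in> ?on k - {p} \<and> y \<in> ?on k - {p} \<and> x \<noteq> y" if "k \<in> lines Pl" for k
  proof -
    have "card (?on k - {p}) \<ge> 2" using thick[OF that]
      by (simp only: card_Diff_singleton_if split: if_split) linarith
    then obtain T where T: "T \<subseteq> ?on k - {p}" "card T = 2" by (meson obtain_subset_with_card_n)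
    then obtain s t where "T = {s, t}" "s \<noteq> t" by (meson card_2_iff)
    then show ?thesis using T(1) by (intro exI[of _ s] exI[of _ t]) simp
  qed
  obtain x y where xy: "x \<in> ?on k1 - {p}" "y \<in> ?on k1 - {p}" "x \<noteq> y" using pick[OF two(1)] by blast
  obtain z w where zw: "z \<in> ?on k2 - {p}" "w \<in> ?on k2 - {p}" "z \<noteq> w" using pick[OF two(2)] by blast
  have meet: "v = p" if "v \<in> points Pl" "incident Pl v k1" "incident Pl v k2" for v
    using lns[OF two] p that by blast
  have off: "\<not> incident Pl x k2" "\<not> incident Pl y k2" "\<not> incident Pl z k1" "\<not> incident Pl w k1"
    using xy zw meet by blast+
  have line1: "k = k1" if "k \<in> lines Pl" "incident Pl x k" "incident Pl y k" for k
    using pts[of x y] xy two that by blast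
  have line2: "k = k2" if "k \<in> lines Pl" "incident Pl z k" "incident Pl w k" for k
    using pts[of z w] zw two that by blast
  have ne: "x \<noteq> z" "x \<noteq> w" "y \<noteq> z" "y \<noteq> w" using off xy zw by blast+
  have "\<exists>Q\<subseteq>points Pl. card Q = 4 \<and>
        (\<forall>T\<subseteq>Q. card T = 3 \<longrightarrow> \<not> (\<exists>k\<in>lines Pl. \<forall>v\<in>T. incident Pl v k))"
  proof (intro exI[of _ "{x, y, z, w}"] conjI allI impI notI)
    show "{x, y, z, w} \<subseteq> points Pl" using xy zw by blast
    show "card {x, y, z, w} = 4" using xy(3) zw(3) ne by simp
    fix T assume T: "T \<subseteq> {x, y, z, w}" "card T = 3" and "\<exists>k\<in>lines Pl. \<forall>v\<in>T. incident Pl v k"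
    then obtain k where k: "k \<in> lines Pl" "\<And>v. v \<in> T \<Longrightarrow> incident Pl v k" by blast
    have fT: "finite T" using T by (meson finite.emptyI finite_insert finite_subset)
    \<comment> \<open>At most one of the four points is missing from \<open>T\<close>.\<close>
    have miss: "s \<in> T \<or> t \<in> T" if "s \<in> {x, y, z, w}" "t \<in> {x, y, z, w}" "s \<noteq> t" for s t
    proof (rule ccontr)
      assume "\<not> (s \<in> T \<or> t \<in> T)"
      then have "T \<subseteq> {x, y, z, w} - {s, t}" using T(1) by blast
      then have "card T \<le> card ({x, y, z, w} - {s, t})" by (intro card_mono) auto
      also have "\<dots> = 2" using that xy(3) zw(3) ne by (subst card_Diff_subset) auto
      finally show False using T(2) by simp
    qed
    have "x \<in> T \<and> y \<in> T \<and> (z \<in> T \<or> w \<in> T) \<or> z \<in> T \<and> w \<in> T \<and> (x \<in> T \<or> y \<in> T)"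
      using miss[of x y] miss[of x z] miss[of x w] miss[of y z] miss[of y w] miss[of z w] ne xy(3) zw(3)
      by blast
    then show False using k line1 line2 off by blast
  qed
  note quad = this
  show ?thesis
    unfolding finite_projective_plane_def
    by (intro conjI ballI impI fin pts lns quad)
qed

lemma card_one_imp_ex1:
  assumes "card {x \<in> S. P x} = 1"
  shows "\<exists>!x. x \<in> S \<and> P x"
proof -
  obtain v where "{x \<in> S. P x} = {v}" using assms by (rule card_1_singletonE)
  then have "x \<in> S \<and> P x \<longleftrightarrow> x = v" for x by blast
  then show ?thesis by simp
qed

context plane_graph
begin

text \<open>The condition says that \<open>M\<close> is a symmetric matrix with entries \<open>0\<close> and \<open>1\<close> and
  \<open>M\<^sup>2 = J + q I\<close>.\<close>

definition polar :: bool where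
  "polar \<longleftrightarrow> (\<forall>i<n. \<delta> i = 0 \<or> \<delta> i = 1) \<and> (\<forall>i<n. \<forall>j<n. E i j = 0)"

lemma M_eq_of_bool:
  assumes "polar" "i < n" shows "M i j = of_bool (M i j = 1)"
  using assms a_cases[of i j] by (cases "i = j") (auto simp: polar_def M_off M_diag)

text \<open>The vertices serve both as points and as lines, with \<open>M\<close> as incidence matrix, and the
  polarity exchanges the two roles of a vertex.\<close>

lemma polar_imp_polarity_graph:
  assumes polar: "polar"
  shows "is_polarity_graph G q"
proof -
  let ?V = "vertices G"
  define d where "d = inv_into {..<n} e"
  have ed: "e (d v) = v" "d v < n" if "v \<in> ?V" for v
    using bij_betw_inv_into_right[OF e that] bij_betwE[OF bij_betw_inv_into[OF e]] that
    by (auto simp: d_def)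
  have de: "d (e i) = i" if "i < n" for i
    using e that by (simp add: d_def bij_betw_def)
  have eV: "e i \<in> ?V" if "i < n" for i using e that by (auto dest: bij_betwE)
  define Pl where "Pl = \<lparr>points = ?V, lines = ?V, incident = (\<lambda>x y. M (d x) (d y) = 1)\<rparr>"
  define \<phi> :: "'a + 'a \<Rightarrow> 'a + 'a" where "\<phi> z = (case z of Inl x \<Rightarrow> Inr x | Inr x \<Rightarrow> Inl x)" for z
  have sel: "points Pl = ?V" "lines Pl = ?V" "\<And>x y. incident Pl x y \<longleftrightarrow> M (d x) (d y) = 1"
    by (auto simp: Pl_def)
  have fV: "finite ?V" using simple by (simp add: simple_graph_def)
  have reindex: "card {v \<in> ?V. P (d v)} = card {i \<in> {..<n}. P i}" for P
  proof -
    have "{v \<in> ?V. P (d v)} = e ` {i \<in> {..<n}. P i}"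
      using ed de eV by force
    moreover have "inj_on e {i \<in> {..<n}. P i}" using e by (auto simp: bij_betw_def intro: inj_on_subset)
    ultimately show ?thesis by (simp add: card_image)
  qed
  have common: "card {m \<in> {..<n}. M m i = 1 \<and> M m j = 1} = 1" if ij: "i < n" "j < n" "i \<noteq> j" for i j
  proof -
    have "(\<Sum>m<n. M i m * M m j) = (\<Sum>m<n. of_bool (M m i = 1 \<and> M m j = 1))"
    proof (intro sum.cong refl)
      fix m assume "m \<in> {..<n}"
      then show "M i m * M m j = of_bool (M m i = 1 \<and> M m j = 1)"
        using M_eq_of_bool[OF polar, of m i] M_eq_of_bool[OF polar, of m j] M_sym[of i m] by auto
    qed
    also have "\<dots> = real (card {m \<in> {..<n}. M m i = 1 \<and> M m j = 1})"
      by (simp add: of_bool_def sum.If_cases Int_def)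
    moreover have "(\<Sum>m<n. M i m * M m j) = 1"
    proof -
      have "E i j = 0" using polar ij by (simp add: polar_def)
      then show ?thesis using ij by (simp add: E_def)
    qed
    ultimately show ?thesis by simp
  qed
  have line_card: "card {x \<in> points Pl. incident Pl x k} = q + 1" if "k \<in> lines Pl" for k
  proof -
    have dk: "d k < n" using that ed sel by simp
    have "card {x \<in> points Pl. incident Pl x k} = card {i \<in> {..<n}. M i (d k) = 1}"
      unfolding sel by (rule reindex)
    moreover have "(\<Sum>i<n. M (d k) i) = (\<Sum>i<n. of_bool (M i (d k) = 1))"
    proof (intro sum.cong refl)
      fix i assume "i \<in> {..<n}"
      then show "M (d k) i = of_bool (M i (d k) = 1)"
        using M_eq_of_bool[OF polar, of i "d k"] M_sym[of "d k" i] by auto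
    qed
    moreover have "\<dots> = real (card {i \<in> {..<n}. M i (d k) = 1})"
      by (simp add: of_bool_def sum.If_cases Int_def)
    ultimately have "real (card {x \<in> points Pl. incident Pl x k}) = real (q + 1)"
      using M_row_sum[OF dk] by simp
    then show ?thesis by simp
  qed
  have unique: "\<exists>!k. k \<in> ?V \<and> M (d k) (d x) = 1 \<and> M (d k) (d y) = 1"
    if "x \<in> ?V" "y \<in> ?V" "x \<noteq> y" for x y
  proof (rule card_one_imp_ex1)
    have "d x \<noteq> d y" using ed(1) that by metis
    then show "card {k \<in> ?V. M (d k) (d x) = 1 \<and> M (d k) (d y) = 1} = 1"
      using common[of "d x" "d y"] ed that reindex[of "\<lambda>k. M k (d x) = 1 \<and> M k (d y) = 1"] by simp
  qed
  have e01: "e 0 \<noteq> e 1" "0 < n" "1 < n" using e_inj[of 0 1] q2 by (auto simp: n_def)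
  have plane: "finite_projective_plane Pl"
  proof (rule finite_projective_planeI[of _ "e 0" "e 1"])
    fix x y assume "x \<in> points Pl" "y \<in> points Pl" "x \<noteq> y"
    then show "\<exists>!k. k \<in> lines Pl \<and> incident Pl x k \<and> incident Pl y k"
      using unique[of x y] M_sym unfolding sel by metis
  next
    fix x y assume "x \<in> lines Pl" "y \<in> lines Pl" "x \<noteq> y"
    then show "\<exists>!k. k \<in> points Pl \<and> incident Pl k x \<and> incident Pl k y"
      using unique[of x y] unfolding sel by simp
  next
    fix k assume "k \<in> lines Pl"
    then show "3 \<le> card {x \<in> points Pl. incident Pl x k}" using line_card q2 by simp
  qed (use fV sel eV e01 in auto)
  have ord: "plane_order Pl q" using line_card by (simp add: plane_order_def)
  have pol: "polarity Pl \<phi>"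
    unfolding polarity_def
  proof (intro conjI)
    show "bij_betw \<phi> (points Pl <+> lines Pl) (points Pl <+> lines Pl)"
      unfolding sel by (rule bij_betw_byWitness[where f' = \<phi>]) (auto simp: \<phi>_def)
    show "\<phi> ` Inl ` points Pl = Inr ` lines Pl" "\<phi> ` Inr ` lines Pl = Inl ` points Pl"
      by (simp_all add: sel \<phi>_def image_image)
    show "\<forall>z\<in>points Pl <+> lines Pl. \<phi> (\<phi> z) = z" by (auto simp: \<phi>_def)
    show "\<forall>x\<in>points Pl. \<forall>k\<in>lines Pl. incident Pl x k = incident Pl (projl (\<phi> (Inr k))) (projr (\<phi> (Inl x)))"
    proof (intro ballI)
      fix x k
      show "incident Pl x k = incident Pl (projl (\<phi> (Inr k))) (projr (\<phi> (Inl x)))"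
        by (simp add: sel \<phi>_def M_sym[of "d x"])
    qed
  qed
  have "graph_iso G (polarity_graph Pl \<phi>)"
    unfolding graph_iso_def
  proof (intro exI[of _ id] conjI ballI)
    show "bij_betw id (vertices G) (vertices (polarity_graph Pl \<phi>))"
      by (simp add: polarity_graph_def sel)
    fix u v assume uv: "u \<in> ?V" "v \<in> ?V"
    have "{u, v} \<in> edges (polarity_graph Pl \<phi>) \<longleftrightarrow> u \<noteq> v \<and> M (d u) (d v) = 1"
      using polarity_graph_adjacent_iff[OF pol, of u v] uv by (simp add: sel \<phi>_def)
    also have "\<dots> \<longleftrightarrow> {u, v} \<in> edges G"
    proof (cases "u = v")
      case True
      then show ?thesis using a_diag[of "d u"] ed(1)[OF uv(1)] by (simp add: a_def)
    next
      case False
      then have "d u \<noteq> d v" using ed(1) uv by metis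
      then show ?thesis using False ed(1) uv by (simp add: M_off a_def)
    qed
    finally show "{u, v} \<in> edges G \<longleftrightarrow> {id u, id v} \<in> edges (polarity_graph Pl \<phi>)" by simp
  qed
  then show ?thesis using is_polarity_graphI[OF plane ord pol] by blast
qed

text \<open>The relation \<open>J i j\<close> says that the point \<open>i\<close> lies on the polar line of the point \<open>j\<close>. A
  point on its own polar line loses one neighbour, so its deficiency is \<open>1\<close> and \<open>M\<close> is the
  matrix of \<open>J\<close>.\<close>

lemma polarity_graph_imp_polar:
  assumes "is_polarity_graph G q"
  shows "polar"
proof -
  obtain Pl :: "(nat, nat) incidence_structure" and \<phi> f where
    plane: "finite_projective_plane Pl" and ord: "plane_order Pl q" and pol: "polarity Pl \<phi>"
    and f: "bij_betw f (vertices G) (points Pl)"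
    and iso: "\<And>u v. u \<in> vertices G \<Longrightarrow> v \<in> vertices G \<Longrightarrow>
         {u, v} \<in> edges G \<longleftrightarrow> {f u, f v} \<in> edges (polarity_graph Pl \<phi>)"
    using assms unfolding is_polarity_graph_def graph_iso_def by (auto simp: polarity_graph_def)
  define p where "p i = f (e i)" for i
  define ln where "ln i = projr (\<phi> (Inl (p i)))" for i
  define J where "J i j \<longleftrightarrow> incident Pl (p i) (ln j)" for i j
  have p: "bij_betw p {..<n} (points Pl)"
    using bij_betw_trans[OF e f] by (simp add: p_def[abs_def] comp_def)
  have pP: "p i \<in> points Pl" if "i < n" for i using p that by (auto dest: bij_betwE)
  have p_inj: "p i = p j \<longleftrightarrow> i = j" if "i < n" "j < n" for i j
    using p that by (auto simp: bij_betw_def dest: inj_onD)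
  have ln: "ln i \<in> lines Pl" "\<phi> (Inl (p i)) = Inr (ln i)" "\<phi> (Inr (ln i)) = Inl (p i)" if "i < n" for i
    using polarity_point[OF pol pP[OF that]] by (metis ln_def sum.sel(2))+
  have ln_inj: "ln i \<noteq> ln j" if "i < n" "j < n" "i \<noteq> j" for i j
    using ln(3) that p_inj by (metis sum.inject(1))
  have J_sym: "J i j \<longleftrightarrow> J j i" if "i < n" "j < n" for i j
  proof -
    have "incident Pl (p i) (ln j) \<longleftrightarrow> incident Pl (projl (\<phi> (Inr (ln j)))) (projr (\<phi> (Inl (p i))))"
    proof -
      have "\<forall>x\<in>points Pl. \<forall>k\<in>lines Pl. incident Pl x k \<longleftrightarrow> incident Pl (projl (\<phi> (Inr k))) (projr (\<phi> (Inl x)))"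
        using pol by (simp add: polarity_def)
      then show ?thesis using pP[OF that(1)] ln(1)[OF that(2)] by blast
    qed
    then show ?thesis using ln that by (simp add: J_def)
  qed
  have reindex: "card {i \<in> {..<n}. P (p i)} = card {x \<in> points Pl. P x}" for P
  proof -
    have "{x \<in> points Pl. P x} = p ` {i \<in> {..<n}. P (p i)}"
      using p by (auto simp: bij_betw_def)
    moreover have "inj_on p {i \<in> {..<n}. P (p i)}" using p by (auto simp: bij_betw_def intro: inj_on_subset)
    ultimately show ?thesis by (simp add: card_image)
  qed
  have J_card: "(\<Sum>i<n. of_bool (J i j)) = real q + 1" if "j < n" for j
  proof -
    have "card {i \<in> {..<n}. J i j} = q + 1"
      unfolding J_def using reindex[of "\<lambda>x. incident Pl x (ln j)"] ord ln(1)[OF that]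
      by (simp add: plane_order_def)
    moreover have "(\<Sum>i<n. of_bool (J i j)) = real (card {i \<in> {..<n}. J i j})"
      by (simp add: of_bool_def sum.If_cases Int_def)
    ultimately show ?thesis by simp
  qed
  have aJ: "a i j = of_bool (J i j)" if "i < n" "j < n" "i \<noteq> j" for i j
  proof -
    have "e i \<in> vertices G" "e j \<in> vertices G" using e that by (auto dest: bij_betwE)
    then have "{e i, e j} \<in> edges G \<longleftrightarrow> {p i, p j} \<in> edges (polarity_graph Pl \<phi>)"
      unfolding p_def using iso by blast
    also have "\<dots> \<longleftrightarrow> J i j"
      using polarity_graph_adjacent_iff[OF pol pP pP] p_inj that by (simp add: J_def ln_def)
    finally show ?thesis by (simp add: a_def)
  qed
  have \<delta>J: "\<delta> i = of_bool (J i i)" if i: "i < n" for i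
  proof -
    have "(\<Sum>j<n. a i j) = (\<Sum>j<n. of_bool (J j i) - (if i = j then of_bool (J i i) else 0))"
      using i aJ J_sym a_diag by (intro sum.cong refl) auto
    then show ?thesis using i J_card[OF i] by (simp add: \<delta>_def sum_subtractf)
  qed
  have MJ: "M i j = of_bool (J i j)" if "i < n" "j < n" for i j
    using aJ \<delta>J that by (cases "i = j") (auto simp: M_off M_diag)
  have E0: "E i j = 0" if ij: "i < n" "j < n" for i j
  proof -
    have "(\<Sum>m<n. M i m * M m j) = (\<Sum>m<n. of_bool (J m i \<and> J m j))"
      using ij J_sym by (intro sum.cong refl) (auto simp: MJ)
    moreover have "(\<Sum>m<n. of_bool (J m i \<and> J m j)) = real (card {m \<in> {..<n}. J m i \<and> J m j})"
      by (simp add: of_bool_def sum.If_cases Int_def)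
    moreover have "card {m \<in> {..<n}. J m i \<and> J m j} = 1" if "i \<noteq> j"
    proof -
      have "\<exists>!x. x \<in> points Pl \<and> incident Pl x (ln i) \<and> incident Pl x (ln j)"
      proof -
        have "\<forall>k\<in>lines Pl. \<forall>m\<in>lines Pl. k \<noteq> m \<longrightarrow>
          (\<exists>!x. x \<in> points Pl \<and> incident Pl x k \<and> incident Pl x m)"
          using plane unfolding finite_projective_plane_def by (elim conjE)
        then show ?thesis using ln(1)[OF ij(1)] ln(1)[OF ij(2)] ln_inj[OF ij that] by simp
      qed
      then obtain x where "x \<in> points Pl \<and> incident Pl x (ln i) \<and> incident Pl x (ln j)"
        "\<And>y. y \<in> points Pl \<and> incident Pl y (ln i) \<and> incident Pl y (ln j) \<Longrightarrow> y = x" by (rule ex1E) blast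
      then have "{x \<in> points Pl. incident Pl x (ln i) \<and> incident Pl x (ln j)} = {x}" by blast
      then have "card {x \<in> points Pl. incident Pl x (ln i) \<and> incident Pl x (ln j)} = 1" by simp
      then show ?thesis unfolding J_def
        using reindex[of "\<lambda>x. incident Pl x (ln i) \<and> incident Pl x (ln j)"] by simp
    qed
    moreover have "(\<Sum>m<n. of_bool (J m i)) = real q + 1" by (rule J_card[OF ij(1)])
    ultimately show ?thesis by (cases "i = j") (auto simp: E_def)
  qed
  show ?thesis unfolding polar_def using \<delta>J E0 by auto
qed

end

section \<open>The bound\<close>

theorem theorem1p4:
  fixes q n :: nat and m\<^sub>q A\<^sub>q :: real and G :: "'a graph"
  assumes "q \<ge> 2"
    and "n = q ^ 2 + q + 1"
    and "m\<^sub>q = 1 / 2 * real q * (real q + 1) ^ 2"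
    and "A\<^sub>q = 1 / (2 * sqrt (real q)) *
               ln ((real q + 1 + sqrt (real q)) / (real q + 1 - sqrt (real q)))"
    and "simple_graph G"
    and "card (vertices G) = n"
    and "connected_graph G"
    and "C4_free G"
  shows "real (num_spanning_trees G)
           \<le> real n powr ((real n - 3) / 2) * exp (- 2 * A\<^sub>q * (m\<^sub>q - real (num_edges G))) \<and>
         (real (num_spanning_trees G)
           = real n powr ((real n - 3) / 2) * exp (- 2 * A\<^sub>q * (m\<^sub>q - real (num_edges G)))
          \<longleftrightarrow> is_polarity_graph G q)"
proof -
  have "finite (vertices G)" using assms(5) by (simp add: simple_graph_def)
  then obtain e where "bij_betw e {0..<card (vertices G)} (vertices G)"
    using ex_bij_betw_nat_finite by blast
  then have e: "bij_betw e {..<n} (vertices G)" using assms(6) by (simp add: lessThan_atLeast0)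
  interpret plane_graph q G e n
    by unfold_locales (use assms e in auto)
  have unit: "(\<Sum>i<n. (1 / sqrt (real n))\<^sup>2) = 1"
    using n_pos by (simp add: power_divide)
  have eigen: "(\<Sum>j<n. M i j * (1 / sqrt (real n))) = (real q + 1) * (1 / sqrt (real n))" if "i < n" for i
    by (simp only: sum_distrib_right[symmetric] M_row_sum[OF that])
  obtain u l where
    "\<And>i j. i < n \<Longrightarrow> j < n \<Longrightarrow> (\<Sum>k<n. u i k * u j k) = (if i = j then 1 else 0)"
    "\<And>i j. i < n \<Longrightarrow> j < n \<Longrightarrow> (\<Sum>k<n. u k i * u k j) = (if i = j then 1 else 0)"
    "\<And>i j. i < n \<Longrightarrow> j < n \<Longrightarrow> M i j = (\<Sum>k<n. l k * (u i k * u j k))"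
    "\<And>i. i < n \<Longrightarrow> u i 0 = 1 / sqrt (real n)" "l 0 = real q + 1"
    using symmetric_eigenbasis_extension[OF M_sym n_pos unit eigen] by blast
  then interpret plane_graph_spectrum q G e n u l
    by unfold_locales
  have "bound = real n powr ((real n - 3) / 2) * exp (- 2 * A\<^sub>q * (m\<^sub>q - real (num_edges G)))"
    unfolding bound_def A_def assms(3,4) by simp
  moreover have "is_polarity_graph G q \<longleftrightarrow> polar"
    using polar_imp_polarity_graph polarity_graph_imp_polar by blast
  ultimately show ?thesis
    using spanning_trees_bound unfolding polar_def by simp
qed

end
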